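(* Let $k\in\mathbb{N}$. Suppose $S\subseteq\mathbb{R}$ is discrete, $Y\subseteq\mathbb{R}^k$ is perfect, and $Z\subseteq\mathbb{R}\setminus\{0\}$ is $\sigma$-compact. If $\lambda Y$ is gap-rich with exceptional set $S$ for every $\lambda\in Z$, then for generic $\boldsymbol{y}\in\mathrm{LP}(\mathbb{Z},Y)$ and all $\lambda\in Z$, $\operatorname{spec}(H_{\lambda\boldsymbol{y}})$ is a Cantor set of zero Hausdorff dimension. (That is, there is one dense $G_\delta$ subset $\mathcal{G}$ of $\mathrm{LP}(\mathbb{Z},Y)$ such that the conclusion holds for every $\boldsymbol{y}\in\mathcal{G}$ and every $\lambda\in Z$.)
   Context: $\mathbb{N}=\{1,2,\ldots\}$; perfect means closed without isolated points; $\sigma$-compact means a countable union of compact sets; $\lambda Y=\{\lambda y:y\in Y\}$. $Y\subseteq\mathbb{R}^k$ carries the metric $d$ induced by a norm on $\mathbb{R}^k$. $Y^{\mathbb{Z}}$ carries the uniform metric $d(\boldsymbol{y},\boldsymbol{z})=\sup_j d(y_j,z_j)$. $\mathrm{Per}(\mathbb{Z},Y)$ is the set of periodic elements of $Y^{\mathbb{Z}}$ ($y_{j+q}=y_j$ for all $j$, for some $q\in\mathbb{N}$), and $\mathrm{LP}(\mathbb{Z},Y)$ is its closure in the uniform metric, a complete metric space. Words: $Y^\star=\bigcup_{p\ge1}Y^p$. For $\boldsymbol{x}\in Y^p$, $\boldsymbol{x}^{\sharp\mathbb{Z}}\in\mathrm{Per}(\mathbb{Z},Y)$ is the $p$-periodic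 sequence coinciding with $\boldsymbol{x}$ on $\{1,\ldots,p\}$. For words $\boldsymbol{x},\boldsymbol{y}\in Y^\star$ of possibly different lengths, $d(\boldsymbol{x},\boldsymbol{y}):=d(\boldsymbol{x}^{\sharp\mathbb{Z}},\boldsymbol{y}^{\sharp\mathbb{Z}})$. Operators: for bounded $\boldsymbol{y}=(y_j)_{j\in\mathbb{Z}}\in(\mathbb{R}^k)^{\mathbb{Z}}$ with $y_j=(y_j(1),\ldots,y_j(k))$, define $\boldsymbol{y}^\natural:\mathbb{Z}\to\mathbb{R}$ by $\boldsymbol{y}^\natural(jk+\ell)=y_j(\ell)$, $j\in\mathbb{Z}$, $1\le\ell\le k$, and let $H_{\boldsymbol{y}}$ be the discrete Schr\"odinger operator on $\ell^2(\mathbb{Z})$, $[H_{\boldsymbol{y}}\psi](n)=\psi(n-1)+\psi(n+1)+\boldsymbol{y}^\natural(n)\psi(n)$. For a word $\boldsymbol{x}\in(\mathbb{R}^k)^p$, $H_{\boldsymbol{x}}:=H_{\boldsymbol{x}^{\sharp\mathbb{Z}}}$. $\operatorname{spec}$ denotes the spectrum. Gap-rich set: a closed set $Y\subseteq\mathbb{R}^k$ without isolated points is gap-rich with exceptional set $S\subseteq\mathbb{R}$ if $S$ is discrete and for every $E\in\mathbb{R}\setminus S$, $\boldsymbol{x}\in Y^\star$ and $\varepsilon>0$ there exists $\boldsymbol{y}\in Y^\star$ with $d(\boldsymbol{x},\boldsymbol{y})<\varepsilon$ and $E\notin\operatorname{spec}(H_{\boldsymbol{y}})$. A Cantor set in $\mathbb{R}$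 here is a nonempty compact set without isolated points and with empty interior. *)

theory Defs
  imports "HOL-Analysis.Analysis"
begin

section \<open>Sequences and words over a subset of \<open>\<real>\<^sup>k\<close>\<close>

definition perfect :: "'a::topological_space set \<Rightarrow> bool" where
  "perfect Y \<longleftrightarrow> closed Y \<and> (\<forall>y\<in>Y. \<not> y isolated_in Y)"

definition sigma_compact :: "'a::topological_space set \<Rightarrow> bool" where
  "sigma_compact Z \<longleftrightarrow> (\<exists>C::nat \<Rightarrow> 'a set. (\<forall>n. compact (C n)) \<and> Z = (\<Union>n. C n))"

definition is_norm :: "('a::real_vector \<Rightarrow> real) \<Rightarrow> bool" where
  "is_norm N \<longleftrightarrow>
     (\<forall>u. 0 \<le> N u) \<and> (\<forall>u. N u = 0 \<longleftrightarrow> u = 0) \<and>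
     (\<forall>a u. N (a *\<^sub>R u) = \<bar>a\<bar> * N u) \<and> (\<forall>u v. N (u + v) \<le> N u + N v)"

definition norm_metric :: "('a::real_vector \<Rightarrow> real) \<Rightarrow> 'a set \<Rightarrow> 'a metric" where
  "norm_metric N Y = metric (Y, \<lambda>u v. N (u - v))"

text \<open>
  The points of \<^const>\<open>funspace\<close> are the bounded \<open>Y\<close>-valued sequences, with the supremum
  distance.  An unbounded sequence is at infinite distance from every periodic one, so restricting
  to bounded sequences does not change the closure of the periodic sequences.
\<close>

definition seq_metric :: "('a::real_vector \<Rightarrow> real) \<Rightarrow> 'a set \<Rightarrow> (int \<Rightarrow> 'a) metric" where
  "seq_metric N Y = funspace UNIV (norm_metric N Y)"

definition Per :: "'a set \<Rightarrow> (int \<Rightarrow> 'a) set" where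
  "Per Y = {y. range y \<subseteq> Y \<and> (\<exists>q::nat. q \<ge> 1 \<and> (\<forall>j. y (j + int q) = y j))}"

definition LP :: "('a::real_vector \<Rightarrow> real) \<Rightarrow> 'a set \<Rightarrow> (int \<Rightarrow> 'a) set" where
  "LP N Y = mtopology_of (seq_metric N Y) closure_of Per Y"

definition LP_topology :: "('a::real_vector \<Rightarrow> real) \<Rightarrow> 'a set \<Rightarrow> (int \<Rightarrow> 'a) topology" where
  "LP_topology N Y = subtopology (mtopology_of (seq_metric N Y)) (LP N Y)"

definition words :: "'a set \<Rightarrow> 'a list set" where
  "words Y = {x. x \<noteq> [] \<and> set x \<subseteq> Y}"

text \<open>The list entry \<open>x ! i\<close> is the letter in position \<open>i + 1\<close> of the word.\<close>

definition periodize :: "'a list \<Rightarrow> int \<Rightarrow> 'a" where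
  "periodize x = (\<lambda>j. x ! nat ((j - 1) mod int (length x)))"

definition word_dist :: "('a::real_vector \<Rightarrow> real) \<Rightarrow> 'a set \<Rightarrow> 'a list \<Rightarrow> 'a list \<Rightarrow> real" where
  "word_dist N Y x y = mdist (seq_metric N Y) (periodize x) (periodize y)"


section \<open>Discrete Schroedinger operators and spectra\<close>

definition l2 :: "(int \<Rightarrow> complex) set" where
  "l2 = {\<psi>. (\<lambda>n. (cmod (\<psi> n))\<^sup>2) summable_on UNIV}"

definition l2_norm :: "(int \<Rightarrow> complex) \<Rightarrow> real" where
  "l2_norm \<psi> = sqrt (\<Sum>\<^sub>\<infinity>n. (cmod (\<psi> n))\<^sup>2)"

definition bounded_operator_l2 :: "((int \<Rightarrow> complex) \<Rightarrow> (int \<Rightarrow> complex)) \<Rightarrow> bool" where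
  "bounded_operator_l2 T \<longleftrightarrow>
     (\<forall>\<psi>\<in>l2. T \<psi> \<in> l2) \<and>
     (\<forall>\<psi>\<in>l2. \<forall>\<phi>\<in>l2. \<forall>a b. T (\<lambda>n. a * \<psi> n + b * \<phi> n) = (\<lambda>n. a * T \<psi> n + b * T \<phi> n)) \<and>
     (\<exists>C. \<forall>\<psi>\<in>l2. l2_norm (T \<psi>) \<le> C * l2_norm \<psi>)"

definition spectrum_l2 :: "((int \<Rightarrow> complex) \<Rightarrow> (int \<Rightarrow> complex)) \<Rightarrow> complex set" where
  "spectrum_l2 T =
     {z. \<not> (\<exists>R. bounded_operator_l2 R \<and>
               (\<forall>\<psi>\<in>l2. R (\<lambda>n. T \<psi> n - z * \<psi> n) = \<psi> \<and> (\<lambda>n. T (R \<psi>) n - z * R \<psi> n) = \<psi>))}"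

definition schroedinger :: "(int \<Rightarrow> real) \<Rightarrow> (int \<Rightarrow> complex) \<Rightarrow> int \<Rightarrow> complex" where
  "schroedinger V \<psi> = (\<lambda>n. \<psi> (n - 1) + \<psi> (n + 1) + complex_of_real (V n) * \<psi> n)"

text \<open>
  The coordinates of \<open>\<real>\<^sup>k\<close> are indexed by a finite linearly ordered type with \<open>k\<close> elements; the
  \<open>\<ell>\<close>-th coordinate, for \<open>\<ell> = 1, \<dots>, k\<close>, is the one at the \<open>\<ell>\<close>-th smallest index.
\<close>

definition coord :: "real ^ 'k::{finite,linorder} \<Rightarrow> nat \<Rightarrow> real" where
  "coord v l = v $ (sorted_list_of_set (UNIV :: 'k set) ! (l - 1))"

text \<open>
  For \<open>k = CARD('k)\<close>, the unique way to write \<open>n = j * k + \<ell>\<close> with \<open>1 \<le> \<ell> \<le> k\<close> is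
  \<open>j = (n - 1) div k\<close> and \<open>\<ell> = (n - 1) mod k + 1\<close>.
\<close>

definition flatten :: "(int \<Rightarrow> real ^ 'k::{finite,linorder}) \<Rightarrow> int \<Rightarrow> real" where
  "flatten y = (\<lambda>n. coord (y ((n - 1) div int CARD('k))) (nat ((n - 1) mod int CARD('k) + 1)))"

definition H :: "(int \<Rightarrow> real ^ 'k::{finite,linorder}) \<Rightarrow> (int \<Rightarrow> complex) \<Rightarrow> int \<Rightarrow> complex" where
  "H y = schroedinger (flatten y)"

definition gap_rich ::
  "(real ^ 'k::{finite,linorder} \<Rightarrow> real) \<Rightarrow> (real ^ 'k::{finite,linorder}) set \<Rightarrow> real set \<Rightarrow> bool" where
  "gap_rich N Y S \<longleftrightarrow> perfect Y \<and> discrete S \<and>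
     (\<forall>E. E \<notin> S \<longrightarrow> (\<forall>x\<in>words Y. \<forall>\<epsilon>>0.
        \<exists>y\<in>words Y. word_dist N Y x y < \<epsilon> \<and> complex_of_real E \<notin> spectrum_l2 (H (periodize y))))"


section \<open>Cantor sets and Hausdorff dimension\<close>

definition cantor_set :: "real set \<Rightarrow> bool" where
  "cantor_set K \<longleftrightarrow> K \<noteq> {} \<and> compact K \<and> (\<forall>x\<in>K. \<not> x isolated_in K) \<and> interior K = {}"

text \<open>
  The exponent \<open>s\<close> is meant to be positive: \<open>0 powr 0 = 0\<close> in HOL, so \<open>s = 0\<close> does not give the
  counting measure.  Covers by bounded sets only, since \<^const>\<open>diameter\<close> is unspecified on
  unbounded ones.
\<close>

definition hausdorff_content :: "real \<Rightarrow> real \<Rightarrow> 'a::metric_space set \<Rightarrow> ennreal" where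
  "hausdorff_content s \<delta> A =
     (INF U \<in> {U::nat \<Rightarrow> 'a set. A \<subseteq> (\<Union>i. U i) \<and> (\<forall>i. bounded (U i) \<and> diameter (U i) \<le> \<delta>)}.
        \<Sum>i. ennreal (diameter (U i) powr s))"

definition hausdorff_measure :: "real \<Rightarrow> 'a::metric_space set \<Rightarrow> ennreal" where
  "hausdorff_measure s A = (SUP \<delta>\<in>{0<..}. hausdorff_content s \<delta> A)"

definition hausdorff_dim :: "'a::metric_space set \<Rightarrow> ennreal" where
  "hausdorff_dim A = Inf {ennreal s | s. s > 0 \<and> hausdorff_measure s A = 0}"


section \<open>Consistency of the metric encodings\<close>

lemma Metric_space_norm:
  assumes "is_norm N"
  shows "Metric_space Y (\<lambda>u v. N (u - v))"
proof
  fix u v w :: 'a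
  have "N (u - v) = N ((-1) *\<^sub>R (v - u))" by simp
  also have "\<dots> = N (v - u)" using assms unfolding is_norm_def by (metis abs_minus_cancel abs_one mult_1)
  finally show "N (u - v) = N (v - u)" .
  have "N ((u - v) + (v - w)) \<le> N (u - v) + N (v - w)" using assms unfolding is_norm_def by blast
  then show "N (u - w) \<le> N (u - v) + N (v - w)" by simp
qed (use assms in \<open>auto simp: is_norm_def\<close>)

lemma mspace_norm_metric: "is_norm N \<Longrightarrow> mspace (norm_metric N Y) = Y"
  and mdist_norm_metric: "is_norm N \<Longrightarrow> mdist (norm_metric N Y) = (\<lambda>u v. N (u - v))"
  by (simp_all add: norm_metric_def Metric_space_norm Metric_space.mspace_metric Metric_space.mdist_metric)

lemma Per_subset_mspace:
  assumes "is_norm N"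
  shows "Per Y \<subseteq> mspace (seq_metric N Y)"
proof
  fix y assume y: "y \<in> Per Y"
  interpret M: Metric_space Y "\<lambda>u v. N (u - v)" by (rule Metric_space_norm[OF assms])
  obtain q :: nat where q: "q \<ge> 1" "\<And>j. y (j + int q) = y j" using y by (auto simp: Per_def)
  have up: "y (j + int q * int m) = y j" for j m
    by (induction m arbitrary: j) (simp_all add: algebra_simps q(2) flip: add.assoc)
  have per: "y (j + int q * i) = y j" for i j
  proof (cases "i \<ge> 0")
    case True then show ?thesis using up[of j "nat i"] by simp
  next
    case False then show ?thesis using up[of "j + int q * i" "nat (- i)"] by simp
  qed
  have "y j = y (j mod int q)" for j
    using per[of "j mod int q" "j div int q"] by simp
  moreover have "j mod int q \<in> {0..<int q}" for j using q(1) by simp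
  ultimately have "range y \<subseteq> y ` {0..<int q}" by (metis image_eqI image_subsetI)
  then have fin: "finite (range y)" using finite_subset by blast
  have sub: "range y \<subseteq> Y" using y by (auto simp: Per_def)
  have "M.mbounded (range y)" using fin sub by (metis M.compactin_imp_mbounded M.topspace_mtopology finite_imp_compactin)
  then show "y \<in> mspace (seq_metric N Y)"
    using sub by (simp add: seq_metric_def mspace_norm_metric mdist_norm_metric assms M.fspace_def)
qed

end

theory Submission
  imports Defs
begin

text \<open>
  By Baire's theorem and the stability of spectra under small perturbations, it suffices to
  find, near any periodic sequence \<open>x\<close>, a periodic sequence \<open>z\<close> such that for all \<open>\<lambda>\<close> in a compact
  subset of \<open>Z\<close> the spectrum of \<open>H\<^bsub>\<lambda>z\<^esub>\<close> is covered by intervals of small total \<open>s\<close>-size. By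
  gap-richness and compactness, finitely many periodic sequences near \<open>x\<close> suffice to put every energy
  outside a small neighbourhood of \<open>S\<close> into a spectral gap of one of them. Concatenate long
  blocks of these sequences: on a block whose sequence has a gap at \<open>E\<close>, the transfer matrix is
  exponentially large, and this forces the derivative of the discriminant to be exponentially large on
  the spectrum. So the bands, whose number is at most the period, are exponentially short.
  Isolated points are excluded because far translates of an approximate eigenvector are approximate
  eigenvectors for the same energy, whereas eigenspaces are finite-dimensional.
\<close>

section \<open>Approximate spectrum of symmetric operators\<close>

text \<open>The spectral theorem is avoided: \<open>approx_spec\<close> collects the real
  approximate eigenvalues, and all that is needed follows from the fact that for symmetric
  \<open>A\<close> the distance from t to this set bounds A - t from below;
  \<open>spectrum_schroedinger\<close> identifies it with the spectrum. Two requirements shape the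
  construction. One sequence has to serve all couplings of a compact set at once, so compactness is
  applied to pairs (\<lambda>, E), not to energies alone. And the points of S, possibly infinitely
  many, must be surrounded before it is known which of them a finite subcover selects; hence radii
  with summable weights. The number of bands is linear in the number M of repetitions, while the
  growth rate per repetition does not depend on M. So M can be chosen last: a linear count times any
  fixed positive power of an exponentially small length tends to 0. Radii are doubled so that a
  cover survives a small change of the potential, which turns a property of one periodic sequence
  into a property of a whole ball around it.\<close>

definition approx_spec :: "('a::real_inner \<Rightarrow> 'a) \<Rightarrow> real set" where
  "approx_spec A = {t. \<forall>e>0. \<exists>x. norm x = 1 \<and> norm (A x - t *\<^sub>R x) < e}"

lemma not_approx_spec_bounded_below:
  fixes A :: "'a::real_inner \<Rightarrow> 'a"
  assumes "linear A" "t \<notin> approx_spec A"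
  obtains c where "c > 0" "\<And>x. c * norm x \<le> norm (A x - t *\<^sub>R x)"
proof -
  obtain c where c: "c > 0" "\<And>x. norm x = 1 \<Longrightarrow> c \<le> norm (A x - t *\<^sub>R x)"
    using assms(2) unfolding approx_spec_def by (auto simp: not_less)
  have "c * norm x \<le> norm (A x - t *\<^sub>R x)" for x
  proof (cases "x = 0")
    case False
    let ?u = "(1 / norm x) *\<^sub>R x"
    have "A ?u - t *\<^sub>R ?u = (1 / norm x) *\<^sub>R (A x - t *\<^sub>R x)"
      using assms(1) by (simp add: linear_cmul scaleR_diff_right)
    then have "norm (A ?u - t *\<^sub>R ?u) = norm (A x - t *\<^sub>R x) / norm x"
      by simp
    moreover have "c \<le> norm (A ?u - t *\<^sub>R ?u)" using False by (intro c(2)) simp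
    ultimately show ?thesis using False by (simp add: pos_le_divide_eq)
  qed simp
  with c(1) that show thesis by blast
qed

lemma approx_specD:
  assumes "t \<in> approx_spec A" "e > 0"
  obtains x where "norm x = 1" "norm (A x - t *\<^sub>R x) < e"
  using assms unfolding approx_spec_def by auto

lemma approx_spec_norm_le:
  assumes "\<And>x. norm (A x) \<le> M * norm x" "t \<in> approx_spec A"
  shows "\<bar>t\<bar> \<le> M"
proof (rule field_le_epsilon)
  fix e :: real assume "e > 0"
  then obtain x where x: "norm x = 1" "norm (A x - t *\<^sub>R x) < e" using approx_specD[OF assms(2)] by blast
  have "\<bar>t\<bar> = norm (t *\<^sub>R x)" using x by simp
  also have "\<dots> \<le> norm (A x) + norm (A x - t *\<^sub>R x)"
    by (metis add.commute norm_minus_commute norm_triangle_sub)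
  finally show "\<bar>t\<bar> \<le> M + e" using assms(1)[of x] x by simp
qed

lemma closed_approx_spec:
  assumes "linear A"
  shows "closed (approx_spec A)"
  unfolding closed_limpt
proof (intro allI impI)
  fix t assume t: "t islimpt approx_spec A"
  show "t \<in> approx_spec A"
    unfolding approx_spec_def
  proof (clarify)
    fix e :: real assume e: "e > 0"
    obtain s where s: "s \<in> approx_spec A" "dist s t < e / 2"
      using t e unfolding islimpt_approachable by (meson half_gt_zero)
    obtain x where x: "norm x = 1" "norm (A x - s *\<^sub>R x) < e / 2" using approx_specD[OF s(1)] e by (metis half_gt_zero)
    have "norm (A x - t *\<^sub>R x) = norm ((A x - s *\<^sub>R x) + (s - t) *\<^sub>R x)" by (simp add: algebra_simps)
    also have "\<dots> \<le> norm (A x - s *\<^sub>R x) + norm ((s - t) *\<^sub>R x)" by (rule norm_triangle_ineq)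
    also have "\<dots> < e" using x s(2) by (simp add: dist_real_def)
    finally show "\<exists>x. norm x = 1 \<and> norm (A x - t *\<^sub>R x) < e" using x by blast
  qed
qed

lemma norm_diff_scaleR_square:
  fixes u v :: "'a::real_inner"
  shows "(norm (u - c *\<^sub>R v))\<^sup>2 = (norm u)\<^sup>2 - 2 * c * inner v u + c\<^sup>2 * (norm v)\<^sup>2"
  unfolding power2_norm_eq_inner by (simp add: inner_diff inner_commute power2_eq_square algebra_simps)

text \<open>Lax-Milgram by Banach's fixed point theorem: solutions of \<open>B x = y\<close> are the
  fixed points of the map that adds a small multiple of \<open>y - B x\<close> to x, and coercivity
  makes this map a contraction.\<close>

lemma coercive_surj:
  fixes B :: "'a::{real_inner,banach} \<Rightarrow> 'a"
  assumes "bounded_linear B" "m > 0" and coer: "\<And>x. m * (norm x)\<^sup>2 \<le> inner (B x) x"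
  shows "\<exists>x. B x = y"
proof -
  interpret B: bounded_linear B by fact
  obtain K where K: "K > 0" "\<And>x. norm (B x) \<le> norm x * K" using B.pos_bounded by blast
  \<comment> \<open>The squared Lipschitz factor is at most 1 - 2 c m + c^2 b^2, which c = m / b^2
    minimises with value 1 - (m / b)^2. Taking b at least m keeps this nonnegative.\<close>
  define b where "b = max K m"
  define c where "c = m / b\<^sup>2"
  have b: "b > 0" "b \<ge> m" "b \<ge> K" using K by (auto simp: b_def)
  have bK: "norm (B x) \<le> b * norm x" for x
    using K(2)[of x] mult_right_mono[OF b(3), of "norm x"] by (simp add: mult.commute)
  have c0: "c > 0" using assms b by (simp add: c_def)
  define k where "k = sqrt (1 - (m / b)\<^sup>2)"
  have mb: "(m / b)\<^sup>2 \<le> 1" using b assms(2) by (simp add: power_le_one)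
  have mb0: "(m / b)\<^sup>2 > 0" using b(1) assms(2) by (metis divide_pos_pos zero_less_power)
  have k: "0 \<le> k" "k < 1" using mb mb0 by (auto simp: k_def)
  let ?T = "\<lambda>x. x + c *\<^sub>R (y - B x)"
  have "dist (?T x) (?T x') \<le> k * dist x x'" for x x'
  proof -
    define u where "u = x - x'"
    have e1: "?T x - ?T x' = u - c *\<^sub>R B u" by (simp add: u_def B.diff algebra_simps)
    moreover have "(norm (u - c *\<^sub>R B u))\<^sup>2 = (norm u)\<^sup>2 - 2 * c * inner (B u) u + c\<^sup>2 * (norm (B u))\<^sup>2"
      by (rule norm_diff_scaleR_square)
    moreover have "c\<^sup>2 * (norm (B u))\<^sup>2 \<le> c\<^sup>2 * (b\<^sup>2 * (norm u)\<^sup>2)"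
      using bK[of u] by (metis mult_left_mono norm_ge_zero power_mono power_mult_distrib zero_le_power2)
    moreover have "c * (m * (norm u)\<^sup>2) \<le> c * inner (B u) u" using coer[of u] c0 by simp
    moreover have "(norm u)\<^sup>2 - 2 * (c * (m * (norm u)\<^sup>2)) + c\<^sup>2 * (b\<^sup>2 * (norm u)\<^sup>2) = (k * norm u)\<^sup>2"
    proof -
      have "(k * norm u)\<^sup>2 = (1 - (m/b)\<^sup>2) * (norm u)\<^sup>2" using mb by (simp add: k_def power_mult_distrib)
      moreover have "c * m = (m/b)\<^sup>2" by (simp add: c_def power2_eq_square)
      moreover have "c\<^sup>2 * b\<^sup>2 = (m/b)\<^sup>2" using b by (simp add: c_def power2_eq_square)
      moreover have "(1 - (m/b)\<^sup>2) * (norm u)\<^sup>2 = (norm u)\<^sup>2 - (m/b)\<^sup>2 * (norm u)\<^sup>2" by (simp only: left_diff_distrib mult_1)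
      moreover have "c * (m * (norm u)\<^sup>2) = (m/b)\<^sup>2 * (norm u)\<^sup>2" "c\<^sup>2 * (b\<^sup>2 * (norm u)\<^sup>2) = (m/b)\<^sup>2 * (norm u)\<^sup>2"
        using calculation(2,3) by (simp_all only: mult.assoc[symmetric])
      ultimately show ?thesis by linarith
    qed
    ultimately have "(norm (?T x - ?T x'))\<^sup>2 \<le> (k * norm u)\<^sup>2" unfolding e1 by linarith
    then have "norm (?T x - ?T x') \<le> k * norm u" by (rule power2_le_imp_le) (intro mult_nonneg_nonneg k norm_ge_zero)
    then show ?thesis by (simp add: dist_norm u_def)
  qed
  then obtain x where "?T x = x" using banach_fix_type[OF k, of ?T] by blast
  then show ?thesis using c0 by auto
qed

locale symmetric_operator =
  fixes A :: "'a::real_inner \<Rightarrow> 'a"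
  assumes bounded_linear: "bounded_linear A"
    and symmetric: "inner (A x) y = inner x (A y)"
begin

lemma linear: "linear A"
  using bounded_linear bounded_linear.linear by blast

lemma shift: "symmetric_operator (\<lambda>x. A x - t *\<^sub>R x)"
proof (rule symmetric_operator.intro)
  show "bounded_linear (\<lambda>x. A x - t *\<^sub>R x)"
    by (intro bounded_linear_sub bounded_linear bounded_linear_scaleR_right)
qed (simp add: inner_diff symmetric)

lemma square: "symmetric_operator (\<lambda>x. A (A x))"
proof (rule symmetric_operator.intro)
  show "bounded_linear (\<lambda>x. A (A x))" by (rule bounded_linear_compose[OF bounded_linear bounded_linear])
qed (simp add: symmetric)

text \<open>Nonnegativity of the form is tested at x - (1/K) A x; the quadratic term there takes
  back at most half of what the cross term gains.\<close>

lemma nonneg_Cauchy_Schwarz: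
  assumes "\<And>x. 0 \<le> inner (A x) x" "K > 0" "\<And>x. norm (A x) \<le> K * norm x"
  shows "(norm (A x))\<^sup>2 \<le> K * inner (A x) x"
proof -
  have "0 \<le> inner (A (x - (1/K) *\<^sub>R A x)) (x - (1/K) *\<^sub>R A x)" by (rule assms)
  also have "\<dots> = inner (A x) x - 2 / K * (norm (A x))\<^sup>2 + inner (A (A x)) (A x) / K\<^sup>2"
    using linear symmetric[of "A x" x] unfolding power2_norm_eq_inner
    by (simp add: linear_diff linear_cmul inner_diff algebra_simps power2_eq_square)
  also have "inner (A (A x)) (A x) / K\<^sup>2 \<le> (norm (A x))\<^sup>2 / K"
  proof -
    have "inner (A (A x)) (A x) \<le> norm (A (A x)) * norm (A x)" by (rule norm_cauchy_schwarz)
    also have "\<dots> \<le> K * (norm (A x))\<^sup>2"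
      using assms(3)[of "A x"] mult_right_mono[OF assms(3)[of "A x"], of "norm (A x)"] by (simp add: power2_eq_square)
    finally show ?thesis using assms(2) by (simp add: field_simps power2_eq_square)
  qed
  finally show ?thesis using assms(2) by (simp add: field_simps)
qed

text \<open>
  If \<open>m\<close> is the infimum of \<open>\<parallel>(A - t) x\<parallel>\<close> over unit vectors, then \<open>(A - t)\<^sup>2 - m\<^sup>2\<close> is nonnegative
  but not bounded below, so one of its factors \<open>A - t \<plusminus> m\<close> is not bounded below either.
\<close>

lemma approx_spec_near:
  assumes "x0 \<noteq> 0" "norm (A x0 - t *\<^sub>R x0) \<le> r * norm x0"
  shows "\<exists>s\<in>approx_spec A. \<bar>s - t\<bar> \<le> r"
proof (rule ccontr)
  assume neg: "\<not> ?thesis"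
  define B where "B = (\<lambda>x. A x - t *\<^sub>R x)"
  interpret B: symmetric_operator B unfolding B_def by (rule shift)
  define U where "U = (\<lambda>x. norm (B x)) ` {x. norm x = 1}"
  define m where "m = Inf U"
  have bdd: "bdd_below U" unfolding U_def by (rule bdd_belowI[of _ 0]) auto
  let ?u = "(1 / norm x0) *\<^sub>R x0"
  have "B ?u = (1 / norm x0) *\<^sub>R B x0" using B.linear by (simp add: linear_cmul)
  then have "norm (B ?u) = norm (B x0) / norm x0" by simp
  moreover have "norm (B x0) \<le> r * norm x0" using assms(2) by (simp add: B_def)
  ultimately have "norm (B ?u) \<le> r" using assms(1) by (simp add: pos_divide_le_eq)
  moreover have "norm (B ?u) \<in> U" unfolding U_def using assms by simp
  ultimately have mr: "m \<le> r" and ne: "U \<noteq> {}" using cInf_lower[OF _ bdd] unfolding m_def by fastforce+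
  have m0: "m \<ge> 0" unfolding m_def using ne by (rule cInf_greatest) (auto simp: U_def)
  have mB: "m \<le> norm (B x)" if "norm x = 1" for x
    unfolding m_def using that by (intro cInf_lower[OF _ bdd]) (auto simp: U_def)
  have mB': "m * norm x \<le> norm (B x)" for x
  proof (cases "x = 0")
    case False
    have "B ((1 / norm x) *\<^sub>R x) = (1 / norm x) *\<^sub>R B x" using B.linear by (simp add: linear_cmul)
    then show ?thesis using mB[of "(1 / norm x) *\<^sub>R x"] False by (simp add: field_simps)
  qed simp
  have n1: "t + m \<notin> approx_spec A" and n2: "t - m \<notin> approx_spec A" using neg mr m0 by fastforce+
  obtain c1 where c1: "c1 > 0" "\<And>x. c1 * norm x \<le> norm (A x - (t + m) *\<^sub>R x)"
    using not_approx_spec_bounded_below[OF linear n1] by blast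
  obtain c2 where c2: "c2 > 0" "\<And>x. c2 * norm x \<le> norm (A x - (t - m) *\<^sub>R x)"
    using not_approx_spec_bounded_below[OF linear n2] by blast
  define C where "C = (\<lambda>x. B (B x) - m\<^sup>2 *\<^sub>R x)"
  interpret B2: symmetric_operator "\<lambda>x. B (B x)" by (rule B.square)
  interpret C: symmetric_operator C unfolding C_def by (rule B2.shift)
  obtain K where K: "K > 0" "\<And>x. norm (C x) \<le> K * norm x"
    using bounded_linear.pos_bounded[OF C.bounded_linear] by (metis mult.commute)
  have CB: "inner (C x) x = (norm (B x))\<^sup>2 - (m * norm x)\<^sup>2" for x
    by (simp add: C_def inner_diff B.symmetric[of "B x"] power2_norm_eq_inner power_mult_distrib)
  have C0: "0 \<le> inner (C x) x" for x
    unfolding CB using mB'[of x] m0 by (simp add: power_mono)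
  have Cbelow: "c1 * c2 * norm x \<le> norm (C x)" for x
  proof -
    let ?y = "A x - (t - m) *\<^sub>R x"
    have "C x = A ?y - (t + m) *\<^sub>R ?y"
      using linear by (simp add: C_def B_def linear_diff linear_add linear_cmul algebra_simps power2_eq_square)
    then have "c1 * norm ?y \<le> norm (C x)" using c1(2)[of ?y] by simp
    moreover have "c1 * (c2 * norm x) \<le> c1 * norm ?y" using c1(1) c2(2)[of x] by simp
    ultimately show ?thesis by simp
  qed
  \<comment> \<open>The lower bound on \<open>C\<close> and \<open>nonneg_Cauchy_Schwarz\<close>
    force the square of \<open>norm (B x)\<close> to be at least m^2 + d on all unit vectors,
    although m is the infimum of these norms.\<close>
  define d where "d = (c1 * c2)\<^sup>2 / K"
  have d: "d > 0" using c1 c2 K by (simp add: d_def)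
  have "m < sqrt (m\<^sup>2 + d)" using d m0 by (simp add: real_less_rsqrt)
  then obtain x where x: "norm x = 1" "norm (B x) < sqrt (m\<^sup>2 + d)"
    using cInf_lessD[OF ne] unfolding m_def U_def by fastforce
  have "(c1 * c2)\<^sup>2 \<le> (norm (C x))\<^sup>2"
    using Cbelow[of x] x c1(1) c2(1) by (intro power_mono) auto
  also have "\<dots> \<le> K * ((norm (B x))\<^sup>2 - m\<^sup>2)"
    using C.nonneg_Cauchy_Schwarz[OF C0 K, of x] x by (simp add: CB)
  finally have "m\<^sup>2 + d \<le> (norm (B x))\<^sup>2" using K by (simp add: d_def field_simps)
  then have "sqrt (m\<^sup>2 + d) \<le> norm (B x)" by (simp add: real_le_lsqrt)
  then show False using x(2) by simp
qed

text \<open>A vector violating the bound is an approximate eigenvector good enough for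
  \<open>approx_spec_near\<close> to produce a spectral point closer than \<open>r\<close> to
  \<open>t\<close>. This takes the place of the formula for the norm of the resolvent.\<close>

lemma approx_spec_gap:
  assumes "\<And>s. s \<in> approx_spec A \<Longrightarrow> r \<le> \<bar>s - t\<bar>"
  shows "r * norm x \<le> norm (A x - t *\<^sub>R x)"
proof (rule ccontr)
  assume neg: "\<not> ?thesis"
  then have x: "x \<noteq> 0" using linear by (auto simp: linear_0)
  define r' where "r' = norm (A x - t *\<^sub>R x) / norm x"
  obtain s where "s \<in> approx_spec A" "\<bar>s - t\<bar> \<le> r'" using approx_spec_near[of x t r'] x by (auto simp: r'_def)
  moreover have "r' < r" using neg x by (simp add: r'_def field_simps)
  ultimately show False using assms[of s] by linarith
qed

lemma approx_spec_nonempty: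
  assumes "(x0::'a) \<noteq> 0"
  shows "approx_spec A \<noteq> {}"
  using approx_spec_near[of x0 0 "norm (A x0) / norm x0"] assms by auto

text \<open>
  On the range of \<open>A - t\<close> the operator \<open>A - t\<close> is bounded below by \<open>d\<close>: by the gap around \<open>t\<close>,
  \<open>\<parallel>(A - t \<mp> d/2) x\<parallel> \<ge> (d/2) \<parallel>x\<parallel>\<close>, that is \<open>d \<bar>\<langle>(A - t) x, x\<rangle>\<bar> \<le> \<parallel>(A - t) x\<parallel>\<^sup>2\<close>, and polarization
  turns this into the claim.
\<close>

lemma isolated_approx_spec_range:
  assumes "d > 0" "approx_spec A \<inter> {t - d<..<t + d} \<subseteq> {t}"
  defines "B \<equiv> \<lambda>x. A x - t *\<^sub>R x"
  shows "d * norm (B x) \<le> norm (B (B x))"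
proof -
  interpret B: symmetric_operator B unfolding B_def by (rule shift)
  have gap: "d/2 * norm x \<le> norm (A x - (t + s) *\<^sub>R x)" if "\<bar>s\<bar> = d/2" for s x
  proof (rule approx_spec_gap)
    fix u assume u: "u \<in> approx_spec A"
    show "d/2 \<le> \<bar>u - (t + s)\<bar>"
    proof (rule ccontr)
      assume "\<not> ?thesis"
      then have "u \<in> {t - d<..<t + d}" "u \<noteq> t" using that by auto
      then show False using assms(2) u by blast
    qed
  qed
  have q: "2 * s * inner (B x) x \<le> (norm (B x))\<^sup>2" if "\<bar>s\<bar> = d/2" for s x
  proof -
    have "(d/2 * norm x)\<^sup>2 \<le> (norm (B x - s *\<^sub>R x))\<^sup>2"
      using gap[OF that, of x] assms(1) by (intro power_mono) (auto simp: B_def algebra_simps)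
    also have "\<dots> = (norm (B x))\<^sup>2 - 2 * s * inner (B x) x + s\<^sup>2 * (norm x)\<^sup>2"
      by (simp add: norm_diff_scaleR_square inner_commute)
    also have "s\<^sup>2 = (d/2)\<^sup>2" using that by (metis power2_abs)
    finally show ?thesis unfolding power_mult_distrib by linarith
  qed
  have q1: "d * inner (B x) x \<le> (norm (B x))\<^sup>2" for x using q[of "d/2" x] assms(1) by simp
  have q2: "- d * inner (B x) x \<le> (norm (B x))\<^sup>2" for x using q[of "-d/2" x] assms(1) by simp
  \<comment> \<open>With this choice \<open>d * inner (B x) y\<close> is the square of
    \<open>norm (B x)\<close> and \<open>d * norm (B y)\<close> is \<open>norm (B (B x))\<close>, so
    the polarized inequality compares exactly the two norms wanted.\<close>
  define y where "y = (1/d) *\<^sub>R B x"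
  have "d * inner (B (x + y)) (x + y) - d * inner (B (x - y)) (x - y) \<le> (norm (B (x + y)))\<^sup>2 + (norm (B (x - y)))\<^sup>2"
    using q1[of "x + y"] q2[of "x - y"] by simp
  also have "\<dots> = 2 * (norm (B x))\<^sup>2 + 2 * (norm (B y))\<^sup>2"
    using B.linear by (simp add: linear_add linear_diff power2_norm_eq_inner inner_diff inner_add)
  also have "d * inner (B (x + y)) (x + y) - d * inner (B (x - y)) (x - y) = 4 * d * inner (B x) y"
    using B.linear B.symmetric[of y x]
    by (simp add: linear_add linear_diff inner_diff inner_add algebra_simps inner_commute)
  finally have main: "4 * d * inner (B x) y \<le> 2 * (norm (B x))\<^sup>2 + 2 * (norm (B y))\<^sup>2" .
  have dy: "d * inner (B x) y = (norm (B x))\<^sup>2" using assms(1) by (simp add: y_def power2_norm_eq_inner)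
  have By: "B y = (1/d) *\<^sub>R B (B x)" unfolding y_def using B.linear by (simp add: linear_cmul)
  have "norm (B y) = norm (B (B x)) / d" using assms(1) by (simp add: By)
  then have "(norm (B x))\<^sup>2 \<le> (norm (B (B x)) / d)\<^sup>2" using main dy by simp
  then have "norm (B x) \<le> norm (B (B x)) / d" by (rule power2_le_imp_le) (use assms(1) in simp)
  then show ?thesis using assms(1) by (simp add: field_simps)
qed

end

text \<open>\<open>P x\<close> is the limit of the iterates \<open>(T ^^ n) x\<close> for T = 1 - (A
  - t)^2 / M^2, that is, the orthogonal projection onto the eigenspace. T fixes the kernel of A - t
  and, by \<open>isolated_approx_spec_range\<close>, contracts on its range; the resulting geometric
  series bounds x - P x by the residual.\<close>

lemma isolated_approx_spec_projection:
  fixes A :: "'a::{real_inner,banach} \<Rightarrow> 'a"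
  assumes "symmetric_operator A" "d > 0" "approx_spec A \<inter> {t - d<..<t + d} \<subseteq> {t}"
  obtains P C where "linear P" "C > 0" "\<And>x. A (P x) = t *\<^sub>R P x" "\<And>x. norm (x - P x) \<le> C * norm (A x - t *\<^sub>R x)"
proof -
  interpret A: symmetric_operator A by fact
  define B where "B = (\<lambda>x. A x - t *\<^sub>R x)"
  interpret B: symmetric_operator B unfolding B_def by (rule A.shift)
  have BB: "d * norm (B x) \<le> norm (B (B x))" for x
    unfolding B_def using A.isolated_approx_spec_range[OF assms(2,3)] by simp
  obtain M0 where M0: "M0 > 0" "\<And>x. norm (B x) \<le> norm x * M0"
    using bounded_linear.pos_bounded[OF B.bounded_linear] by blast
  define M where "M = max M0 d"
  have M: "M > 0" "M \<ge> d" "M \<ge> M0" using M0 by (auto simp: M_def)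
  have MB: "norm (B x) \<le> M * norm x" for x
    using M0(2)[of x] mult_right_mono[OF M(3), of "norm x"] by (simp add: mult.commute)
  define T where "T = (\<lambda>x. x - (1/M\<^sup>2) *\<^sub>R B (B x))"
  have linB: "linear B" by (rule B.linear)
  have linT: "linear T" unfolding T_def
    by (intro linear_compose_sub linear_ident linear_compose_scale_right linear_compose[OF linB linB, unfolded o_def])
  define k where "k = sqrt (1 - (d/M)\<^sup>2)"
  have dM: "(d / M)\<^sup>2 \<le> 1" using M assms(2) by (simp add: power_le_one)
  have dM0: "(d / M)\<^sup>2 > 0" using M(1) assms(2) by (metis divide_pos_pos zero_less_power)
  have k: "0 \<le> k" "k < 1" using dM dM0 by (auto simp: k_def)
  have TB: "T (B x) = B (T x)" for x
    unfolding T_def using linB by (simp add: linear_diff linear_cmul)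
  have Tn: "(T ^^ n) (B x) = B ((T ^^ n) x)" for n x by (induction n) (auto simp: TB)
  have contr: "norm (T (B x)) \<le> k * norm (B x)" for x
  proof -
    define u where "u = B x"
    have 1: "(norm (T u))\<^sup>2 = (norm u)\<^sup>2 - 2 * (1/M\<^sup>2) * inner (B (B u)) u + (1/M\<^sup>2)\<^sup>2 * (norm (B (B u)))\<^sup>2"
      by (simp add: T_def norm_diff_scaleR_square)
    have 2: "inner (B (B u)) u = (norm (B u))\<^sup>2" by (simp add: B.symmetric[of "B u"] power2_norm_eq_inner)
    have "(1/M\<^sup>2)\<^sup>2 * (norm (B (B u)))\<^sup>2 \<le> (1/M\<^sup>2)\<^sup>2 * (M * norm (B u))\<^sup>2"
      using MB[of "B u"] by (intro mult_left_mono power_mono) auto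
    also have "(1/M\<^sup>2)\<^sup>2 * (M * norm (B u))\<^sup>2 = (1/M\<^sup>2) * (norm (B u))\<^sup>2"
      using M by (simp add: power_mult_distrib field_simps power2_eq_square)
    finally have "(norm (T u))\<^sup>2 \<le> (norm u)\<^sup>2 - (1/M\<^sup>2) * (norm (B u))\<^sup>2"
      using 1 unfolding 2 by (simp only: mult.assoc)
    also have "\<dots> \<le> (norm u)\<^sup>2 - (1/M\<^sup>2) * (d * norm u)\<^sup>2"
      using BB[of x] assms(2) by (intro diff_left_mono mult_left_mono power_mono) (auto simp: u_def)
    also have "\<dots> = (k * norm u)\<^sup>2" 
    proof -
      have "(k * norm u)\<^sup>2 = (1 - (d/M)\<^sup>2) * (norm u)\<^sup>2" using dM by (simp add: k_def power_mult_distrib)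
      moreover have "(1 - (d/M)\<^sup>2) * (norm u)\<^sup>2 = (norm u)\<^sup>2 - (d/M)\<^sup>2 * (norm u)\<^sup>2" by (simp only: left_diff_distrib mult_1)
      moreover have "1/M\<^sup>2 * (d * norm u)\<^sup>2 = (d/M)\<^sup>2 * (norm u)\<^sup>2"
        by (simp only: power_mult_distrib power_divide times_divide_eq_left mult_1 mult.assoc)
      ultimately show ?thesis by linarith
    qed

    finally have "norm (T u) \<le> k * norm u" by (rule power2_le_imp_le) (intro mult_nonneg_nonneg k norm_ge_zero)
    then show ?thesis by (simp add: u_def)
  qed
  have bnd: "norm ((T ^^ n) (B x)) \<le> k ^ n * norm (B x)" for n x
  proof (induction n)
    case (Suc n)
    have "norm ((T ^^ Suc n) (B x)) \<le> k * norm ((T ^^ n) (B x))" using contr by (simp add: Tn)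
    also have "\<dots> \<le> k * (k ^ n * norm (B x))" using Suc k by (intro mult_left_mono) auto
    finally show ?case by simp
  qed simp
  have geo: "summable (\<lambda>n. k ^ n * norm (B x))" for x
    using k by (intro summable_mult2 summable_geometric) auto
  have smn: "summable (\<lambda>n. norm ((T ^^ n) (B x)))" for x
    using bnd by (intro summable_comparison_test'[OF geo[of x], of 0]) auto
  then have sm: "summable (\<lambda>n. (T ^^ n) (B x))" for x by (rule summable_norm_cancel)
  \<comment> \<open>\<open>B\<close> after S / M^2 is the identity on the range of \<open>B\<close>:
    since 1 - T = B^2 / M^2, the series telescopes.\<close>
  define S where "S = (\<lambda>x. \<Sum>n. (T ^^ n) (B x))"
  have linTn: "linear (T ^^ n)" for n
  proof (induction n)
    case 0 show ?case by (simp add: linear_id[unfolded id_def] id_def linear_ident)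
  next
    case (Suc n) show ?case using linear_compose[OF Suc linT] by (simp add: o_def)
  qed
  have linS: "linear S"
  proof
    fix x y and r :: real
    show "S (x + y) = S x + S y"
      unfolding S_def using linTn linB by (subst suminf_add[OF sm sm]) (simp add: linear_add)
    show "S (r *\<^sub>R x) = r *\<^sub>R S x"
      unfolding S_def using linTn linB bounded_linear.suminf[OF bounded_linear_scaleR_right sm, of r x] by (simp add: linear_cmul)
  qed
  have normS: "norm (S x) \<le> norm (B x) / (1 - k)" for x
  proof -
    have "norm (S x) \<le> (\<Sum>n. norm ((T ^^ n) (B x)))" unfolding S_def by (rule summable_norm[OF smn])
    also have "\<dots> \<le> (\<Sum>n. k ^ n * norm (B x))" by (intro suminf_le bnd smn geo)
    also have "\<dots> = norm (B x) / (1 - k)"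
      using k by (simp add: suminf_mult2[symmetric] suminf_geometric summable_geometric)
    finally show ?thesis .
  qed
  define P where "P = (\<lambda>x. x - (1/M\<^sup>2) *\<^sub>R S (B x))"
  have "linear P" unfolding P_def
    by (intro linear_compose_sub linear_ident linear_compose_scale_right linear_compose[OF linB linS, unfolded o_def])
  moreover have "B (P x) = 0" for x
  proof -
    have "(\<lambda>n. (T ^^ n) (B (B x))) sums S (B x)" unfolding S_def using sm by (rule summable_sums)
    then have "(\<lambda>n. B ((T ^^ n) (B (B x)))) sums B (S (B x))"
      by (rule bounded_linear.sums[OF B.bounded_linear])
    then have 1: "(\<lambda>n. (1/M\<^sup>2) *\<^sub>R B ((T ^^ n) (B (B x)))) sums ((1/M\<^sup>2) *\<^sub>R B (S (B x)))"
      by (rule sums_scaleR_right)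
    have "(1/M\<^sup>2) *\<^sub>R B ((T ^^ n) (B (B x))) = (T ^^ n) (B x) - (T ^^ Suc n) (B x)" for n
    proof -
      have "T z = z - (1/M\<^sup>2) *\<^sub>R B (B z)" for z by (simp add: T_def)
      from this[of "(T ^^ n) (B x)"] show ?thesis using Tn[of n "B x"] by simp
    qed
    moreover have "(\<lambda>n. (T ^^ n) (B x)) \<longlonglongrightarrow> 0" by (rule summable_LIMSEQ_zero[OF sm])
    ultimately have "(\<lambda>n. (1/M\<^sup>2) *\<^sub>R B ((T ^^ n) (B (B x)))) sums ((T ^^ 0) (B x) - 0)"
      using telescope_sums'[of "\<lambda>n. (T ^^ n) (B x)" 0] by simp
    with 1 have "(1/M\<^sup>2) *\<^sub>R B (S (B x)) = B x" using sums_unique2 by fastforce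
    then show ?thesis using linB by (simp add: P_def linear_diff linear_cmul)
  qed
  then have "A (P x) = t *\<^sub>R P x" for x by (simp add: B_def)
  moreover have "norm (x - P x) \<le> 1 / (M * (1 - k)) * norm (A x - t *\<^sub>R x)" for x
  proof -
    have "norm (x - P x) = (1/M\<^sup>2) * norm (S (B x))" by (simp add: P_def)
    also have "\<dots> \<le> (1/M\<^sup>2) * (norm (B (B x)) / (1 - k))" by (intro mult_left_mono normS) auto
    also have "\<dots> \<le> (1/M\<^sup>2) * (M * norm (B x) / (1 - k))"
      using MB k by (intro mult_left_mono divide_right_mono) auto
    finally show ?thesis using M by (simp add: B_def power2_eq_square field_simps)
  qed
  moreover have "1 / (M * (1 - k)) > 0" using M k by simp
  ultimately show thesis using that by blast
qed

section \<open>The Hilbert space of square-summable sequences\<close>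

lemma l2_iff_bounded: "\<psi> \<in> l2 \<longleftrightarrow> (\<exists>C. \<forall>F. finite F \<longrightarrow> (\<Sum>n\<in>F. (cmod (\<psi> n))\<^sup>2) \<le> C)"
proof
  assume "\<psi> \<in> l2"
  then have "(\<Sum>n\<in>F. (cmod (\<psi> n))\<^sup>2) \<le> (\<Sum>\<^sub>\<infinity>n. (cmod (\<psi> n))\<^sup>2)" if "finite F" for F
    using that by (intro finite_sum_le_infsum) (auto simp: l2_def)
  then show "\<exists>C. \<forall>F. finite F \<longrightarrow> (\<Sum>n\<in>F. (cmod (\<psi> n))\<^sup>2) \<le> C" by blast
next
  assume "\<exists>C. \<forall>F. finite F \<longrightarrow> (\<Sum>n\<in>F. (cmod (\<psi> n))\<^sup>2) \<le> C"
  then show "\<psi> \<in> l2" unfolding l2_def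
    by (auto intro!: nonneg_bdd_above_summable_on simp: bdd_above_def)
qed

lemma l2_dominated:
  assumes "\<psi> \<in> l2" "\<And>n. cmod (\<phi> n) \<le> K * cmod (\<psi> n)"
  shows "\<phi> \<in> l2"
  unfolding l2_def mem_Collect_eq
proof (rule summable_on_comparison_test)
  show "(\<lambda>n. K\<^sup>2 * (cmod (\<psi> n))\<^sup>2) summable_on UNIV"
    using assms(1) by (intro summable_on_cmult_right) (auto simp: l2_def)
  show "(cmod (\<phi> n))\<^sup>2 \<le> K\<^sup>2 * (cmod (\<psi> n))\<^sup>2" for n
    using power_mono[OF assms(2)[of n], of 2] by (simp add: power_mult_distrib)
qed auto

lemma l2_zero: "(\<lambda>n. 0) \<in> l2"
  by (simp add: l2_def)

lemma l2_add:
  assumes "\<psi> \<in> l2" "\<phi> \<in> l2"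
  shows "(\<lambda>n. \<psi> n + \<phi> n) \<in> l2"
  unfolding l2_def mem_Collect_eq
proof (rule summable_on_comparison_test)
  show "(\<lambda>n. 2 * (cmod (\<psi> n))\<^sup>2 + 2 * (cmod (\<phi> n))\<^sup>2) summable_on UNIV"
    using assms by (intro summable_on_add summable_on_cmult_right) (auto simp: l2_def)
  show "(cmod (\<psi> n + \<phi> n))\<^sup>2 \<le> 2 * (cmod (\<psi> n))\<^sup>2 + 2 * (cmod (\<phi> n))\<^sup>2" for n
  proof -
    have "(cmod (\<psi> n + \<phi> n))\<^sup>2 \<le> (cmod (\<psi> n) + cmod (\<phi> n))\<^sup>2"
      by (intro power_mono norm_triangle_ineq) auto
    also have "\<dots> \<le> 2 * (cmod (\<psi> n))\<^sup>2 + 2 * (cmod (\<phi> n))\<^sup>2"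
      using sum_squares_bound[of "cmod (\<psi> n)" "cmod (\<phi> n)"] by (simp add: power2_sum)
    finally show ?thesis .
  qed
qed auto

lemma l2_cmult: "\<psi> \<in> l2 \<Longrightarrow> (\<lambda>n. c * \<psi> n) \<in> l2"
  by (rule l2_dominated[of \<psi> _ "cmod c"]) (auto simp: norm_mult)

lemma l2_comb: "\<psi> \<in> l2 \<Longrightarrow> \<phi> \<in> l2 \<Longrightarrow> (\<lambda>n. a * \<psi> n + b * \<phi> n) \<in> l2"
  by (intro l2_add l2_cmult)

lemma l2_shift:
  assumes "\<psi> \<in> l2"
  shows "(\<lambda>n. \<psi> (n + k)) \<in> l2"
  using assms summable_on_reindex_bij_betw[of "\<lambda>n. n + k" UNIV UNIV "\<lambda>n. (cmod (\<psi> n))\<^sup>2"]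
  by (simp add: l2_def bij_plus_right[unfolded bij_def] bij_betw_def inj_on_def surj_plus_right)

text \<open>The sequences are complex, but the space is given its real structure: the inner product
  is the real part of the usual one, with the same norm, and multiplication by the imaginary unit
  returns as the operator \<open>imult\<close>.\<close>

typedef ell2 = l2
  using l2_zero by blast

setup_lifting type_definition_ell2

lemma summable_inner_l2:
  assumes "\<psi> \<in> l2" "\<phi> \<in> l2"
  shows "(\<lambda>n. inner (\<psi> n) (\<phi> n)) summable_on UNIV"
proof -
  have "(\<lambda>n. norm (inner (\<psi> n) (\<phi> n))) summable_on UNIV"
  proof (rule Infinite_Sum.abs_summable_on_comparison_test)
    show "(\<lambda>n. norm ((cmod (\<psi> n))\<^sup>2 + (cmod (\<phi> n))\<^sup>2)) summable_on UNIV"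
      using assms summable_on_add[of "\<lambda>n. (cmod (\<psi> n))\<^sup>2" UNIV "\<lambda>n. (cmod (\<phi> n))\<^sup>2"]
      by (simp add: l2_def)
    show "norm (inner (\<psi> n) (\<phi> n)) \<le> norm ((cmod (\<psi> n))\<^sup>2 + (cmod (\<phi> n))\<^sup>2)" for n
    proof -
      have "\<bar>inner (\<psi> n) (\<phi> n)\<bar> \<le> cmod (\<psi> n) * cmod (\<phi> n)" by (rule Cauchy_Schwarz_ineq2)
      also have "\<dots> \<le> (cmod (\<psi> n))\<^sup>2 + (cmod (\<phi> n))\<^sup>2"
        using sum_squares_bound[of "cmod (\<psi> n)" "cmod (\<phi> n)"] mult_nonneg_nonneg[OF norm_ge_zero[of "\<psi> n"] norm_ge_zero[of "\<phi> n"]]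
        by linarith
      finally show ?thesis by simp
    qed
  qed
  then show ?thesis by (rule abs_summable_summable)
qed

instantiation ell2 :: real_inner
begin

lift_definition zero_ell2 :: ell2 is "\<lambda>n. 0" by (rule l2_zero)
lift_definition plus_ell2 :: "ell2 \<Rightarrow> ell2 \<Rightarrow> ell2" is "\<lambda>f g n. f n + g n" by (rule l2_add)
lift_definition uminus_ell2 :: "ell2 \<Rightarrow> ell2" is "\<lambda>f n. - f n" by (simp add: l2_def)
lift_definition minus_ell2 :: "ell2 \<Rightarrow> ell2 \<Rightarrow> ell2" is "\<lambda>f g n. f n - g n"
  using l2_comb[of _ _ 1 "-1"] by simp
lift_definition scaleR_ell2 :: "real \<Rightarrow> ell2 \<Rightarrow> ell2" is "\<lambda>r f n. r *\<^sub>R f n"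
  using l2_cmult by (simp add: scaleR_conv_of_real)
lift_definition inner_ell2 :: "ell2 \<Rightarrow> ell2 \<Rightarrow> real" is "\<lambda>f g. \<Sum>\<^sub>\<infinity>n. inner (f n) (g n)" .
definition "norm (x :: ell2) = sqrt (inner x x)"
definition "dist (x :: ell2) y = norm (x - y)"
definition "sgn (x :: ell2) = inverse (norm x) *\<^sub>R x"
definition [code del]: "(uniformity :: (ell2 \<times> ell2) filter) = (INF e\<in>{0<..}. principal {(x, y). dist x y < e})"
definition [code del]: "open (U :: ell2 set) \<longleftrightarrow> (\<forall>x\<in>U. \<forall>\<^sub>F (x', y) in uniformity. x' = x \<longrightarrow> y \<in> U)"

instance
proof
  fix x y z :: ell2 and a b :: real
  show "x + y + z = x + (y + z)" "x + y = y + x" "0 + x = x" "- x + x = 0" "x - y = x + - y"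
    by (transfer; simp add: algebra_simps)+
  show "a *\<^sub>R (x + y) = a *\<^sub>R x + a *\<^sub>R y" "(a + b) *\<^sub>R x = a *\<^sub>R x + b *\<^sub>R x"
    "a *\<^sub>R b *\<^sub>R x = (a * b) *\<^sub>R x" "1 *\<^sub>R x = x"
    by (transfer; simp add: scaleR_add_right scaleR_add_left)+
  show "dist x y = norm (x - y)" by (rule dist_ell2_def)
  show "sgn x = inverse (norm x) *\<^sub>R x" by (rule sgn_ell2_def)
  show "(uniformity :: (ell2 \<times> ell2) filter) = (INF e\<in>{0<..}. principal {(x, y). dist x y < e})"
    by (rule uniformity_ell2_def)
  show "open U \<longleftrightarrow> (\<forall>x\<in>U. \<forall>\<^sub>F (x', y) in uniformity. x' = x \<longrightarrow> y \<in> U)" for U :: "ell2 set"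
    by (rule open_ell2_def)
  show "inner x y = inner y x" by transfer (simp add: inner_commute)
  show "inner (x + y) z = inner x z + inner y z"
    by transfer (simp add: inner_add_left infsum_add summable_inner_l2)
  show "inner (a *\<^sub>R x) y = a * inner x y"
    by transfer (simp add: infsum_cmult_right')
  show "0 \<le> inner x x" by transfer (simp add: infsum_nonneg)
  show "inner x x = 0 \<longleftrightarrow> x = 0"
  proof transfer
    fix x assume x: "x \<in> l2"
    show "(\<Sum>\<^sub>\<infinity>n. inner (x n) (x n)) = 0 \<longleftrightarrow> x = (\<lambda>n. 0)"
    proof
      assume "(\<Sum>\<^sub>\<infinity>n. inner (x n) (x n)) = 0"
      then have "inner (x n) (x n) = 0" for n
        using nonneg_infsum_le_0D[of "\<lambda>n. inner (x n) (x n)" UNIV n] summable_inner_l2[OF x x] by simp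
      then show "x = (\<lambda>n. 0)" by auto
    qed simp
  qed
  show "norm x = sqrt (inner x x)" by (rule norm_ell2_def)
qed

end

abbreviation ap :: "ell2 \<Rightarrow> int \<Rightarrow> complex" where "ap \<equiv> Rep_ell2"

lemma ap_l2: "ap x \<in> l2" using Rep_ell2 .

lemma ell2_eqI: "(\<And>n. ap x n = ap y n) \<Longrightarrow> x = y"
  by (metis Rep_ell2_inject ext)

lemma ap_simps [simp]:
  "ap 0 n = 0" "ap (x + y) n = ap x n + ap y n" "ap (x - y) n = ap x n - ap y n" "ap (- x) n = - ap x n"
  "ap (r *\<^sub>R x) n = of_real r * ap x n"
  by (transfer; simp add: scaleR_conv_of_real)+

lemma ap_sum: "ap (\<Sum>i\<in>I. f i) n = (\<Sum>i\<in>I. ap (f i) n)"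
  by (induction I rule: infinite_finite_induct) auto

lemma norm_ell2: "norm x = l2_norm (ap x)"
  by (simp add: norm_ell2_def inner_ell2.rep_eq l2_norm_def power2_norm_eq_inner)

lemma norm_ell2_square: "(norm x)\<^sup>2 = (\<Sum>\<^sub>\<infinity>n. (cmod (ap x n))\<^sup>2)"
  by (simp add: norm_ell2 l2_norm_def infsum_nonneg)

lemma ell2_summable: "(\<lambda>n. (cmod (ap x n))\<^sup>2) summable_on A"
  using ap_l2[of x] summable_on_subset_banach[of _ UNIV A] by (simp add: l2_def)

lemma ell2_sum_le: "finite F \<Longrightarrow> (\<Sum>n\<in>F. (cmod (ap x n))\<^sup>2) \<le> (norm x)\<^sup>2"
  unfolding norm_ell2_square by (intro finite_sum_le_infsum ell2_summable) auto

lemma ell2_norm_leI: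
  assumes "\<And>F. finite F \<Longrightarrow> (\<Sum>n\<in>F. (cmod (ap x n))\<^sup>2) \<le> c\<^sup>2" "c \<ge> 0"
  shows "norm x \<le> c"
proof -
  have "(norm x)\<^sup>2 \<le> c\<^sup>2" unfolding norm_ell2_square
    by (rule infsum_le_finite_sums[OF ell2_summable]) (use assms in auto)
  then show ?thesis using assms(2) by (rule power2_le_imp_le)
qed

lemma norm_ell2_mono:
  assumes "\<And>n. cmod (ap x n) \<le> cmod (ap y n)"
  shows "norm x \<le> norm y"
proof (rule ell2_norm_leI)
  fix F :: "int set" assume "finite F"
  have "(\<Sum>n\<in>F. (cmod (ap x n))\<^sup>2) \<le> (\<Sum>n\<in>F. (cmod (ap y n))\<^sup>2)"
    by (intro sum_mono power_mono assms) auto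
  also have "\<dots> \<le> (norm y)\<^sup>2" using \<open>finite F\<close> by (rule ell2_sum_le)
  finally show "(\<Sum>n\<in>F. (cmod (ap x n))\<^sup>2) \<le> (norm y)\<^sup>2" .
qed simp

lemma ap_le_norm: "cmod (ap x n) \<le> norm x"
  by (rule power2_le_imp_le) (use ell2_sum_le[of "{n}" x] in simp_all)

instance ell2 :: banach
proof
  fix X :: "nat \<Rightarrow> ell2"
  assume X: "Cauchy X"
  have "Cauchy (\<lambda>m. ap (X m) n)" for n
  proof (rule metric_CauchyI)
    fix e :: real assume "e > 0"
    then obtain M where M: "\<And>m k. m \<ge> M \<Longrightarrow> k \<ge> M \<Longrightarrow> dist (X m) (X k) < e" using X by (meson metric_CauchyD)
    have "dist (ap (X m) n) (ap (X k) n) < e" if "m \<ge> M" "k \<ge> M" for m k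
      using ap_le_norm[of "X m - X k" n] M[OF that] by (simp add: dist_norm)
    then show "\<exists>M. \<forall>m\<ge>M. \<forall>k\<ge>M. dist (ap (X m) n) (ap (X k) n) < e" by blast
  qed
  then have "\<exists>l. (\<lambda>m. ap (X m) n) \<longlonglongrightarrow> l" for n
    by (simp add: Cauchy_convergent_iff convergent_def)
  then obtain L where L: "\<And>n. (\<lambda>m. ap (X m) n) \<longlonglongrightarrow> L n" by metis
  have key: "\<exists>M. \<forall>m\<ge>M. \<forall>F. finite F \<longrightarrow> (\<Sum>n\<in>F. (cmod (ap (X m) n - L n))\<^sup>2) \<le> e\<^sup>2" if e: "e > 0" for e
  proof -
    obtain M where M: "\<And>m k. m \<ge> M \<Longrightarrow> k \<ge> M \<Longrightarrow> dist (X m) (X k) < e" using X e by (meson metric_CauchyD)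
    have "(\<Sum>n\<in>F. (cmod (ap (X m) n - L n))\<^sup>2) \<le> e\<^sup>2" if m: "m \<ge> M" and F: "finite F" for m F
    proof (rule tendsto_upperbound)
      show "(\<lambda>k. \<Sum>n\<in>F. (cmod (ap (X m) n - ap (X k) n))\<^sup>2) \<longlonglongrightarrow> (\<Sum>n\<in>F. (cmod (ap (X m) n - L n))\<^sup>2)"
        by (intro tendsto_intros L)
      show "\<forall>\<^sub>F k in sequentially. (\<Sum>n\<in>F. (cmod (ap (X m) n - ap (X k) n))\<^sup>2) \<le> e\<^sup>2"
      proof (rule eventually_sequentiallyI[of M])
        fix k assume k: "k \<ge> M"
        have "(\<Sum>n\<in>F. (cmod (ap (X m) n - ap (X k) n))\<^sup>2) \<le> (norm (X m - X k))\<^sup>2"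
          using ell2_sum_le[OF F, of "X m - X k"] by simp
        also have "\<dots> \<le> e\<^sup>2" using M[OF m k] by (intro power_mono) (auto simp: dist_norm)
        finally show "(\<Sum>n\<in>F. (cmod (ap (X m) n - ap (X k) n))\<^sup>2) \<le> e\<^sup>2" .
      qed
    qed simp
    then show ?thesis by blast
  qed
  obtain M where M: "\<And>m F. m \<ge> M \<Longrightarrow> finite F \<Longrightarrow> (\<Sum>n\<in>F. (cmod (ap (X m) n - L n))\<^sup>2) \<le> 1"
    using key[of 1] by auto
  have "(\<lambda>n. ap (X M) n - L n) \<in> l2" unfolding l2_iff_bounded using M[of M] by blast
  then have "L \<in> l2" using l2_comb[OF ap_l2[of "X M"], of "\<lambda>n. ap (X M) n - L n" 1 "-1"] by simp
  then have apL: "ap (Abs_ell2 L) = L" by (rule Abs_ell2_inverse)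
  have "X \<longlonglongrightarrow> Abs_ell2 L"
  proof (rule metric_LIMSEQ_I)
    fix e :: real assume e: "e > 0"
    obtain M where M: "\<And>m F. m \<ge> M \<Longrightarrow> finite F \<Longrightarrow> (\<Sum>n\<in>F. (cmod (ap (X m) n - L n))\<^sup>2) \<le> (e/2)\<^sup>2"
      using key[of "e/2"] e by auto
    have "dist (X m) (Abs_ell2 L) < e" if "m \<ge> M" for m
    proof -
      have "norm (X m - Abs_ell2 L) \<le> e/2"
        using M[OF that] e by (intro ell2_norm_leI) (auto simp: apL)
      then show ?thesis using e by (simp add: dist_norm)
    qed
    then show "\<exists>M. \<forall>m\<ge>M. dist (X m) (Abs_ell2 L) < e" by blast
  qed
  then show "convergent X" by (auto simp: convergent_def)
qed

lift_definition shift_ell2 :: "int \<Rightarrow> ell2 \<Rightarrow> ell2" is "\<lambda>k f n. f (n + k)"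
  by (rule l2_shift)

lemma ap_shift [simp]: "ap (shift_ell2 k x) n = ap x (n + k)"
  by transfer simp

lemma bij_int_plus: "bij_betw (\<lambda>n::int. n + k) UNIV UNIV"
  by (rule bij_betwI[where g = "\<lambda>n. n - k"]) auto

lemma inner_shift: "inner (shift_ell2 k x) y = inner x (shift_ell2 (- k) y)"
proof transfer
  fix k :: int and x y :: "int \<Rightarrow> complex"
  show "(\<Sum>\<^sub>\<infinity>n. inner (x (n + k)) (y n)) = (\<Sum>\<^sub>\<infinity>n. inner (x n) (y (n + - k)))"
    using infsum_reindex_bij_betw[OF bij_int_plus[of k], of "\<lambda>n. inner (x n) (y (n - k))"] by simp
qed

lemma norm_shift [simp]: "norm (shift_ell2 k x) = norm x"
proof -
  have "shift_ell2 (- k) (shift_ell2 k x) = x" by (rule ell2_eqI) simp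
  then show ?thesis using inner_shift[of k x "shift_ell2 k x"] by (simp add: norm_eq_sqrt_inner)
qed

lift_definition imult :: "ell2 \<Rightarrow> ell2" is "\<lambda>f n. \<i> * f n"
  by (rule l2_cmult)

lemma ap_imult [simp]: "ap (imult x) n = \<i> * ap x n"
  by transfer simp

lemma inner_imult: "inner (imult x) y = - inner x (imult y)"
proof transfer
  fix x y :: "int \<Rightarrow> complex"
  have "(\<Sum>\<^sub>\<infinity>n. inner (\<i> * x n) (y n)) = (\<Sum>\<^sub>\<infinity>n. - inner (x n) (\<i> * y n))"
    by (rule infsum_cong) (simp add: inner_complex_def)
  then show "(\<Sum>\<^sub>\<infinity>n. inner (\<i> * x n) (y n)) = - (\<Sum>\<^sub>\<infinity>n. inner (x n) (\<i> * y n))"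
    by (simp add: infsum_uminus)
qed

lemma norm_imult [simp]: "norm (imult x) = norm x"
proof -
  have "imult (imult x) = - x" by (rule ell2_eqI) simp
  then show ?thesis using inner_imult[of x "imult x"] by (simp add: norm_eq_sqrt_inner)
qed

section \<open>Spectra of Schroedinger operators\<close>

text \<open>For unbounded \<open>V\<close> the image may leave \<open>l2\<close>, where
  \<open>Abs_ell2\<close> is unspecified; hence the boundedness hypotheses on potentials.\<close>

definition schr :: "(int \<Rightarrow> real) \<Rightarrow> ell2 \<Rightarrow> ell2" where
  "schr V x = Abs_ell2 (schroedinger V (ap x))"

abbreviation sspec :: "(int \<Rightarrow> real) \<Rightarrow> real set" where
  "sspec V \<equiv> approx_spec (schr V)"

lemma bounded_range_real: "bounded (range V) \<longleftrightarrow> (\<exists>K>0. \<forall>n. \<bar>V n :: real\<bar> \<le> K)"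
  unfolding bounded_pos by auto

lemma schroedinger_l2:
  assumes "bounded (range V)" "\<psi> \<in> l2"
  shows "schroedinger V \<psi> \<in> l2"
proof -
  obtain K where "\<And>n. \<bar>V n\<bar> \<le> K" using assms(1) bounded_range_real by blast
  then have "(\<lambda>n. complex_of_real (V n) * \<psi> n) \<in> l2"
    by (intro l2_dominated[OF assms(2), of _ K]) (auto simp: norm_mult intro!: mult_right_mono)
  then show ?thesis
    using l2_add[OF l2_add[OF l2_shift[OF assms(2), of "-1"] l2_shift[OF assms(2), of 1]]]
    by (simp add: schroedinger_def)
qed

lemma ap_schr:
  assumes "bounded (range V)"
  shows "ap (schr V x) n = ap x (n - 1) + ap x (n + 1) + complex_of_real (V n) * ap x n"
  unfolding schr_def using Abs_ell2_inverse[OF schroedinger_l2[OF assms ap_l2[of x]]] by (simp add: schroedinger_def)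

lemma norm_schr_diff:
  assumes "bounded (range V)" "bounded (range W)" "\<And>n. \<bar>V n - W n\<bar> \<le> d"
  shows "norm (schr V x - schr W x) \<le> d * norm x"
proof -
  have d: "d \<ge> 0" using assms(3)[of 0] by linarith
  have "norm (schr V x - schr W x) \<le> norm (d *\<^sub>R x)"
  proof (rule norm_ell2_mono)
    fix n
    have "ap (schr V x - schr W x) n = complex_of_real (V n - W n) * ap x n"
      by (simp add: ap_schr assms algebra_simps)
    then show "cmod (ap (schr V x - schr W x) n) \<le> cmod (ap (d *\<^sub>R x) n)"
      using assms(3)[of n] d by (simp add: norm_mult mult_right_mono flip: of_real_diff)
  qed
  then show ?thesis using d by simp
qed

lemma norm_schr_le:
  assumes "\<And>n. \<bar>V n\<bar> \<le> K"
  shows "norm (schr V x) \<le> (K + 2) * norm x"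
proof -
  have b: "bounded (range V)" using assms by (auto simp: bounded_iff)
  have eq: "schr (\<lambda>n. 0) x = shift_ell2 (-1) x + shift_ell2 1 x"
    by (rule ell2_eqI) (simp add: ap_schr)
  have "norm (schr V x) \<le> norm (schr V x - schr (\<lambda>n. 0) x) + norm (shift_ell2 (-1) x + shift_ell2 1 x)"
    unfolding eq[symmetric] by (metis norm_triangle_sub add.commute)
  also have "\<dots> \<le> K * norm x + (norm x + norm x)"
    using norm_triangle_ineq[of "shift_ell2 (-1) x" "shift_ell2 1 x"] norm_schr_diff[OF b, of "\<lambda>n. 0" K x] assms
    by (intro add_mono) auto
  finally show ?thesis by (simp add: algebra_simps)
qed

lemma symmetric_operator_schr:
  assumes "bounded (range V)"
  shows "symmetric_operator (schr V)"
proof (rule symmetric_operator.intro)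
  obtain K where K: "\<And>n. \<bar>V n\<bar> \<le> K" using assms bounded_range_real by blast
  show "bounded_linear (schr V)"
  proof (rule bounded_linear_intro)
    show "norm (schr V x) \<le> norm x * (K + 2)" for x using norm_schr_le[OF K] by (simp add: mult.commute)
  qed (auto intro!: ell2_eqI simp: ap_schr assms algebra_simps)
  fix x y
  \<comment> \<open>Multiplication by \<open>V\<close>, expressed inside \<open>ell2\<close> as what
    remains after removing the two shifts, which are adjoint to each other.\<close>
  define M where "M = (\<lambda>x. schr V x - shift_ell2 (-1) x - shift_ell2 1 x)"
  have apM: "ap (M x) n = complex_of_real (V n) * ap x n" for x n
    by (simp add: M_def ap_schr assms)
  have "inner (M x) y = inner x (M y)"
    unfolding inner_ell2.rep_eq by (rule infsum_cong) (simp add: apM inner_complex_def algebra_simps)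
  then show "inner (schr V x) y = inner x (schr V y)"
    using inner_shift[of 1 x y] inner_shift[of "-1" x y] by (simp add: M_def inner_diff)
qed

lemma closed_sspec: "bounded (range V) \<Longrightarrow> closed (sspec V)"
  using closed_approx_spec symmetric_operator.linear symmetric_operator_schr by blast

lemma sspec_bounded:
  assumes "\<And>n. \<bar>V n\<bar> \<le> K" "E \<in> sspec V"
  shows "\<bar>E\<bar> \<le> K + 2"
  using approx_spec_norm_le norm_schr_le assms by blast

lemma compact_sspec:
  assumes "bounded (range V)"
  shows "compact (sspec V)"
proof -
  obtain K where "\<And>n. \<bar>V n\<bar> \<le> K" using assms bounded_range_real by blast
  then have "bounded (sspec V)" unfolding bounded_iff using sspec_bounded by (metis real_norm_def)
  then show ?thesis using closed_sspec[OF assms] by (simp add: compact_eq_bounded_closed)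
qed

lift_definition delta_ell2 :: ell2 is "\<lambda>n. if n = 0 then 1 else 0"
  unfolding l2_iff_bounded
proof (intro exI allI impI)
  fix F :: "int set" assume "finite F"
  have "(\<Sum>n\<in>F. (cmod (if n = 0 then 1 else 0))\<^sup>2) = (\<Sum>n\<in>F. if n = 0 then 1 else 0 :: real)"
    by (rule sum.cong) auto
  also have "\<dots> \<le> 1" using \<open>finite F\<close> by simp
  finally show "(\<Sum>n\<in>F. (cmod (if n = 0 then 1 else 0))\<^sup>2) \<le> 1" .
qed

lemma sspec_nonempty:
  assumes "bounded (range V)"
  shows "sspec V \<noteq> {}"
proof -
  have "ap delta_ell2 0 \<noteq> ap 0 0" by (simp add: delta_ell2.rep_eq)
  then show ?thesis using symmetric_operator.approx_spec_nonempty[OF symmetric_operator_schr[OF assms]] by metis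
qed

text \<open>An approximate eigenvector for \<open>V\<close> is one for \<open>W\<close> up to an
  error d. By compactness the distance from E to \<open>sspec W\<close> is attained, so if every
  point were farther than d there would be room left for the error.\<close>

lemma sspec_perturb:
  assumes "bounded (range V)" "bounded (range W)" "\<And>n. \<bar>V n - W n\<bar> \<le> d" "E \<in> sspec V"
  shows "\<exists>E'\<in>sspec W. \<bar>E' - E\<bar> \<le> d"
proof (rule ccontr)
  assume neg: "\<not> ?thesis"
  interpret W: symmetric_operator "schr W" by (rule symmetric_operator_schr[OF assms(2)])
  have "compact ((\<lambda>s. \<bar>s - E\<bar>) ` sspec W)"
    by (intro compact_continuous_image continuous_intros compact_sspec assms)
  moreover have "(\<lambda>s. \<bar>s - E\<bar>) ` sspec W \<noteq> {}" using sspec_nonempty[OF assms(2)] by simp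
  ultimately obtain r where r: "r \<in> (\<lambda>s. \<bar>s - E\<bar>) ` sspec W" "\<And>s. s \<in> sspec W \<Longrightarrow> r \<le> \<bar>s - E\<bar>"
    by (metis (no_types, lifting) compact_attains_inf image_eqI)
  have rd: "r > d" using r(1) neg by force
  obtain x where x: "norm x = 1" "norm (schr V x - E *\<^sub>R x) < r - d" using approx_specD[OF assms(4), of "r - d"] rd by auto
  have "r \<le> norm (schr W x - E *\<^sub>R x)" using W.approx_spec_gap[of r E x] r(2) x(1) by simp
  also have "\<dots> \<le> norm (schr V x - E *\<^sub>R x) + norm (schr V x - schr W x)"
    by (metis (no_types, opaque_lifting) norm_minus_commute norm_triangle_ineq diff_add_cancel add_diff_eq add.commute diff_add_eq norm_triangle_sub diff_diff_eq2)
  also have "norm (schr V x - schr W x) \<le> d" using norm_schr_diff[OF assms(1-3), of x] x by simp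
  finally show False using x by simp
qed

text \<open>Let z = a + i b and B = H - a. As B commutes with multiplication by i, the vectors B x
  and i x are orthogonal in the real inner product, so the squared norm of (H - z) x is that of B x
  plus b^2 times that of x. This bounds H - z from below when b is nonzero; for b = 0 the bound
  comes from \<open>a\<close> not being an approximate eigenvalue.\<close>

lemma spectrum_schroedinger:
  assumes V: "bounded (range V)"
  shows "spectrum_l2 (schroedinger V) = complex_of_real ` sspec V"
proof -
  interpret S: symmetric_operator "schr V" by (rule symmetric_operator_schr[OF V])
  have apS: "ap (schr V x) = schroedinger V (ap x)" for x
    unfolding schr_def by (rule Abs_ell2_inverse[OF schroedinger_l2[OF V ap_l2]])
  have "z \<notin> spectrum_l2 (schroedinger V)" if z: "z \<notin> complex_of_real ` sspec V" for z
  proof -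
    define a b where "a = Re z" and "b = Im z"
    define B where "B = (\<lambda>x. schr V x - a *\<^sub>R x)"
    interpret B: symmetric_operator B unfolding B_def by (rule S.shift)
    define A where "A = (\<lambda>x. B x - b *\<^sub>R imult x)"
    define A' where "A' = (\<lambda>x. B x + b *\<^sub>R imult x)"
    have BJ: "B (imult x) = imult (B x)" for x
      by (rule ell2_eqI) (simp add: B_def ap_schr V algebra_simps)
    have orth: "inner (B x) (imult x) = 0" for x
    proof -
      have "inner (B x) (imult x) = inner x (imult (B x))" by (simp add: B.symmetric BJ)
      also have "\<dots> = - inner (B x) (imult x)" using inner_imult[of x "B x"] by (simp add: inner_commute)
      finally show ?thesis by simp
    qed
    have normA: "(norm (A x))\<^sup>2 = (norm (B x))\<^sup>2 + b\<^sup>2 * (norm x)\<^sup>2"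
      and normA': "(norm (A' x))\<^sup>2 = (norm (B x))\<^sup>2 + b\<^sup>2 * (norm x)\<^sup>2" for x
      using orth[of x] arg_cong[OF norm_imult[of x], of "\<lambda>r. r\<^sup>2"]
      unfolding A_def A'_def power2_norm_eq_inner
      by (simp_all add: inner_diff inner_add inner_commute power2_eq_square)
    obtain m where m: "m > 0" "\<And>x. (m * norm x)\<^sup>2 \<le> (norm (B x))\<^sup>2 + b\<^sup>2 * (norm x)\<^sup>2"
    proof (cases "b = 0")
      case True
      then have "a \<notin> sspec V" using z by (auto simp: a_def b_def complex_eq_iff image_iff)
      then obtain c where "c > 0" "\<And>x. c * norm x \<le> norm (B x)"
        using not_approx_spec_bounded_below[OF S.linear] unfolding B_def by blast
      then show ?thesis using that[of c] by (simp add: power_mono True)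
    next
      case False
      then show ?thesis using that[of "\<bar>b\<bar>"] by (simp add: power_mult_distrib)
    qed
    have blJ: "bounded_linear imult"
      by (rule bounded_linear_intro[of _ 1]) (auto intro!: ell2_eqI simp: algebra_simps)
    have blA: "bounded_linear A" unfolding A_def
      by (intro bounded_linear_sub B.bounded_linear bounded_linear_compose[OF bounded_linear_scaleR_right blJ])
    have blA': "bounded_linear A'" unfolding A'_def
      by (intro bounded_linear_add B.bounded_linear bounded_linear_compose[OF bounded_linear_scaleR_right blJ])
    have adj: "inner (A x) y = inner x (A' y)" for x y
      by (simp add: A_def A'_def inner_diff inner_add B.symmetric inner_imult)
    have low: "m * norm x \<le> norm (A x)" for x
      by (rule power2_le_imp_le) (use m(2)[of x] normA[of x] in auto)
    have surj: "\<exists>x. A x = y" for y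
    proof -
      \<comment> \<open>\<open>A'\<close> is the adjoint of \<open>A\<close>, so the form of the
        product at x is the square of \<open>norm (A' x)\<close>. The product is therefore coercive
        even where the form of \<open>A\<close> is indefinite.\<close>
      have "\<exists>x. A (A' x) = y"
      proof (rule coercive_surj)
        show "bounded_linear (\<lambda>x. A (A' x))" by (rule bounded_linear_compose[OF blA blA'])
        show "m\<^sup>2 > 0" using m by simp
        show "m\<^sup>2 * (norm x)\<^sup>2 \<le> inner (A (A' x)) x" for x
          using m(2)[of x] normA'[of x] by (simp add: adj power2_norm_eq_inner power_mult_distrib)
      qed
      then show ?thesis by blast
    qed
    have apA: "ap (A x) n = schroedinger V (ap x) n - z * ap x n" for x n
    proof -
      have "z = of_real a + \<i> * of_real b" unfolding a_def b_def by (rule complex_eq)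
      then have "z * ap x n = of_real a * ap x n + of_real b * (\<i> * ap x n)" by (simp add: algebra_simps)
      then show ?thesis by (simp add: A_def B_def apS)
    qed
    have inj: "x = y" if "A x = A y" for x y
    proof -
      have "A (x - y) = 0" using that bounded_linear.linear[OF blA] by (simp add: linear_diff)
      then show ?thesis using low[of "x - y"] m(1) by (simp add: mult_le_0_iff)
    qed
    define R where "R = (\<lambda>\<psi>. ap (inv A (Abs_ell2 \<psi>)))"
    have AinvA: "A (inv A y) = y" for y using surj by (metis f_inv_into_f rangeI)
    have Rsol: "(\<lambda>n. schroedinger V (R \<psi>) n - z * R \<psi> n) = \<psi>" if "\<psi> \<in> l2" for \<psi>
      using apA[of "inv A (Abs_ell2 \<psi>)"] unfolding R_def AinvA Abs_ell2_inverse[OF that] by auto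
    have Runiq: "R \<psi> = \<phi>" if "\<psi> \<in> l2" "\<phi> \<in> l2" "(\<lambda>n. schroedinger V \<phi> n - z * \<phi> n) = \<psi>" for \<psi> \<phi>
    proof -
      have "ap (A (Abs_ell2 \<phi>)) = \<psi>" using that by (intro ext) (auto simp: apA Abs_ell2_inverse)
      then have "A (Abs_ell2 \<phi>) = Abs_ell2 \<psi>" by (metis Rep_ell2_inverse)
      then have "inv A (Abs_ell2 \<psi>) = Abs_ell2 \<phi>" using AinvA inj by metis
      then show ?thesis by (simp add: R_def Abs_ell2_inverse that)
    qed
    have Rl2: "R \<psi> \<in> l2" for \<psi> unfolding R_def by (rule ap_l2)
    have "bounded_operator_l2 R" unfolding bounded_operator_l2_def
    proof (intro conjI ballI allI Rl2)
      fix \<psi> \<phi> :: "int \<Rightarrow> complex" and c d assume *: "\<psi> \<in> l2" "\<phi> \<in> l2"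
      show "R (\<lambda>n. c * \<psi> n + d * \<phi> n) = (\<lambda>n. c * R \<psi> n + d * R \<phi> n)"
      proof (rule Runiq)
        show "(\<lambda>n. schroedinger V (\<lambda>n. c * R \<psi> n + d * R \<phi> n) n - z * (c * R \<psi> n + d * R \<phi> n)) =
            (\<lambda>n. c * \<psi> n + d * \<phi> n)" (is "?l = _")
        proof
          fix n
          have "?l n = c * (schroedinger V (R \<psi>) n - z * R \<psi> n) + d * (schroedinger V (R \<phi>) n - z * R \<phi> n)"
            by (simp add: schroedinger_def algebra_simps)
          then show "?l n = c * \<psi> n + d * \<phi> n" using fun_cong[OF Rsol[OF *(1)]] fun_cong[OF Rsol[OF *(2)]] by simp
        qed
      qed (intro l2_comb * Rl2)+
    next
      show "\<exists>C. \<forall>\<psi>\<in>l2. l2_norm (R \<psi>) \<le> C * l2_norm \<psi>"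
      proof (intro exI ballI)
        fix \<psi> assume "\<psi> \<in> l2"
        then have "m * l2_norm (R \<psi>) \<le> l2_norm \<psi>"
          using low[of "inv A (Abs_ell2 \<psi>)"] by (simp add: R_def norm_ell2 AinvA Abs_ell2_inverse)
        then show "l2_norm (R \<psi>) \<le> (1 / m) * l2_norm \<psi>" using m(1) by (simp add: field_simps)
      qed
    qed
    moreover have "R (\<lambda>n. schroedinger V \<psi> n - z * \<psi> n) = \<psi>" if "\<psi> \<in> l2" for \<psi>
    proof (rule Runiq)
      show "(\<lambda>n. schroedinger V \<psi> n - z * \<psi> n) \<in> l2"
        using l2_comb[OF schroedinger_l2[OF V that] that, of 1 "- z"] by simp
    qed (use that in auto)
    ultimately show ?thesis unfolding spectrum_l2_def using Rsol by blast
  qed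
  moreover have "complex_of_real a \<in> spectrum_l2 (schroedinger V)" if a: "a \<in> sspec V" for a
  proof (rule ccontr)
    assume "\<not> ?thesis"
    then obtain R where R: "bounded_operator_l2 R"
      "\<And>\<psi>. \<psi> \<in> l2 \<Longrightarrow> R (\<lambda>n. schroedinger V \<psi> n - of_real a * \<psi> n) = \<psi>"
      unfolding spectrum_l2_def by blast
    obtain C where C: "\<And>\<psi>. \<psi> \<in> l2 \<Longrightarrow> l2_norm (R \<psi>) \<le> C * l2_norm \<psi>"
      using R(1) unfolding bounded_operator_l2_def by blast
    obtain x where x: "norm x = 1" "norm (schr V x - a *\<^sub>R x) < 1 / (\<bar>C\<bar> + 1)"
      
      using approx_specD[OF a, of "1 / (\<bar>C\<bar> + 1)"] by (metis abs_ge_zero add_nonneg_pos zero_less_divide_1_iff zero_less_one)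
    have "ap (schr V x - a *\<^sub>R x) = (\<lambda>n. schroedinger V (ap x) n - of_real a * ap x n)"
      by (rule ext) (simp add: apS)
    then have "R (ap (schr V x - a *\<^sub>R x)) = ap x" using R(2)[OF ap_l2[of x]] by simp
    then have "1 \<le> C * norm (schr V x - a *\<^sub>R x)" using C[OF ap_l2[of "schr V x - a *\<^sub>R x"]] x by (simp add: norm_ell2)
    also have "\<dots> \<le> (\<bar>C\<bar> + 1) * norm (schr V x - a *\<^sub>R x)" by (intro mult_right_mono) auto
    also have "\<dots> < (\<bar>C\<bar> + 1) * (1 / (\<bar>C\<bar> + 1))" using x by (intro mult_strict_left_mono) auto
    also have "\<dots> = 1" by simp
    finally show False by simp
  qed
  ultimately show ?thesis by blast
qed

section \<open>Truncation, eigenspaces and the absence of isolated points\<close>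

lift_definition trunc_ell2 :: "int \<Rightarrow> ell2 \<Rightarrow> ell2" is "\<lambda>N f n. if \<bar>n\<bar> \<le> N then f n else 0"
  by (rule l2_dominated[where K = 1]) auto

lemma trunc_approx:
  assumes "e > 0"
  shows "\<exists>N. norm (x - trunc_ell2 N x) \<le> e"
proof -
  have "\<exists>F. finite F \<and> (\<Sum>n\<in>F. (cmod (ap x n))\<^sup>2) > (norm x)\<^sup>2 - e\<^sup>2"
  proof (rule ccontr)
    assume "\<not> ?thesis"
    then have "(norm x)\<^sup>2 \<le> (norm x)\<^sup>2 - e\<^sup>2" unfolding norm_ell2_square[of x]
      by (intro infsum_le_finite_sums ell2_summable) (auto simp: not_less)
    then show False using assms by simp
  qed
  then obtain F where F: "finite F" "(\<Sum>n\<in>F. (cmod (ap x n))\<^sup>2) > (norm x)\<^sup>2 - e\<^sup>2" by blast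
  define N where "N = Max (insert 0 (abs ` F))"
  have N: "\<bar>n\<bar> \<le> N" if "n \<in> F" for n unfolding N_def using that F by (intro Max_ge) auto
  have "norm (x - trunc_ell2 N x) \<le> e"
  proof (rule ell2_norm_leI)
    fix G :: "int set" assume G: "finite G"
    have "(\<Sum>n\<in>G. (cmod (ap (x - trunc_ell2 N x) n))\<^sup>2) = (\<Sum>n\<in>{n\<in>G. \<bar>n\<bar> > N}. (cmod (ap x n))\<^sup>2)"
      by (rule sum.mono_neutral_cong_right) (auto simp: G trunc_ell2.rep_eq)
    moreover have "(\<Sum>n\<in>{n\<in>G. \<bar>n\<bar> > N}. (cmod (ap x n))\<^sup>2) + (\<Sum>n\<in>F. (cmod (ap x n))\<^sup>2) \<le> (norm x)\<^sup>2"
      using ell2_sum_le[of "{n\<in>G. \<bar>n\<bar> > N} \<union> F" x] sum.union_disjoint[of "{n\<in>G. \<bar>n\<bar> > N}" F "\<lambda>n. (cmod (ap x n))\<^sup>2"] F(1) G N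
      by fastforce
    ultimately show "(\<Sum>n\<in>G. (cmod (ap (x - trunc_ell2 N x) n))\<^sup>2) \<le> e\<^sup>2" using F(2) by linarith
  qed (use assms in simp)
  then show ?thesis by blast
qed

text \<open>The second-order recursion runs in both directions from the sites 0 and 1. Thus
  evaluation at these sites embeds an eigenspace into two complex, that is four real,
  dimensions.\<close>

lemma eigenvector_eq_0:
  assumes "bounded (range V)" "schr V x = E *\<^sub>R x" "ap x 0 = 0" "ap x 1 = 0"
  shows "x = 0"
proof -
  have rec: "ap x (n - 1) + ap x (n + 1) + complex_of_real (V n) * ap x n = complex_of_real E * ap x n" for n
    using ap_schr[OF assms(1), of x n] assms(2) by simp
  have up: "ap x (int m) = 0 \<and> ap x (int m + 1) = 0" for m
  proof (induction m)
    case (Suc m)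
    then show ?case using rec[of "int m + 1"] by (simp add: algebra_simps)
  qed (use assms in simp)
  have down: "ap x (- int m) = 0 \<and> ap x (- int m + 1) = 0" for m
  proof (induction m)
    case (Suc m)
    have "ap x (- int m - 1) = 0" using Suc rec[of "- int m"] by simp
    moreover have "- int (Suc m) = - int m - 1" by simp
    ultimately show ?case using Suc by (metis diff_add_cancel)
  qed (use assms in simp)
  show ?thesis
  proof (rule ell2_eqI)
    fix n show "ap x n = ap 0 n"
      using up[of "nat n"] down[of "nat (- n)"] by (cases "n \<ge> 0") auto
  qed
qed

text \<open>Pairs of complex numbers have real dimension 4. The five vectors will be the values at 0
  and 1 of the projections of five translates.\<close>

lemma linear_relation_complex_pairs:
  fixes v :: "5 \<Rightarrow> complex \<times> complex"
  obtains a :: "real ^ 5" where "a \<noteq> 0" "(\<Sum>i\<in>UNIV. a $ i *\<^sub>R v i) = 0"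
proof -
  define F where "F = (\<lambda>a :: real ^ 5. \<Sum>i\<in>UNIV. a $ i *\<^sub>R v i)"
  have lin: "linear F" unfolding F_def
    by (rule linearI) (auto simp: scaleR_left_distrib sum.distrib scaleR_sum_right)
  have "\<not> inj F"
  proof
    assume "inj F"
    then have "dim (range F) = 5" using dim_image_eq[OF lin, of UNIV] by simp
    moreover have "dim (range F) \<le> 4" using dim_subset_UNIV[of "range F"] by simp
    ultimately show False by simp
  qed
  then obtain a where "F a = 0" "a \<noteq> 0" using linear_injective_0[OF lin] by blast
  then show thesis using that by (auto simp: F_def)
qed

lemma periodic_mult:
  fixes V :: "int \<Rightarrow> 'a"
  assumes "\<And>n. V (n + q) = V n"
  shows "V (n + q * j) = V n"
proof -
  have up: "V (n + q * int m) = V n" for m n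
    by (induction m arbitrary: n) (simp_all add: algebra_simps assms flip: add.assoc)
  show ?thesis using up[of n "nat j"] up[of "n + q * j" "nat (- j)"] by (cases "j \<ge> 0") simp_all
qed

text \<open>
  Far translates of a finitely supported approximate eigenvector are orthogonal approximate
  eigenvectors, because a periodic approximant of \<open>V\<close> commutes with translations.  If the
  eigenvalue were isolated, they would all be close to its eigenspace, which has at most four real
  dimensions.
\<close>

lemma sspec_not_isolated:
  assumes V: "bounded (range V)"
    and lp: "\<And>e. e > 0 \<Longrightarrow> \<exists>W q. q \<ge> (1::int) \<and> bounded (range W) \<and> (\<forall>n. W (n + q) = W n) \<and> (\<forall>n. \<bar>V n - W n\<bar> \<le> e)"
    and E: "E \<in> sspec V"
  shows "\<not> E isolated_in sspec V"
proof
  assume "E isolated_in sspec V"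
  then obtain d where d: "d > 0" "\<forall>y\<in>sspec V. dist E y < d \<longrightarrow> y = E"
    unfolding isolated_in_dist_Ex_iff by blast
  have "sspec V \<inter> {E - d<..<E + d} \<subseteq> {E}" using d(2) by (auto simp: dist_real_def abs_if)
  then obtain P C where P: "linear P" "C > 0" "\<And>x. schr V (P x) = E *\<^sub>R P x"
    "\<And>x. norm (x - P x) \<le> C * norm (schr V x - E *\<^sub>R x)"
    using isolated_approx_spec_projection[OF symmetric_operator_schr[OF V] d(1)] by metis
  interpret V: symmetric_operator "schr V" by (rule symmetric_operator_schr[OF V])
  obtain K where K: "K > 0" "\<And>n. \<bar>V n\<bar> \<le> K" using V bounded_range_real by blast
  have SE: "norm (schr V x - E *\<^sub>R x) \<le> (2 * K + 4) * norm x" for x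
  proof -
    have "norm (schr V x - E *\<^sub>R x) \<le> norm (schr V x) + norm (E *\<^sub>R x)" by (rule norm_triangle_ineq4)
    also have "\<dots> \<le> (K + 2) * norm x + (K + 2) * norm x"
      using norm_schr_le[OF K(2)] sspec_bounded[OF K(2) E] by (intro add_mono) (auto intro: mult_right_mono)
    finally show ?thesis by (simp add: algebra_simps)
  qed
  \<comment> \<open>A combination u of five orthogonal translates with coefficient vector a and
    residuals at most h satisfies norm u \<le> 5 C h norm a = norm a / 4 once its projection
    vanishes, whereas orthogonality gives norm u \<ge> norm a / 2.\<close>
  define h where "h = 1 / (20 * C)"
  have h: "h > 0" using P(2) by (simp add: h_def)
  obtain x where x: "norm x = 1" "norm (schr V x - E *\<^sub>R x) < h / 4" using approx_specD[OF E, of "h/4"] h by auto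
  \<comment> \<open>The truncation error must leave at least half of the norm of x and may add at
    most h/4 to the residual; 2 K + 4 bounds the norm of H - E.\<close>
  define e where "e = min (1/2) (h / (4 * (2 * K + 4)))"
  have e: "e > 0" "e \<le> 1/2" "(2 * K + 4) * e \<le> h / 4"
  proof -
    have K4: "2 * K + 4 > 0" using K(1) by simp
    then show "e > 0" "e \<le> 1/2" using h by (simp_all only: e_def min_less_iff_conj) (auto simp: min.coboundedI1)
    have "(2 * K + 4) * e \<le> (2 * K + 4) * (h / (4 * (2 * K + 4)))"
      using K4 by (intro mult_left_mono) (auto simp: e_def)
    also have "\<dots> = h / 4" using K4 by (metis mult.commute nonzero_mult_divide_mult_cancel_right less_irrefl times_divide_eq_right)
    finally show "(2 * K + 4) * e \<le> h / 4" .
  qed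
  obtain N where N: "norm (x - trunc_ell2 N x) \<le> e" using trunc_approx[OF e(1)] by blast
  define y where "y = trunc_ell2 N x"
  have y1: "norm y \<ge> 1/2" using N x(1) e(2) norm_triangle_ineq2[of x "x - y"] by (simp add: y_def)
  have y2: "norm y \<le> 1"
    using norm_ell2_mono[of y x] x(1) by (simp add: y_def trunc_ell2.rep_eq)
  have y3: "norm (schr V y - E *\<^sub>R y) \<le> h / 2"
  proof -
    have eq: "schr V y - E *\<^sub>R y = (schr V x - E *\<^sub>R x) - (schr V (x - y) - E *\<^sub>R (x - y))"
      using V.linear by (simp add: linear_diff algebra_simps)
    have "norm (schr V y - E *\<^sub>R y) \<le> norm (schr V x - E *\<^sub>R x) + norm (schr V (x - y) - E *\<^sub>R (x - y))"
      unfolding eq by (rule norm_triangle_ineq4)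
    also have "norm (schr V (x - y) - E *\<^sub>R (x - y)) \<le> (2 * K + 4) * e"
      using SE[of "x - y"] N K(1) by (smt (verit) mult_left_mono y_def)
    finally show ?thesis using x(2) e(3) by simp
  qed
  obtain W and q :: int where W: "q \<ge> 1" "bounded (range W)" "\<And>n. W (n + q) = W n" "\<And>n. \<bar>V n - W n\<bar> \<le> h / 4"
    using lp[of "h/4"] h by auto
  have per: "W (n + q * j) = W n" for n j using W(3) by (rule periodic_mult)
  have tr: "norm (schr V (shift_ell2 (q * j) y) - E *\<^sub>R shift_ell2 (q * j) y) \<le> h" for j
  proof -
    let ?s = "shift_ell2 (q * j)"
    have eq: "schr W (?s y) - E *\<^sub>R ?s y = ?s (schr W y - E *\<^sub>R y)"
      
    proof (rule ell2_eqI)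
      fix n show "ap (schr W (?s y) - E *\<^sub>R ?s y) n = ap (?s (schr W y - E *\<^sub>R y)) n"
        using per[of n j] by (simp add: ap_schr[OF W(2)] algebra_simps)
    qed
    have d: "norm (schr V z - schr W z) \<le> h / 4 * norm z" for z
      by (rule norm_schr_diff[OF V W(2) W(4)])
    have "norm (schr V (?s y) - E *\<^sub>R ?s y) \<le> norm (schr V (?s y) - schr W (?s y)) + norm (schr W (?s y) - E *\<^sub>R ?s y)"
      by (metis norm_triangle_ineq diff_add_cancel add_diff_eq)
    also have "norm (schr W (?s y) - E *\<^sub>R ?s y) = norm (schr W y - E *\<^sub>R y)" by (simp add: eq)
    also have "\<dots> \<le> norm (schr V y - schr W y) + norm (schr V y - E *\<^sub>R y)"
      by (metis norm_minus_commute norm_triangle_ineq diff_add_cancel add_diff_eq)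
    finally have "norm (schr V (?s y) - E *\<^sub>R ?s y) \<le> h / 4 * norm y + (h / 4 * norm y + h / 2)"
      using d[of y] d[of "?s y"] y3 by simp
    moreover have "h / 4 * norm y \<le> h / 4" using y2 h by simp
    ultimately show ?thesis by simp
  qed
  obtain f :: "5 \<Rightarrow> nat" where f: "inj f" using finite_imp_inj_to_nat_seg[of "UNIV :: 5 set"] by auto
  \<comment> \<open>Translations by multiples of \<open>q\<close> commute with the operator of
    \<open>W\<close>; the spacing 2 \<bar>N\<bar> + 1 makes the supports disjoint.\<close>
  define g where "g = (\<lambda>i. shift_ell2 (q * ((2 * \<bar>N\<bar> + 1) * int (f i))) y)"
  have g_orth: "inner (g i) (g j) = 0" if "i \<noteq> j" for i j
  proof -
    have "f i \<noteq> f j" using f that by (auto dest: injD)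
    have "ap (g i) n = 0 \<or> ap (g j) n = 0" for n
    proof (rule ccontr)
      assume "\<not> ?thesis"
      then have "\<bar>n + q * ((2 * \<bar>N\<bar> + 1) * int (f i))\<bar> \<le> N" "\<bar>n + q * ((2 * \<bar>N\<bar> + 1) * int (f j))\<bar> \<le> N"
        by (auto simp: g_def y_def trunc_ell2.rep_eq split: if_splits)
      then have "\<bar>q * ((2 * \<bar>N\<bar> + 1) * (int (f i) - int (f j)))\<bar> \<le> 2 * N"
        unfolding right_diff_distrib by linarith
      moreover have "\<bar>q * ((2 * \<bar>N\<bar> + 1) * (int (f i) - int (f j)))\<bar> \<ge> 1 * ((2 * \<bar>N\<bar> + 1) * 1)"
        unfolding abs_mult using W(1) \<open>f i \<noteq> f j\<close> by (intro mult_mono) auto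
      ultimately show False by simp
    qed
    then have "inner (ap (g i) n) (ap (g j) n) = 0" for n by (metis inner_zero_left inner_zero_right)
    then show ?thesis unfolding inner_ell2.rep_eq by simp
  qed
  have g_norm: "inner (g i) (g i) = (norm y)\<^sup>2" for i by (simp add: g_def power2_norm_eq_inner[symmetric])
  obtain a :: "real ^ 5" where a: "a \<noteq> 0" "(\<Sum>i\<in>UNIV. a $ i *\<^sub>R (ap (P (g i)) 0, ap (P (g i)) 1)) = 0"
    by (rule linear_relation_complex_pairs[of "\<lambda>i. (ap (P (g i)) 0, ap (P (g i)) 1)"])
  define u where "u = (\<Sum>i\<in>UNIV. a $ i *\<^sub>R g i)"
  have Pu: "P u = (\<Sum>i\<in>UNIV. a $ i *\<^sub>R P (g i))" unfolding u_def using P(1) by (simp add: linear_sum linear_cmul)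
  have "ap (P u) 0 = 0" "ap (P u) 1 = 0"
    using arg_cong[OF a(2), of fst] arg_cong[OF a(2), of snd]
    unfolding Pu by (simp_all add: ap_sum fst_sum snd_sum scaleR_conv_of_real)
  then have "P u = 0" using eigenvector_eq_0[OF V P(3)] by blast
  then have "norm u \<le> C * norm (schr V u - E *\<^sub>R u)" using P(4)[of u] by simp
  also have "schr V u - E *\<^sub>R u = (\<Sum>i\<in>UNIV. a $ i *\<^sub>R (schr V (g i) - E *\<^sub>R g i))"
    unfolding u_def using V.linear
    by (simp add: linear_sum linear_cmul scaleR_sum_right scaleR_diff_right sum_subtractf mult.commute)
  also have "norm \<dots> \<le> (\<Sum>i\<in>(UNIV :: 5 set). norm a * h)"
  proof (rule sum_norm_le)
    fix i
    show "norm (a $ i *\<^sub>R (schr V (g i) - E *\<^sub>R g i)) \<le> norm a * h"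
      unfolding norm_scaleR g_def using tr component_le_norm_cart[of a i] by (intro mult_mono) auto
  qed
  finally have "norm u \<le> C * (5 * (norm a * h))" using P(2) by simp
  also have "\<dots> = norm a / 4" using P(2) by (simp add: h_def)
  finally have u1: "norm u \<le> norm a / 4" .
  have "(norm u)\<^sup>2 = (\<Sum>i\<in>UNIV. \<Sum>j\<in>UNIV. a $ i * (a $ j * inner (g i) (g j)))"
    unfolding power2_norm_eq_inner u_def inner_sum_left inner_sum_right by (simp add: inner_commute mult.left_commute)
  also have "\<dots> = (\<Sum>i\<in>UNIV. \<Sum>j\<in>UNIV. if j = i then (a $ i)\<^sup>2 * (norm y)\<^sup>2 else 0)"
    by (intro sum.cong refl) (auto simp: g_norm g_orth power2_eq_square)
  also have "\<dots> = (norm a * norm y)\<^sup>2"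
    by (simp add: sum_distrib_right[symmetric] power_mult_distrib power2_norm_eq_inner inner_vec_def power2_eq_square[of "a $ _"])
  finally have "norm u = norm a * norm y" by (simp add: power2_eq_iff_nonneg)
  also have "\<dots> \<ge> norm a * (1/2)" using y1 by (intro mult_left_mono) auto
  finally have "norm a \<le> 0" using u1 by linarith
  then show False using a(1) by simp
qed

section \<open>Periodic potentials and transfer matrices\<close>

definition step_matrix :: "real \<Rightarrow> real ^ 2 ^ 2" where
  "step_matrix v = vector [vector [v, - 1], vector [1, 0]]"

lemma step_matrix_nth [simp]:
  "step_matrix v $ 1 $ 1 = v" "step_matrix v $ 1 $ 2 = - 1" "step_matrix v $ 2 $ 1 = 1" "step_matrix v $ 2 $ 2 = 0"
  by (simp_all add: step_matrix_def)

lemma matrix_mult_nth_2: "((A :: 'a::semiring_1 ^ 2 ^ 2) ** B) $ i $ j = A $ i $ 1 * B $ 1 $ j + A $ i $ 2 * B $ 2 $ j"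
  by (simp add: matrix_matrix_mult_def sum_2)

lemma mat_1_nth_2 [simp]:
  "(mat 1 :: real ^ 2 ^ 2) $ 1 $ 1 = 1" "(mat 1 :: real ^ 2 ^ 2) $ 1 $ 2 = 0"
  "(mat 1 :: real ^ 2 ^ 2) $ 2 $ 1 = 0" "(mat 1 :: real ^ 2 ^ 2) $ 2 $ 2 = 1"
  by (simp_all add: mat_def)

lemma trace_2: "trace (A :: real ^ 2 ^ 2) = A $ 1 $ 1 + A $ 2 $ 2"
  by (simp add: trace_def sum_2)

text \<open>\<open>transfer V E m n\<close> maps \<open>(\<psi> m, \<psi> (m - 1))\<close> to \<open>(\<psi> (m + n), \<psi> (m + n - 1))\<close> for the solutions of \<open>H \<psi> = E \<psi>\<close>.\<close>

primrec transfer :: "(int \<Rightarrow> real) \<Rightarrow> real \<Rightarrow> int \<Rightarrow> nat \<Rightarrow> real ^ 2 ^ 2" where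
  "transfer V E m 0 = mat 1"
| "transfer V E m (Suc n) = step_matrix (E - V (m + int n)) ** transfer V E m n"

lemma transfer_add: "transfer V E m (a + b) = transfer V E (m + int a) b ** transfer V E m a"
  by (induction b) (simp_all add: matrix_mul_assoc add.assoc)

lemma transfer_Suc_left: "transfer V E m (Suc n) = transfer V E (m + 1) n ** step_matrix (E - V m)"
  using transfer_add[of V E m 1 n] by simp

lemma det_transfer: "det (transfer V E m n) = 1"
  by (induction n) (simp_all add: det_mul det_2[of "step_matrix _"])

lemma transfer_cong:
  assumes "\<And>j. j < n \<Longrightarrow> V (m + int j) = W (m' + int j)"
  shows "transfer V E m n = transfer W E m' n"
  using assms by (induction n) auto

lemma periodic_mod:
  fixes V :: "int \<Rightarrow> 'a"
  assumes "\<And>n. V (n + q) = V n"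
  shows "V n = V (n mod q)"
  using periodic_mult[of V q "n mod q" "n div q", OF assms] by simp

lemma finite_range_periodic:
  fixes V :: "int \<Rightarrow> 'a"
  assumes "q > 0" "\<And>n. V (n + q) = V n"
  shows "finite (range V)"
proof -
  have "range V \<subseteq> V ` {0..<q}"
  proof clarify
    fix n
    have "V n = V (n mod q)" using assms(2) by (rule periodic_mod)
    then show "V n \<in> V ` {0..<q}" using assms(1) by simp
  qed
  then show ?thesis using finite_subset by blast
qed

lemma bounded_range_periodic:
  fixes V :: "int \<Rightarrow> 'a::metric_space"
  assumes "q > 0" "\<And>n. V (n + q) = V n"
  shows "bounded (range V)"
  using finite_range_periodic[of q V] assms by (simp add: finite_imp_bounded)

lemma transfer_periodic:
  assumes "\<And>n. V (n + q) = V n"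
  shows "transfer V E (m + q * j) n = transfer V E m n"
  by (rule transfer_cong) (metis assms periodic_mult add.commute add.left_commute)

text \<open>Monodromy matrices at neighbouring base points are conjugate by a step matrix.\<close>

lemma trace_monodromy_Suc:
  assumes "\<And>n. V (n + int q) = V n"
  shows "trace (transfer V E (m + 1) q) = trace (transfer V E m q)"
proof -
  have eq: "transfer V E (m + 1) q ** step_matrix (E - V m) = step_matrix (E - V m) ** transfer V E m q"
    using transfer_Suc_left[of V E m q] assms[of m] by simp
  define B :: "real ^ 2 ^ 2" where "B = vector [vector [0, 1], vector [- 1, E - V m]]"
  have SB: "step_matrix (E - V m) ** B = mat 1" "B ** step_matrix (E - V m) = mat 1"
    by (simp_all add: vec_eq_iff forall_2 matrix_mult_nth_2 B_def)
  have "transfer V E (m + 1) q = step_matrix (E - V m) ** transfer V E m q ** B"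
    using arg_cong[OF eq, of "\<lambda>X. X ** B"] by (simp add: matrix_mul_assoc[symmetric] SB)
  then have "trace (transfer V E (m + 1) q) = trace (B ** (step_matrix (E - V m) ** transfer V E m q))"
    by (metis trace_mul_sym)
  then show ?thesis by (simp add: matrix_mul_assoc SB)
qed

lemma trace_monodromy:
  assumes "\<And>n. V (n + int q) = V n"
  shows "trace (transfer V E m q) = trace (transfer V E 0 q)"
proof -
  have up: "trace (transfer V E (m + int j) q) = trace (transfer V E m q)" for m j
    by (induction j) (simp_all add: trace_monodromy_Suc[of V q, OF assms] flip: add.assoc add: add.commute[of 1])
  show ?thesis using up[of 0 "nat m"] up[of m "nat (- m)"] by (cases "m \<ge> 0") simp_all
qed

lemma transfer_bound:
  assumes "\<And>n. \<bar>E - V n\<bar> \<le> K"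
  shows "\<bar>transfer V E m n $ i $ j\<bar> \<le> (K + 1) ^ n"
proof -
  have K: "K \<ge> 0" using assms[of 0] by linarith
  have "\<forall>i j. \<bar>transfer V E m n $ i $ j\<bar> \<le> (K + 1) ^ n"
  proof (induction n)
    case 0 show ?case by (simp add: mat_def)
  next
    case (Suc n)
    have "\<bar>transfer V E m (Suc n) $ 1 $ j\<bar> \<le> (K + 1) ^ Suc n" for j
    proof -
      have "\<bar>transfer V E m (Suc n) $ 1 $ j\<bar> \<le> \<bar>E - V (m + int n)\<bar> * \<bar>transfer V E m n $ 1 $ j\<bar> + \<bar>transfer V E m n $ 2 $ j\<bar>"
        by (simp add: matrix_mult_nth_2 flip: abs_mult)
      also have "\<dots> \<le> K * (K + 1) ^ n + (K + 1) ^ n"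
        using Suc assms K by (intro add_mono mult_mono) auto
      finally show ?thesis by (simp add: algebra_simps)
    qed
    moreover have "\<bar>transfer V E m (Suc n) $ 2 $ j\<bar> \<le> (K + 1) ^ Suc n" for j
    proof -
      have "\<bar>transfer V E m (Suc n) $ 2 $ j\<bar> \<le> 1 * (K + 1) ^ n" using Suc by (simp add: matrix_mult_nth_2)
      also have "\<dots> \<le> (K + 1) * (K + 1) ^ n" using K by (intro mult_right_mono) auto
      finally show ?thesis by simp
    qed
    ultimately show ?case by (simp only: forall_2)
  qed
  then show ?thesis by blast
qed

lemma norm_diff_add_le:
  fixes a b c :: "'a::real_normed_vector"
  shows "norm (a - b + c) \<le> norm a + norm b + norm c"
  using norm_triangle_ineq[of "a - b" c] norm_triangle_ineq4[of a b] by linarith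

text \<open>Discrete variation of constants: the deviations of an inhomogeneous solution from the
  homogeneous one with the same initial values obey the same recursion with source
  \<open>f\<close>.\<close>

lemma transfer_variation:
  fixes \<phi> f :: "int \<Rightarrow> complex"
  assumes "\<And>n. \<bar>E - V n\<bar> \<le> K" "\<And>n. \<phi> (n - 1) + \<phi> (n + 1) + complex_of_real (V n) * \<phi> n - of_real E * \<phi> n = f n"
  shows "cmod (\<phi> (m + int n) - (transfer V E m n $ 1 $ 1 * \<phi> m + transfer V E m n $ 1 $ 2 * \<phi> (m - 1)))
      \<le> (K + 2) ^ n * (\<Sum>j<n. cmod (f (m + int j)))"
    and "cmod (\<phi> (m + int n - 1) - (transfer V E m n $ 2 $ 1 * \<phi> m + transfer V E m n $ 2 $ 2 * \<phi> (m - 1)))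
      \<le> (K + 2) ^ n * (\<Sum>j<n. cmod (f (m + int j)))"
proof -
  have K: "K \<ge> 0" using assms(1)[of 0] by linarith
  define g where "g = (\<lambda>n. \<phi> (m + int n) - (transfer V E m n $ 1 $ 1 * \<phi> m + transfer V E m n $ 1 $ 2 * \<phi> (m - 1)))"
  define g' where "g' = (\<lambda>n. \<phi> (m + int n - 1) - (transfer V E m n $ 2 $ 1 * \<phi> m + transfer V E m n $ 2 $ 2 * \<phi> (m - 1)))"
  have "cmod (g n) \<le> (K + 2) ^ n * (\<Sum>j<n. cmod (f (m + int j))) \<and> cmod (g' n) \<le> (K + 2) ^ n * (\<Sum>j<n. cmod (f (m + int j)))"
  proof (induction n)
    case 0 show ?case by (simp add: g_def g'_def)
  next
    case (Suc n)
    define F where "F = (\<Sum>j<n. cmod (f (m + int j)))"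
    have F: "F \<ge> 0" by (simp add: F_def sum_nonneg)
    have K1: "(K + 2) ^ n \<ge> 1" using K by (intro one_le_power) simp
    have "\<phi> (m + int n + 1) = of_real (E - V (m + int n)) * \<phi> (m + int n) - \<phi> (m + int n - 1) + f (m + int n)"
      using assms(2)[of "m + int n"] by (simp add: algebra_simps)
    then have "g (Suc n) = of_real (E - V (m + int n)) * g n - g' n + f (m + int n)"
      by (simp add: g_def g'_def matrix_mult_nth_2 algebra_simps)
    then have "cmod (g (Suc n)) \<le> \<bar>E - V (m + int n)\<bar> * cmod (g n) + cmod (g' n) + cmod (f (m + int n))"
      using norm_diff_add_le[of "of_real (E - V (m + int n)) * g n" "g' n" "f (m + int n)"]
      by (simp only: norm_mult norm_of_real)
    also have "\<dots> \<le> K * ((K + 2) ^ n * F) + (K + 2) ^ n * F + (K + 2) ^ Suc n * cmod (f (m + int n))"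
    proof (intro add_mono mult_mono)
      have "(K + 2) ^ Suc n \<ge> 1" using K by (intro one_le_power) simp
      then show "cmod (f (m + int n)) \<le> (K + 2) ^ Suc n * cmod (f (m + int n))"
        using mult_right_mono[of 1 "(K + 2) ^ Suc n" "cmod (f (m + int n))"] by simp
    qed (use Suc assms(1) K in \<open>auto simp: F_def\<close>)
    also have "K * ((K + 2) ^ n * F) + (K + 2) ^ n * F \<le> (K + 2) ^ Suc n * F"
      using F K by (simp add: algebra_simps)
    finally have 1: "cmod (g (Suc n)) \<le> (K + 2) ^ Suc n * (\<Sum>j<Suc n. cmod (f (m + int j)))"
      by (simp only: sum.lessThan_Suc F_def distrib_left)
    have "g' (Suc n) = g n" by (simp add: g_def g'_def matrix_mult_nth_2 algebra_simps)
    then have "cmod (g' (Suc n)) \<le> (K + 2) ^ n * F" using Suc by (simp add: F_def)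
    also have "\<dots> \<le> (K + 2) ^ Suc n * (\<Sum>j<Suc n. cmod (f (m + int j)))"
      using K F by (intro mult_mono power_increasing) (auto simp: F_def)
    finally show ?case using 1 by blast
  qed
  then show "cmod (\<phi> (m + int n) - (transfer V E m n $ 1 $ 1 * \<phi> m + transfer V E m n $ 1 $ 2 * \<phi> (m - 1)))
      \<le> (K + 2) ^ n * (\<Sum>j<n. cmod (f (m + int j)))"
    and "cmod (\<phi> (m + int n - 1) - (transfer V E m n $ 2 $ 1 * \<phi> m + transfer V E m n $ 2 $ 2 * \<phi> (m - 1)))
      \<le> (K + 2) ^ n * (\<Sum>j<n. cmod (f (m + int j)))"
    by (simp_all add: g_def g'_def)
qed

lift_definition cabs :: "ell2 \<Rightarrow> ell2" is "\<lambda>f n. complex_of_real (cmod (f n))"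
  by (rule l2_dominated[where K = 1]) auto

lemma norm_cabs: "norm (cabs x) = norm x"
  by (intro antisym norm_ell2_mono) (simp_all add: cabs.rep_eq)

text \<open>
  With \<open>M\<close> the monodromy matrix, \<open>M + M\<^sup>-\<^sup>1 = (tr M) 1\<close>.  Hence
  \<open>x (n + q) + x (n - q) - (tr M) x n\<close> is a combination of finitely many values of \<open>(H - E) x\<close>
  near \<open>n\<close>, which gives \<open>(\<bar>tr M\<bar> - 2) \<parallel>x\<parallel> \<le> C \<parallel>(H - E) x\<parallel>\<close>.
\<close>

lemma sspec_periodic_imp_trace:
  assumes q: "q \<ge> 1" and per: "\<And>n. V (n + int q) = V n" and E: "E \<in> sspec V"
  shows "\<bar>trace (transfer V E 0 q)\<bar> \<le> 2"
proof (rule ccontr)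
  define D where "D = trace (transfer V E 0 q)"
  assume "\<not> ?thesis"
  then have D: "\<bar>D\<bar> > 2" by (simp add: D_def)
  have bV: "bounded (range V)" using bounded_range_periodic[of "int q" V] q per by simp
  then obtain K0 where K0: "\<And>n. \<bar>V n\<bar> \<le> K0" using bounded_range_real by blast
  define K where "K = \<bar>E\<bar> + K0"
  have K: "\<bar>E - V n\<bar> \<le> K" for n using K0[of n] unfolding K_def by linarith
  define L where "L = (K + 2) ^ q"
  define T where "T = (K + 1) ^ q"
  have KK: "K \<ge> 0" using K[of 0] by linarith
  have L: "L > 0" and T: "T > 0" using KK by (simp_all add: L_def T_def)
  define C where "C = L * q + T * L * q + T * L * q"
  have C: "C > 0" using L T q unfolding C_def by (intro add_pos_pos mult_pos_pos) auto
  have main: "(\<bar>D\<bar> - 2) * norm x \<le> C * norm (schr V x - E *\<^sub>R x)" for x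
  proof -
    define f where "f = schr V x - E *\<^sub>R x"
    define \<phi> where "\<phi> = ap x"
    have eqf: "\<phi> (n - 1) + \<phi> (n + 1) + complex_of_real (V n) * \<phi> n - of_real E * \<phi> n = ap f n" for n
      by (simp add: f_def \<phi>_def ap_schr bV)
    \<comment> \<open>Sums of shifts of the modulus of f turn the pointwise bounds over one period
      into a vector of \<open>ell2\<close>, so that domination of entries yields a norm
      estimate.\<close>
    define y where "y = (\<lambda>k. \<Sum>j<q. shift_ell2 (k + int j) (cabs f))"
    have apy: "ap (y k) n = of_real (\<Sum>j<q. cmod (ap f (n + k + int j)))" for k n
      by (simp add: y_def ap_sum cabs.rep_eq add.assoc)
    have ny: "norm (y k) \<le> q * norm f" for k
    proof -
      have "norm (y k) \<le> (\<Sum>j<q. norm f)" unfolding y_def by (rule sum_norm_le) (simp add: norm_cabs)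
      then show ?thesis by simp
    qed
    define z where "z = L *\<^sub>R y 0 + (T * L) *\<^sub>R y (- int q) + (T * L) *\<^sub>R y (- int q)"
    have "norm (shift_ell2 (int q) x + shift_ell2 (- int q) x - D *\<^sub>R x) \<le> norm z"
    proof (rule norm_ell2_mono)
      fix n
      let ?M = "transfer V E n q" and ?m = "n - int q"
      have M: "transfer V E ?m q = ?M" using transfer_periodic[of V "int q" E n "-1" q] per by simp
      have tr: "?M $ 1 $ 1 + ?M $ 2 $ 2 = D" using trace_monodromy[of V q E n] per by (simp add: trace_2 D_def)
      have det: "?M $ 1 $ 1 * ?M $ 2 $ 2 - ?M $ 1 $ 2 * ?M $ 2 $ 1 = 1" using det_transfer[of V E n q] by (simp add: det_2)
      define S where "S = (\<lambda>m. \<Sum>j<q. cmod (ap f (m + int j)))"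
      define g where "g = \<phi> (n + int q) - (?M $ 1 $ 1 * \<phi> n + ?M $ 1 $ 2 * \<phi> (n - 1))"
      define g1 where "g1 = \<phi> n - (?M $ 1 $ 1 * \<phi> ?m + ?M $ 1 $ 2 * \<phi> (?m - 1))"
      define g2 where "g2 = \<phi> (n - 1) - (?M $ 2 $ 1 * \<phi> ?m + ?M $ 2 $ 2 * \<phi> (?m - 1))"
      have "cmod g \<le> L * S n" using transfer_variation(1)[of E V K \<phi> "ap f" n q, OF K eqf] by (simp add: g_def L_def S_def)
      moreover have g1: "cmod g1 \<le> L * S ?m"
        using transfer_variation(1)[of E V K \<phi> "ap f" ?m q, OF K eqf] unfolding M by (simp add: g1_def L_def S_def)
      moreover have g2: "cmod g2 \<le> L * S ?m"
        using transfer_variation(2)[of E V K \<phi> "ap f" ?m q, OF K eqf] unfolding M by (simp add: g2_def L_def S_def)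
      \<comment> \<open>The coefficients are the first row of the inverse of the monodromy matrix up
        to sign: they cancel the value at n - 1 and leave determinant 1 in front of the value at n -
        q.\<close>
      moreover have "\<phi> (n + int q) + \<phi> ?m - of_real D * \<phi> n = g - of_real (?M $ 2 $ 2) * g1 + of_real (?M $ 1 $ 2) * g2"
      proof -
        have "of_real (?M $ 2 $ 2) * g1 - of_real (?M $ 1 $ 2) * g2 =
            of_real (?M $ 2 $ 2) * \<phi> n - of_real (?M $ 1 $ 2) * \<phi> (n - 1)
            - of_real (?M $ 1 $ 1 * ?M $ 2 $ 2 - ?M $ 1 $ 2 * ?M $ 2 $ 1) * \<phi> ?m"
          by (simp add: g1_def g2_def algebra_simps)
        then show ?thesis unfolding det tr[symmetric] by (simp add: g_def algebra_simps)
      qed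
      then have "cmod (\<phi> (n + int q) + \<phi> ?m - of_real D * \<phi> n) \<le> cmod g + \<bar>?M $ 2 $ 2\<bar> * cmod g1 + \<bar>?M $ 1 $ 2\<bar> * cmod g2"
        using norm_diff_add_le[of g "of_real (?M $ 2 $ 2) * g1" "of_real (?M $ 1 $ 2) * g2"]
        by (simp only: norm_mult norm_of_real)
      moreover have "\<bar>?M $ 2 $ 2\<bar> * cmod g1 \<le> T * (L * S ?m)" "\<bar>?M $ 1 $ 2\<bar> * cmod g2 \<le> T * (L * S ?m)"
        using transfer_bound[of E V K n q] K g1 g2 T unfolding T_def by (intro mult_mono; simp)+
      ultimately have "cmod (\<phi> (n + int q) + \<phi> ?m - of_real D * \<phi> n) \<le> L * S n + T * L * S ?m + T * L * S ?m"
        unfolding mult.assoc by linarith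
      moreover have "ap z n = of_real (L * S n + T * L * S ?m + T * L * S ?m)"
        by (simp add: z_def apy S_def algebra_simps)
      moreover have "\<bar>L * S n + T * L * S ?m + T * L * S ?m\<bar> = L * S n + T * L * S ?m + T * L * S ?m"
        using L T by (intro abs_of_nonneg add_nonneg_nonneg mult_nonneg_nonneg) (auto simp: S_def sum_nonneg)
      ultimately show "cmod (ap (shift_ell2 (int q) x + shift_ell2 (- int q) x - D *\<^sub>R x) n) \<le> cmod (ap z n)"
        by (simp only: norm_of_real) (simp add: \<phi>_def)
    qed
    moreover have "norm z \<le> C * norm f"
    proof -
      have "norm z \<le> L * norm (y 0) + T * L * norm (y (- int q)) + T * L * norm (y (- int q))"
        unfolding z_def using L T by (intro norm_triangle_mono) simp_all
      also have "\<dots> \<le> L * (q * norm f) + T * L * (q * norm f) + T * L * (q * norm f)"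
        using L T by (intro add_mono mult_left_mono ny) auto
      finally show ?thesis by (simp add: C_def algebra_simps)
    qed
    moreover have "\<bar>D\<bar> * norm x \<le> 2 * norm x + norm (shift_ell2 (int q) x + shift_ell2 (- int q) x - D *\<^sub>R x)"
    proof -
      have "\<bar>D\<bar> * norm x = norm (D *\<^sub>R x)" by simp
      also have "\<dots> \<le> norm (shift_ell2 (int q) x + shift_ell2 (- int q) x) +
          norm (shift_ell2 (int q) x + shift_ell2 (- int q) x - D *\<^sub>R x)"
        by (metis norm_minus_commute norm_triangle_sub add.commute)
      also have "norm (shift_ell2 (int q) x + shift_ell2 (- int q) x) \<le> 2 * norm x"
        using norm_triangle_ineq[of "shift_ell2 (int q) x" "shift_ell2 (- int q) x"] by simp
      finally show ?thesis by simp
    qed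
    ultimately show ?thesis by (simp add: f_def algebra_simps)
  qed
  obtain x where x: "norm x = 1" "norm (schr V x - E *\<^sub>R x) < (\<bar>D\<bar> - 2) / C"
    using approx_specD[OF E, of "(\<bar>D\<bar> - 2) / C"] D C by (metis divide_pos_pos diff_gt_0_iff_gt)
  then show False using main[of x] C by (simp add: field_simps)
qed

text \<open>The characteristic polynomial r^2 - t r + 1 with real t in [-2, 2] has its roots on the
  unit circle. Eigenvectors are (b, r - a) or (r - d, c), whichever off-diagonal entry is nonzero,
  and a unit vector for a diagonal matrix.\<close>

lemma Floquet_multiplier:
  fixes a b c d :: real
  assumes "a * d - b * c = 1" "\<bar>a + d\<bar> \<le> 2"
  obtains r v w :: complex where "cmod r = 1" "(v, w) \<noteq> (0, 0)"
    "of_real a * v + of_real b * w = r * v" "of_real c * v + of_real d * w = r * w"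
proof -
  define t where "t = a + d"
  define r where "r = Complex (t / 2) (sqrt (1 - (t / 2)\<^sup>2))"
  have t: "(t / 2)\<^sup>2 \<le> 1"
    using assms(2) by (simp add: abs_square_le_1 t_def)
  have r1: "cmod r = 1" using t by (simp add: r_def cmod_def)
  have "r * r - t * r + 1 = 0"
    using t by (simp add: r_def complex_eq_iff power2_eq_square field_simps)
  moreover have "of_real a * of_real d - of_real b * of_real c = (1 :: complex)"
    using arg_cong[OF assms(1), of complex_of_real] by (simp only: of_real_diff of_real_mult of_real_1)
  ultimately have ch: "(r - of_real a) * (r - of_real d) = of_real b * of_real c"
    by (simp add: t_def algebra_simps)
  consider "b \<noteq> 0" | "c \<noteq> 0" | "b = 0" "c = 0" "r = a" | "b = 0" "c = 0" "r = d"
    using ch by (cases "b = 0"; cases "c = 0") auto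
  then show thesis
  proof cases
    case 1 then show thesis using that[of r "of_real b" "r - of_real a"] r1 ch by (simp add: algebra_simps)
  next
    case 2 then show thesis using that[of r "r - of_real d" "of_real c"] r1 ch by (simp add: algebra_simps)
  next
    case 3 then show thesis using that[of r 1 0] r1 by simp
  next
    case 4 then show thesis using that[of r 0 1] r1 by simp
  qed
qed

text \<open>Truncating a bounded Floquet solution to \<open>N\<close> periods gives an approximate eigenvector.\<close>

lemma trace_imp_sspec_periodic:
  assumes q: "q \<ge> 1" and per: "\<And>n. V (n + int q) = V n" and tr: "\<bar>trace (transfer V E 0 q)\<bar> \<le> 2"
  shows "E \<in> sspec V"
proof (rule ccontr)
  assume "E \<notin> sspec V"
  have bV: "bounded (range V)" using bounded_range_periodic[of "int q" V] q per by simp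
  obtain c where c: "c > 0" "\<And>x. c * norm x \<le> norm (schr V x - E *\<^sub>R x)"
    using not_approx_spec_bounded_below[OF symmetric_operator.linear[OF symmetric_operator_schr[OF bV]] \<open>E \<notin> sspec V\<close>] by blast
  let ?M = "transfer V E 0 q"
  obtain r v w :: complex where r: "cmod r = 1" "(v, w) \<noteq> (0, 0)"
    and ev: "?M $ 1 $ 1 * v + ?M $ 1 $ 2 * w = r * v" "?M $ 2 $ 1 * v + ?M $ 2 $ 2 * w = r * w"
    using Floquet_multiplier[of "?M $ 1 $ 1" "?M $ 2 $ 2" "?M $ 1 $ 2" "?M $ 2 $ 1"] det_transfer[of V E 0 q] tr
    by (auto simp: trace_2 det_2)
  \<comment> \<open>This is the lower component, so \<open>s n\<close> is the Floquet solution at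
    site n - 1 with v at site 0 and w at site -1. The shift by one lets natural numbers index the
    sites from -1 on.\<close>
  define s where "s = (\<lambda>n. transfer V E 0 n $ 2 $ 1 * v + transfer V E 0 n $ 2 $ 2 * w)"
  have s1: "s (Suc n) = transfer V E 0 n $ 1 $ 1 * v + transfer V E 0 n $ 1 $ 2 * w" for n
    by (simp add: s_def matrix_mult_nth_2)
  have s2: "s (Suc (Suc n)) = of_real (E - V (int n)) * s (Suc n) - s n" for n
    unfolding s1[of "Suc n"] by (simp add: s_def matrix_mult_nth_2 algebra_simps)
  have sq: "s (n + q) = r * s n" for n
  proof -
    have "transfer V E 0 (n + q) = transfer V E 0 n ** ?M"
      using transfer_add[of V E 0 q n] transfer_periodic[of V "int q" E 0 1 n] per by (simp add: add.commute)
    then have "s (n + q) = of_real (transfer V E 0 n $ 2 $ 1) * (?M $ 1 $ 1 * v + ?M $ 1 $ 2 * w)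
        + of_real (transfer V E 0 n $ 2 $ 2) * (?M $ 2 $ 1 * v + ?M $ 2 $ 2 * w)"
      by (simp add: s_def matrix_mult_nth_2 algebra_simps)
    then show ?thesis unfolding ev by (simp add: s_def algebra_simps)
  qed
  have sqi: "cmod (s (n + i * q)) = cmod (s n)" for n i
    by (induction i) (simp_all add: sq r(1) norm_mult add.assoc[symmetric] add.commute[of q])
  define B where "B = Max (cmod ` s ` {..<q})"
  have sB: "cmod (s n) \<le> B" for n
  proof -
    have "cmod (s n) = cmod (s (n mod q))" using sqi[of "n mod q" "n div q"] by simp
    also have "\<dots> \<le> B" unfolding B_def using q by (intro Max_ge) auto
    finally show ?thesis .
  qed
  have "\<exists>n0<q. s (Suc n0) \<noteq> 0"
  proof (rule ccontr)
    assume neg: "\<not> ?thesis"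
    have "s (Suc (q - 1)) = 0" "s (Suc 0) = 0" using neg q by (metis Suc_le_eq One_nat_def diff_less zero_less_one, metis Suc_le_eq One_nat_def)
    then have "s (0 + q) = 0" using q by simp
    then have "s 0 = 0" using sq[of 0] r(1) by auto
    then show False using \<open>s (Suc 0) = 0\<close> r(2) s1[of 0] by (auto simp: s_def)
  qed
  then obtain n0 where n0: "n0 < q" "s (Suc n0) \<noteq> 0" by blast
  define p where "p = (cmod (s (Suc n0)))\<^sup>2"
  have p: "p > 0" using n0 by (simp add: p_def)
  \<comment> \<open>Cutting the solution to \<open>N\<close> periods makes the squared norm grow at
    least like N p, while the residual stays below 4 B; this contradicts the lower bound c for large
    \<open>N\<close>.\<close>
  have bound: "c\<^sup>2 * (real N * p) \<le> 16 * B\<^sup>2" if N: "N \<ge> 1" for N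
  proof -
    define \<phi> where "\<phi> = (\<lambda>n::int. if 0 \<le> n \<and> n < int (N * q) then s (Suc (nat n)) else 0)"
    have "\<phi> \<in> l2" unfolding l2_iff_bounded
    proof (intro exI allI impI)
      fix F :: "int set" assume F: "finite F"
      have "(\<Sum>n\<in>F. (cmod (\<phi> n))\<^sup>2) = (\<Sum>n\<in>F \<inter> {0..<int (N * q)}. (cmod (\<phi> n))\<^sup>2)"
        by (rule sum.mono_neutral_right) (auto simp: F \<phi>_def)
      also have "\<dots> \<le> (\<Sum>n\<in>{0..<int (N * q)}. (cmod (\<phi> n))\<^sup>2)" by (rule sum_mono2) auto
      finally show "(\<Sum>n\<in>F. (cmod (\<phi> n))\<^sup>2) \<le> (\<Sum>n\<in>{0..<int (N * q)}. (cmod (\<phi> n))\<^sup>2)" .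
    qed
    define x where "x = Abs_ell2 \<phi>"
    have apx: "ap x = \<phi>" unfolding x_def by (rule Abs_ell2_inverse) fact
    have "real N * p \<le> (norm x)\<^sup>2"
    proof -
      let ?F = "(\<lambda>i. int (n0 + i * q)) ` {..<N}"
      have "inj_on (\<lambda>i. int (n0 + i * q)) {..<N}" using q by (auto simp: inj_on_def)
      then have "(\<Sum>n\<in>?F. (cmod (ap x n))\<^sup>2) = (\<Sum>i<N. (cmod (ap x (int (n0 + i * q))))\<^sup>2)"
        by (simp add: sum.reindex)
      also have "\<dots> = (\<Sum>i<N. p)"
      proof (rule sum.cong)
        fix i assume "i \<in> {..<N}"
        then have "Suc i * q \<le> N * q" by (intro mult_le_mono1) auto
        then have "n0 + i * q < N * q" using n0(1) by simp
        then show "(cmod (ap x (int (n0 + i * q))))\<^sup>2 = p" using sqi[of "Suc n0" i]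
          by (simp add: apx \<phi>_def p_def del: of_nat_add of_nat_mult)
      qed simp
      finally show ?thesis using ell2_sum_le[of ?F x] by simp
    qed
    moreover have "norm (schr V x - E *\<^sub>R x) \<le> 4 * B"
    proof (rule ell2_norm_leI)
      have B0: "B \<ge> 0" using sB[of 0] norm_ge_zero order_trans by blast
      then show "4 * B \<ge> 0" by simp
      define L where "L = int (N * q)"
      have "N * q > 0" using N q by simp
      then have L: "L \<ge> 1" unfolding L_def by linarith
      have \<phi>in: "\<phi> n = s (Suc (nat n))" if "0 \<le> n" "n < L" for n using that by (simp add: \<phi>_def L_def)
      have \<phi>out: "\<phi> n = 0" if "n < 0 \<or> n \<ge> L" for n using that by (auto simp: \<phi>_def L_def)
      have nS: "nat (n + 1) = Suc (nat n)" if "0 \<le> n" for n using that by simp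
      have nP: "Suc (nat (n - 1)) = nat n" if "0 < n" for n using that by simp
      \<comment> \<open>Only at these sites, next to the two cuts, can the truncated solution fail
        the equation; each failure is at most 2 B.\<close>
      define S where "S = {-1, 0, L - 1, L}"
      define f where "f = schr V x - E *\<^sub>R x"
      have f: "ap f n = \<phi> (n - 1) + \<phi> (n + 1) + of_real (V n) * \<phi> n - of_real E * \<phi> n" for n
        by (simp add: f_def ap_schr bV apx)
      have eqn: "s (nat n) + s (Suc (Suc (nat n))) + of_real (V n) * s (Suc (nat n)) - of_real E * s (Suc (nat n)) = 0" if "n \<ge> 0" for n
        using s2[of "nat n"] that by (simp add: algebra_simps)
      have f0: "ap f n = 0" if "n \<notin> S" for n
      proof (cases "0 \<le> n \<and> n < L")
        case True
        then have n: "0 < n" "n < L - 1" using that by (auto simp: S_def)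
        have "\<phi> n = s (Suc (nat n))" "\<phi> (n + 1) = s (Suc (Suc (nat n)))" "\<phi> (n - 1) = s (nat n)"
          using n \<phi>in[of n] \<phi>in[of "n + 1"] \<phi>in[of "n - 1"] nS[of n] nP[of n] by simp_all
        then show ?thesis unfolding f using eqn[of n] n by simp
      next
        case False
        then have "\<phi> n = 0" "\<phi> (n - 1) = 0" "\<phi> (n + 1) = 0" 
            using that by (intro \<phi>out; auto simp: S_def)+
        then show ?thesis by (simp add: f)
      qed
      have f1: "cmod (ap f n) \<le> 2 * B" for n
      proof -
        consider "0 \<le> n" "n < L" | "n < 0" | "n \<ge> L" by linarith
        then show ?thesis
        proof cases
          case 1
          have "ap f n = (\<phi> (n - 1) - s (nat n)) + (\<phi> (n + 1) - s (Suc (Suc (nat n))))"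
            unfolding f using eqn[of n] 1 \<phi>in[of n] by (simp add: algebra_simps)
          moreover have "cmod (\<phi> (n - 1) - s (nat n)) \<le> B"
            using 1 sB[of "nat n"] B0 \<phi>in[of "n - 1"] \<phi>out[of "n - 1"] nP[of n] by (cases "n = 0") auto
          moreover have "cmod (\<phi> (n + 1) - s (Suc (Suc (nat n)))) \<le> B"
            using 1 sB[of "Suc (Suc (nat n))"] B0 \<phi>in[of "n + 1"] \<phi>out[of "n + 1"] nS[of n] by (cases "n + 1 < L") auto
          ultimately show ?thesis using norm_triangle_ineq[of "\<phi> (n - 1) - s (nat n)" "\<phi> (n + 1) - s (Suc (Suc (nat n)))"] by simp
        next
          case 2
          then have "ap f n = \<phi> (n + 1)" using \<phi>out[of n] \<phi>out[of "n - 1"] by (simp add: f)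
          then show ?thesis using sB[of "Suc (nat (n + 1))"] B0 by (simp add: \<phi>_def)
        next
          case 3
          then have "ap f n = \<phi> (n - 1)" using \<phi>out[of n] \<phi>out[of "n + 1"] by (simp add: f)
          then show ?thesis using sB[of "Suc (nat (n - 1))"] B0 by (simp add: \<phi>_def)
        qed
      qed
      fix F :: "int set" assume F: "finite F"
      have "(\<Sum>n\<in>F. (cmod (ap f n))\<^sup>2) = (\<Sum>n\<in>F \<inter> S. (cmod (ap f n))\<^sup>2)"
        by (rule sum.mono_neutral_right) (use F f0 in auto)
      also have "\<dots> \<le> (\<Sum>n\<in>F \<inter> S. (2 * B)\<^sup>2)" by (intro sum_mono power_mono f1) auto
      also have "\<dots> \<le> real 4 * (2 * B)\<^sup>2"
      proof -
        have "card (F \<inter> S) \<le> card S" by (intro card_mono) (auto simp: S_def)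
        also have "\<dots> \<le> 4" unfolding S_def using card_length[of "[-1, 0, L - 1, L]"] by simp
        finally have "real (card (F \<inter> S)) \<le> real 4" by (rule of_nat_mono)
        then show ?thesis by (simp only: sum_constant) (rule mult_right_mono, auto)
      qed
      finally show "(\<Sum>n\<in>F. (cmod (ap (schr V x - E *\<^sub>R x) n))\<^sup>2) \<le> (4 * B)\<^sup>2"
        by (simp add: f_def power_mult_distrib)
    qed
    ultimately have "(c * norm x)\<^sup>2 \<le> (4 * B)\<^sup>2" using c by (intro power_mono) (auto intro: order_trans)
    then show ?thesis using \<open>real N * p \<le> (norm x)\<^sup>2\<close> mult_left_mono[of "real N * p" "(norm x)\<^sup>2" "c\<^sup>2"]
      by (simp add: power_mult_distrib)
  qed
  have pos: "c\<^sup>2 * p > 0" using c(1) p by simp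
  obtain N :: nat where "16 * B\<^sup>2 / (c\<^sup>2 * p) < real N" using reals_Archimedean2 by blast
  then have "16 * B\<^sup>2 < c\<^sup>2 * (real (Suc N) * p)" using pos by (simp add: field_simps)
  then show False using bound[of "Suc N"] by simp
qed

section \<open>Spectral bands of periodic potentials\<close>

lemma transfer_poly: "\<exists>p. degree p \<le> n \<and> (\<forall>E. transfer V E m n $ i $ j = poly p E)"
proof -
  have "\<forall>i j. \<exists>p. degree p \<le> n \<and> (\<forall>E. transfer V E m n $ i $ j = poly p E)"
  proof (induction n)
    case 0
    have "degree [:c :: real:] \<le> 0 \<and> (\<forall>E. c = poly [:c:] E)" for c by simp
    then show ?case by (simp only: transfer.simps) blast
  next
    case (Suc n)
    have "\<exists>p. degree p \<le> Suc n \<and> (\<forall>E. transfer V E m (Suc n) $ 1 $ j = poly p E)" for j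
    proof -
      obtain p1 p2 where p: "degree p1 \<le> n" "degree p2 \<le> n"
        "\<And>E. transfer V E m n $ 1 $ j = poly p1 E" "\<And>E. transfer V E m n $ 2 $ j = poly p2 E"
        using Suc by metis
      have "degree ([:- V (m + int n), 1:] * p1) \<le> Suc n"
        using degree_mult_le[of "[:- V (m + int n), 1:]" p1] p(1) by simp
      then have "degree ([:- V (m + int n), 1:] * p1 - p2) \<le> Suc n"
        using p(2) by (intro degree_diff_le) auto
      moreover have "transfer V E m (Suc n) $ 1 $ j = poly ([:- V (m + int n), 1:] * p1 - p2) E" for E
        by (simp add: matrix_mult_nth_2 p(3,4) algebra_simps)
      ultimately show ?thesis by blast
    qed
    moreover have "\<exists>p. degree p \<le> Suc n \<and> (\<forall>E. transfer V E m (Suc n) $ 2 $ j = poly p E)" for j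
    proof -
      obtain p where "degree p \<le> n" "\<And>E. transfer V E m n $ 1 $ j = poly p E" using Suc by metis
      then show ?thesis by (intro exI[of _ p]) (simp add: matrix_mult_nth_2)
    qed
    ultimately show ?case by (simp only: forall_2)
  qed
  then show ?thesis by blast
qed

lemma trace_transfer_poly:
  obtains p where "degree p \<le> n" "\<And>E. trace (transfer V E m n) = poly p E"
proof -
  obtain p1 p2 where "degree p1 \<le> n" "degree p2 \<le> n"
    "\<And>E. transfer V E m n $ 1 $ 1 = poly p1 E" "\<And>E. transfer V E m n $ 2 $ 2 = poly p2 E"
    using transfer_poly by metis
  then show thesis using that[of "p1 + p2"] by (simp add: trace_2 degree_add_le)
qed

text \<open>The derivative of \<open>step_matrix (E - V n)\<close> with respect to E; it replaces
  one factor at a time in the product rule.\<close>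

definition unit_11 :: "real ^ 2 ^ 2" where
  "unit_11 = vector [vector [1, 0], vector [0, 0]]"

lemma unit_11_nth [simp]:
  "unit_11 $ 1 $ 1 = 1" "unit_11 $ 1 $ 2 = 0" "unit_11 $ 2 $ 1 = 0" "unit_11 $ 2 $ 2 = 0"
  by (simp_all add: unit_11_def)

lemma matrix_mult_sum_right: "(A :: real ^ 2 ^ 2) ** (\<Sum>i\<in>I. f i) = (\<Sum>i\<in>I. A ** f i)"
  by (induction I rule: infinite_finite_induct) (simp_all add: matrix_add_ldistrib)

lemma trace_sum: "trace (\<Sum>i\<in>I. f i :: real ^ 2 ^ 2) = (\<Sum>i\<in>I. trace (f i))"
  by (induction I rule: infinite_finite_induct) (simp_all add: trace_add trace_0[simplified mat_0] trace_2)

lemma DERIV_transfer: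
  "((\<lambda>E. transfer V E m n $ i $ k) has_real_derivative
     (\<Sum>j<n. transfer V E (m + int j + 1) (n - 1 - j) ** unit_11 ** transfer V E m j) $ i $ k) (at E)"
proof -
  define D where "D = (\<lambda>n. \<Sum>j<n. transfer V E (m + int j + 1) (n - 1 - j) ** unit_11 ** transfer V E m j)"
  have D_Suc: "D (Suc n) = unit_11 ** transfer V E m n + step_matrix (E - V (m + int n)) ** D n" for n
  proof -
    have "transfer V E (m + int j + 1) (Suc n - 1 - j) ** unit_11 ** transfer V E m j =
        step_matrix (E - V (m + int n)) ** (transfer V E (m + int j + 1) (n - 1 - j) ** unit_11 ** transfer V E m j)"
      if "j < n" for j
    proof -
      have "Suc n - 1 - j = Suc (n - 1 - j)" "m + int j + 1 + int (n - 1 - j) = m + int n" using that by auto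
      then show ?thesis by (simp only: transfer.simps matrix_mul_assoc)
    qed
    then show ?thesis unfolding D_def sum.lessThan_Suc matrix_mult_sum_right by (simp add: add.commute)
  qed
  have "\<forall>i k. ((\<lambda>E. transfer V E m n $ i $ k) has_real_derivative D n $ i $ k) (at E)"
  proof (induction n)
    case 0 show ?case by (simp add: D_def)
  next
    case (Suc n)
    have T: "((\<lambda>E. transfer V E m n $ i $ k) has_real_derivative D n $ i $ k) (at E)" for i k using Suc by blast
    have "((\<lambda>E. transfer V E m (Suc n) $ 1 $ k) has_real_derivative D (Suc n) $ 1 $ k) (at E)" for k
      unfolding D_Suc transfer.simps matrix_mult_nth_2
      by (auto simp: matrix_mult_nth_2 intro!: derivative_eq_intros T)
    moreover have "((\<lambda>E. transfer V E m (Suc n) $ 2 $ k) has_real_derivative D (Suc n) $ 2 $ k) (at E)" for k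
      unfolding D_Suc transfer.simps matrix_mult_nth_2
      by (auto simp: matrix_mult_nth_2 intro!: derivative_eq_intros T)
    ultimately show ?case by (simp only: forall_2)
  qed
  then show ?thesis unfolding D_def by blast
qed

text \<open>By cyclicity of the trace the differentiated factor moves to the front, and the other q
  - 1 factors form the transfer matrix starting just after it. Its upper left entry is the lower
  left entry of the full monodromy matrix there, because a step matrix copies the first row into the
  second.\<close>

lemma DERIV_trace_monodromy:
  assumes q: "q \<ge> 1" and per: "\<And>n. V (n + int q) = V n"
  shows "((\<lambda>E. trace (transfer V E m q)) has_real_derivative
     (\<Sum>j<q. transfer V E (m + int j + 1) q $ 2 $ 1)) (at E)"
proof -
  define D where "D = (\<Sum>j<q. transfer V E (m + int j + 1) (q - 1 - j) ** unit_11 ** transfer V E m j)"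
  have "((\<lambda>E. trace (transfer V E m q)) has_real_derivative trace D) (at E)"
    unfolding trace_2 D_def by (intro DERIV_add DERIV_transfer)
  moreover have "trace D = (\<Sum>j<q. transfer V E (m + int j + 1) q $ 2 $ 1)"
    unfolding D_def trace_sum
  proof (rule sum.cong)
    fix j assume "j \<in> {..<q}"
    then have j: "q - 1 = (q - 1 - j) + j" "m + int j + 1 + int (q - 1 - j) = m + int q" using q by auto
    let ?X = "transfer V E (m + int j + 1) (q - 1)"
    have "trace (transfer V E (m + int j + 1) (q - 1 - j) ** unit_11 ** transfer V E m j) =
        trace (unit_11 ** (transfer V E m j ** transfer V E (m + int j + 1) (q - 1 - j)))"
      by (metis matrix_mul_assoc trace_mul_sym)
    also have "transfer V E m j ** transfer V E (m + int j + 1) (q - 1 - j) = ?X"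
      using transfer_add[of V E "m + int j + 1" "q - 1 - j" j] transfer_periodic[of V "int q" E m 1 j] per
      unfolding j(2) j(1)[symmetric] by simp
    also have "trace (unit_11 ** ?X) = ?X $ 1 $ 1" by (simp add: trace_2 matrix_mult_nth_2)
    also have "\<dots> = transfer V E (m + int j + 1) (Suc (q - 1)) $ 2 $ 1" by (simp add: matrix_mult_nth_2)
    also have "Suc (q - 1) = q" using q by simp
    finally show "trace (transfer V E (m + int j + 1) (q - 1 - j) ** unit_11 ** transfer V E m j) =
        transfer V E (m + int j + 1) q $ 2 $ 1" .
  qed simp
  ultimately show ?thesis by simp
qed

text \<open>
  With \<open>M n\<close> the monodromy matrix based at \<open>n\<close>, the quadratic forms \<open>Q n v = \<omega> (v, M n v)\<close> satisfy
  \<open>Q n' (B v) = Q n v\<close> for the transfer matrix \<open>B\<close> from \<open>n\<close> to \<open>n'\<close>, and have determinant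
  \<open>1 - (tr M)\<^sup>2 / 4\<close>. So if \<open>B\<close> is large and \<open>tr M\<close> is not close to \<open>\<plusminus>2\<close>, then one of \<open>Q n\<close>, \<open>Q n'\<close> is
  large.  As \<open>Q n (1, 0) = c n\<close> and \<open>Q n (0, 1) = c (n + 1)\<close> with \<open>c n\<close> the lower left entry of \<open>M n\<close>,
  and the derivative of \<open>tr M\<close> is the sum of the \<open>c n\<close> over a period, which all have the same sign, this
  bounds that derivative from below.
\<close>

lemma trace_derivative_lower_bound:
  fixes V :: "int \<Rightarrow> real" and E :: real
  assumes q: "q \<ge> 1" and per: "\<And>n. V (n + int q) = V n"
  defines "D \<equiv> trace (transfer V E 0 q)"
  defines "D' \<equiv> \<Sum>j<q. transfer V E (int j + 1) q $ 2 $ 1"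
  assumes D: "\<bar>D\<bar> < 2" and t: "\<bar>trace (transfer V E n L)\<bar> \<ge> t" "t > 0"
  shows "\<bar>D'\<bar> \<ge> t / 3 * sqrt (1 - (D / 2)\<^sup>2)" "1 - (D / 2)\<^sup>2 > 0"
proof -
  define M where "M = (\<lambda>n. transfer V E n q)"
  define c where "c = (\<lambda>n. M n $ 2 $ 1)"
  define s where "s = 1 - (D / 2)\<^sup>2"
  have tr: "M n $ 1 $ 1 + M n $ 2 $ 2 = D" for n
    using trace_monodromy[of V q E n] per by (simp add: D_def trace_2 M_def)
  have det: "M n $ 1 $ 1 * M n $ 2 $ 2 - M n $ 1 $ 2 * M n $ 2 $ 1 = 1" for n
    using det_transfer[of V E n q] by (simp add: det_2 M_def)
  have "(D / 2)\<^sup>2 < 1" using D by (simp add: abs_square_less_1)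
  then show s: "1 - (D / 2)\<^sup>2 > 0" by simp
  have b: "M n $ 1 $ 2 = - c (n + 1)" for n
  proof -
    have "M (n + 1) ** step_matrix (E - V n) = step_matrix (E - V n) ** M n"
      using transfer_Suc_left[of V E n q] per by (simp add: M_def)
    from arg_cong[OF this, of "\<lambda>X. X $ 2 $ 2"] show ?thesis by (simp add: matrix_mult_nth_2 c_def)
  qed
  have s_eq: "c n * c (n + 1) - ((M n $ 2 $ 2 - M n $ 1 $ 1) / 2)\<^sup>2 = s" for n
  proof -
    have "c n * c (n + 1) = 1 - M n $ 1 $ 1 * M n $ 2 $ 2" using det[of n] b[of n] by (simp add: c_def algebra_simps)
    then show ?thesis unfolding s_def tr[of n, symmetric] by (simp add: power2_eq_square field_simps)
  qed
  \<comment> \<open>A form with positive determinant is definite, so its diagonal coefficients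
    \<open>c n\<close> and \<open>c (n + 1)\<close> agree in sign. Hence nothing cancels in
    \<open>D'\<close>.\<close>
  have same: "c n * c (n + 1) > 0" for n
    using s_eq[of n] s zero_le_power2[of "(M n $ 2 $ 2 - M n $ 1 $ 1) / 2"] unfolding s_def by linarith
  have sgn1: "sgn (c (n + 1)) = sgn (c n)" for n
    using same[of n] by (auto simp: zero_less_mult_iff)
  have sgn0: "sgn (c n) = sgn (c 0)" for n
  proof -
    have up: "sgn (c (m + int j)) = sgn (c m)" for m j
      by (induction j) (simp_all add: sgn1 flip: add.assoc add: add.commute[of 1])
    show ?thesis using up[of 0 "nat n"] up[of n "nat (- n)"] by (cases "n \<ge> 0") simp_all
  qed
  have c_per: "c (n + int q * j) = c n" for n j
    using transfer_periodic[of V "int q" E n j q] per by (simp add: c_def M_def)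
  have c_le: "\<bar>c n\<bar> \<le> \<bar>D'\<bar>" for n
  proof -
    define j where "j = nat ((n - 1) mod int q)"
    have j: "int j = (n - 1) mod int q" "j < q" using q by (auto simp: j_def nat_less_iff)
    have "n = (int j + 1) + int q * ((n - 1) div int q)" unfolding j(1) by simp
    then have "c n = c (int j + 1)" using c_per by metis
    then have "\<bar>c n\<bar> \<le> (\<Sum>j<q. \<bar>c (int j + 1)\<bar>)"
      using member_le_sum[of j "{..<q}" "\<lambda>j. \<bar>c (int j + 1)\<bar>"] j(2) by simp
    also have "\<dots> = (\<Sum>j<q. sgn (c 0) * c (int j + 1))"
      by (rule sum.cong) (metis refl abs_sgn mult.commute sgn0)+
    also have "\<dots> = sgn (c 0) * D'" by (simp add: D'_def c_def M_def sum_distrib_left)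
    also have "\<dots> \<le> \<bar>D'\<bar>" by (simp add: sgn_if abs_ge_self abs_ge_minus_self)
    finally show ?thesis .
  qed
  define B where "B = transfer V E n L"
  define n' where "n' = n + int L"
  define Q where "Q = (\<lambda>n x y. c n * x\<^sup>2 + (M n $ 2 $ 2 - M n $ 1 $ 1) * x * y + c (n + 1) * y\<^sup>2)"
  have QB: "Q n' (B $ 1 $ 1 * x + B $ 1 $ 2 * y) (B $ 2 $ 1 * x + B $ 2 $ 2 * y) = Q n x y" for x y
  proof -
    have MB: "M n' ** B = B ** M n"
      using transfer_add[of V E n L q] transfer_add[of V E n q L] transfer_periodic[of V "int q" E n 1 L] per
      by (simp add: M_def B_def n'_def add.commute)
    have dB: "B $ 1 $ 1 * B $ 2 $ 2 - B $ 1 $ 2 * B $ 2 $ 1 = 1"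
      using det_transfer[of V E n L] by (simp add: det_2 B_def)
    have Qw: "Q n x y = x * (M n $ 2 $ 1 * x + M n $ 2 $ 2 * y) - y * (M n $ 1 $ 1 * x + M n $ 1 $ 2 * y)" for n x y
      by (simp add: Q_def b c_def[of] power2_eq_square algebra_simps)
    let ?x = "B $ 1 $ 1 * x + B $ 1 $ 2 * y" and ?y = "B $ 2 $ 1 * x + B $ 2 $ 2 * y"
    let ?u = "M n $ 1 $ 1 * x + M n $ 1 $ 2 * y" and ?v = "M n $ 2 $ 1 * x + M n $ 2 $ 2 * y"
    have e: "M n' $ i $ 1 * B $ 1 $ j + M n' $ i $ 2 * B $ 2 $ j = B $ i $ 1 * M n $ 1 $ j + B $ i $ 2 * M n $ 2 $ j" for i j
      using arg_cong[OF MB, of "\<lambda>X. X $ i $ j"] by (simp add: matrix_mult_nth_2)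
    have "M n' $ i $ 1 * ?x + M n' $ i $ 2 * ?y = (M n' $ i $ 1 * B $ 1 $ 1 + M n' $ i $ 2 * B $ 2 $ 1) * x
        + (M n' $ i $ 1 * B $ 1 $ 2 + M n' $ i $ 2 * B $ 2 $ 2) * y" for i
      by (simp add: algebra_simps)
    then have e': "M n' $ i $ 1 * ?x + M n' $ i $ 2 * ?y = B $ i $ 1 * ?u + B $ i $ 2 * ?v" for i
      unfolding e by (simp add: algebra_simps)
    have "Q n' ?x ?y = ?x * (B $ 2 $ 1 * ?u + B $ 2 $ 2 * ?v) - ?y * (B $ 1 $ 1 * ?u + B $ 1 $ 2 * ?v)"
      unfolding Qw e' ..
    also have "\<dots> = (B $ 1 $ 1 * B $ 2 $ 2 - B $ 1 $ 2 * B $ 2 $ 1) * (x * ?v - y * ?u)"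
      by (simp only: distrib_left distrib_right left_diff_distrib right_diff_distrib mult_ac add_ac)
    finally show ?thesis unfolding Qw dB by simp
  qed
  \<comment> \<open>A positive definite form is at least its determinant over its trace times the
    squared norm. Multiplied by the trace, this holds for either sign, and the difference is an
    explicit sum of two squares.\<close>
  have Qlow: "s * (x\<^sup>2 + y\<^sup>2) \<le> (c n + c (n + 1)) * Q n x y" for n x y
  proof -
    define b' where "b' = (M n $ 2 $ 2 - M n $ 1 $ 1) / 2"
    have "(c n + c (n + 1)) * Q n x y - s * (x\<^sup>2 + y\<^sup>2) = (c n * x + b' * y)\<^sup>2 + (b' * x + c (n + 1) * y)\<^sup>2"
      unfolding s_eq[of n, symmetric] Q_def b'_def[symmetric]
      by (simp add: b'_def power2_eq_square field_simps)
    also have "\<dots> \<ge> 0" by simp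
    finally show ?thesis by simp
  qed
  have Q10: "Q n 1 0 = c n" and Q01: "Q n 0 1 = c (n + 1)" by (simp_all add: Q_def)
  have "s * ((B $ 1 $ 1)\<^sup>2 + (B $ 2 $ 1)\<^sup>2) \<le> (c n' + c (n' + 1)) * c n"
    using Qlow[of "B $ 1 $ 1" "B $ 2 $ 1" n'] QB[of 1 0] by (simp add: Q10)
  moreover have "s * ((B $ 1 $ 2)\<^sup>2 + (B $ 2 $ 2)\<^sup>2) \<le> (c n' + c (n' + 1)) * c (n + 1)"
    using Qlow[of "B $ 1 $ 2" "B $ 2 $ 2" n'] QB[of 0 1] by (simp add: Q01)
  ultimately have "s * ((B $ 1 $ 1)\<^sup>2 + (B $ 2 $ 1)\<^sup>2 + (B $ 1 $ 2)\<^sup>2 + (B $ 2 $ 2)\<^sup>2) \<le> (c n' + c (n' + 1)) * (c n + c (n + 1))"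
    by (simp add: algebra_simps)
  also have "\<dots> \<le> \<bar>c n' + c (n' + 1)\<bar> * \<bar>c n + c (n + 1)\<bar>" by (metis abs_ge_self abs_mult)
  also have "\<dots> \<le> (2 * \<bar>D'\<bar>) * (2 * \<bar>D'\<bar>)"
    using c_le[of n] c_le[of "n + 1"] c_le[of n'] c_le[of "n' + 1"] by (intro mult_mono) linarith+
  finally have up: "s * ((B $ 1 $ 1)\<^sup>2 + (B $ 2 $ 1)\<^sup>2 + (B $ 1 $ 2)\<^sup>2 + (B $ 2 $ 2)\<^sup>2) \<le> 4 * \<bar>D'\<bar>\<^sup>2" by (simp add: power2_eq_square)
  \<comment> \<open>The squared trace of B is at most twice the sum of the squared entries, which
    gives s t^2 \<le> 8 D'^2; the 8 is rounded up to 9 for the sake of a rational factor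
    1/3.\<close>
  have "t\<^sup>2 \<le> (trace B)\<^sup>2" using t unfolding B_def by (metis abs_le_square_iff abs_of_pos)
  also have "\<dots> \<le> 2 * (B $ 1 $ 1)\<^sup>2 + 2 * (B $ 2 $ 2)\<^sup>2"
    using sum_squares_bound[of "B $ 1 $ 1" "B $ 2 $ 2"] by (simp add: trace_2 power2_sum)
  also have "\<dots> \<le> 2 * ((B $ 1 $ 1)\<^sup>2 + (B $ 2 $ 1)\<^sup>2 + (B $ 1 $ 2)\<^sup>2 + (B $ 2 $ 2)\<^sup>2)" by simp
  finally have "s * t\<^sup>2 \<le> s * (2 * ((B $ 1 $ 1)\<^sup>2 + (B $ 2 $ 1)\<^sup>2 + (B $ 1 $ 2)\<^sup>2 + (B $ 2 $ 2)\<^sup>2))"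
    using s by (intro mult_left_mono) (auto simp: s_def)
  then have "s * t\<^sup>2 \<le> 8 * \<bar>D'\<bar>\<^sup>2" using up by (simp only: mult.left_commute[of s 2])
  moreover have "(t / 3 * sqrt s)\<^sup>2 = s * t\<^sup>2 / 9" using s by (simp add: power_mult_distrib power_divide s_def)
  ultimately have "(t / 3 * sqrt s)\<^sup>2 \<le> \<bar>D'\<bar>\<^sup>2" using zero_le_power2[of "\<bar>D'\<bar>"] by linarith
  then show "\<bar>D'\<bar> \<ge> t / 3 * sqrt (1 - (D / 2)\<^sup>2)" unfolding s_def by (rule power2_le_imp_le) simp
qed

text \<open>The phase arccos (D / 2) changes by at most \<pi> along a band, and its derivative has
  modulus \<bar>D'\<bar> / (2 sqrt (1 - (D / 2)^2)). The square root cancels against the one in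
  \<open>trace_derivative_lower_bound\<close>, leaving at least t / 6 up to the band edges, so the
  length is at most 6 \<pi> / t < 20 / t.\<close>

lemma band_length:
  assumes q: "q \<ge> 1" and per: "\<And>n. V (n + int q) = V n" and t: "t > 0" and "a \<le> b"
    and band: "\<And>E. a \<le> E \<Longrightarrow> E \<le> b \<Longrightarrow> \<bar>trace (transfer V E 0 q)\<bar> < 2"
    and block: "\<And>E. a \<le> E \<Longrightarrow> E \<le> b \<Longrightarrow> \<exists>n L. \<bar>trace (transfer V E n L)\<bar> \<ge> t"
  shows "b - a \<le> 20 / t"
proof (cases "a = b")
  case False
  define D where "D = (\<lambda>E. trace (transfer V E 0 q))"
  define D' where "D' = (\<lambda>E. \<Sum>j<q. transfer V E (int j + 1) q $ 2 $ 1)"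
  have DD: "(D has_real_derivative D' E) (at E)" for E
    using DERIV_trace_monodromy[of q V 0 E, OF q per] by (simp add: D_def D'_def)
  have D2: "\<bar>D E\<bar> < 2" if "a \<le> E" "E \<le> b" for E using band that by (simp add: D_def)
  let ?g' = "\<lambda>E. inverse (- sqrt (1 - (D E / 2)\<^sup>2)) * (D' E / 2)"
  have g: "((\<lambda>E. arccos (D E / 2)) has_real_derivative ?g' E) (at E)" if "a \<le> E" "E \<le> b" for E
    by (rule DERIV_chain2[OF DERIV_arccos DERIV_cdivide[OF DD]]) (use D2[OF that] in auto)
  have "\<exists>x>a. x < b \<and> arccos (D b / 2) - arccos (D a / 2) = (b - a) * ?g' x"
    by (rule MVT2) (use \<open>a \<le> b\<close> False in simp, rule g)
  then obtain x where x: "a < x" "x < b" "arccos (D b / 2) - arccos (D a / 2) = (b - a) * ?g' x" by blast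
  obtain n L where nL: "\<bar>trace (transfer V x n L)\<bar> \<ge> t" using block[of x] x by auto
  have low: "\<bar>D' x\<bar> \<ge> t / 3 * sqrt (1 - (D x / 2)\<^sup>2)" "1 - (D x / 2)\<^sup>2 > 0"
    using trace_derivative_lower_bound[of q V x t n L, OF q per _ nL t] D2[of x] x by (simp_all add: D_def D'_def)
  define r where "r = sqrt (1 - (D x / 2)\<^sup>2)"
  have r: "r > 0" using low(2) by (simp add: r_def)
  have "inverse (- r) * (D' x / 2) = - (D' x / (2 * r))" using r by (simp add: field_simps)
  then have "\<bar>?g' x\<bar> = \<bar>D' x\<bar> / (2 * r)" using r unfolding r_def[symmetric] by simp
  moreover have "t / 6 \<le> \<bar>D' x\<bar> / (2 * r)" using low(1) r unfolding r_def[symmetric] by (simp add: field_simps)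
  ultimately have "(b - a) * (t / 6) \<le> (b - a) * \<bar>?g' x\<bar>" using \<open>a \<le> b\<close> by (intro mult_left_mono) auto
  also have "\<dots> = \<bar>arccos (D b / 2) - arccos (D a / 2)\<bar>" using x(3) \<open>a \<le> b\<close> by (simp add: abs_mult)
  also have "\<dots> \<le> pi"
  proof -
    have "0 \<le> arccos (D E / 2) \<and> arccos (D E / 2) \<le> pi" if "\<bar>D E\<bar> < 2" for E
      using that by (intro conjI arccos_lbound arccos_ubound) auto
    from this[of a] this[of b] show ?thesis using D2[of a] D2[of b] \<open>a \<le> b\<close> by simp linarith
  qed
  also have "pi < 10 / 3" using pi_less_4 pi_approx by simp
  finally show ?thesis using t by (simp add: field_simps)
qed (use t in simp)

text \<open>
  The discriminant is a polynomial of degree at most \<open>q\<close>, so the points where it equals \<open>\<plusminus>2\<close>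
  cut the line into at most \<open>2 q + 1\<close> pieces.
\<close>

lemma periodic_sspec_cover:
  assumes q: "q \<ge> 1" and per: "\<And>n. V (n + int q) = V n" and t: "t > 0" and U: "is_interval U"
    and block: "\<And>E. E \<in> U \<Longrightarrow> \<exists>n L. \<bar>trace (transfer V E n L)\<bar> \<ge> t"
  shows "\<exists>F. finite F \<and> card F \<le> 4 * q + 1 \<and> U \<inter> sspec V \<subseteq> (\<Union>c\<in>F. cball c (20 / t))"
proof -
  obtain p where p: "degree p \<le> q" "\<And>E. trace (transfer V E 0 q) = poly p E"
    using trace_transfer_poly by metis
  \<comment> \<open>Negative exactly where the discriminant lies strictly between -2 and 2, with the
    remaining points of the spectrum among its roots.\<close>
  define P where "P = p\<^sup>2 - [:4:]"
  have polyP: "poly P E = (poly p E)\<^sup>2 - 4" for E by (simp add: P_def)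
  have neg: "poly P E < 0 \<longleftrightarrow> \<bar>poly p E\<bar> < 2" for E
    using abs_square_less_1[of "poly p E / 2"] by (simp add: polyP power_divide)
  have bV: "bounded (range V)" using bounded_range_periodic[of "int q" V] q per by simp
  have "P \<noteq> 0"
  proof
    assume "P = 0"
    then have "\<bar>poly p E\<bar> = 2" for E
      using polyP[of E] abs_square_eq_1[of "poly p E / 2"] by (simp add: power_divide)
    then have "sspec V = UNIV" using trace_imp_sspec_periodic[of q V, OF q per] by (auto simp: p(2))
    then show False using compact_sspec[OF bV] by (simp add: compact_eq_bounded_closed)
  qed
  define R where "R = {E. poly P E = 0}"
  have finR: "finite R" unfolding R_def using \<open>P \<noteq> 0\<close> by (rule poly_roots_finite)
  have "degree P \<le> 2 * q" unfolding P_def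
    using p(1) degree_power_le[of p 2] by (intro degree_diff_le) auto
  then have cardR: "card R \<le> 2 * q" unfolding R_def using card_poly_roots_bound[OF \<open>P \<noteq> 0\<close>] by simp
  define B where "B = {E\<in>U. \<bar>poly p E\<bar> < 2}"
  \<comment> \<open>The number of roots below a point labels the piece it lies in: two points of B
    with the same label have no root between them.\<close>
  define k where "k = (\<lambda>E. card {r\<in>R. r < E})"
  have k_le: "k E \<le> 2 * q" for E unfolding k_def using card_mono[OF finR, of "{r\<in>R. r < E}"] cardR by simp
  have close: "b - a \<le> 20 / t" if ab: "a \<in> B" "b \<in> B" "k a = k b" "a \<le> b" for a b
  proof (rule band_length[of q V, OF q per t ab(4)])
    fix E assume E: "a \<le> E" "E \<le> b"
    have EU: "E \<in> U" using U ab(1,2) E unfolding is_interval_1 B_def by blast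
    then show "\<exists>n L. \<bar>trace (transfer V E n L)\<bar> \<ge> t" by (rule block)
    have noroot: "r \<notin> R" if r: "a \<le> r" "r \<le> b" for r
    proof
      assume "r \<in> R"
      moreover have "poly P a < 0" "poly P b < 0" using ab(1,2) by (auto simp: neg B_def)
      ultimately have "a < r" "r < b" using r by (auto simp: R_def order.order_iff_strict)
      then have "r \<in> {r\<in>R. r < b}" "r \<notin> {r\<in>R. r < a}" using \<open>r \<in> R\<close> by simp_all
      moreover have "{r\<in>R. r < a} \<subseteq> {r\<in>R. r < b}" using ab(4) by (intro Collect_mono) simp
      ultimately have "{r\<in>R. r < a} \<subset> {r\<in>R. r < b}" by blast
      then have "k a < k b" unfolding k_def using finR by (intro psubset_card_mono) auto
      then show False using ab(3) by simp
    qed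
    have "poly P a < 0" using ab(1) by (simp add: neg B_def)
    have "poly P E < 0"
    proof (rule ccontr)
      assume "\<not> ?thesis"
      then obtain r where "a \<le> r" "r \<le> E" "poly P r = 0"
        using IVT'[of "poly P" a 0 E] \<open>poly P a < 0\<close> E
        by (auto simp: continuous_at_imp_continuous_on)
      then show False using noroot[of r] E by (simp add: R_def)
    qed
    then show "\<bar>trace (transfer V E 0 q)\<bar> < 2" by (simp add: p(2) neg)
  qed
  \<comment> \<open>If no point of \<open>B\<close> carries the label i, the chosen centre is
    arbitrary and harmless. At most 2 q roots and 2 q + 1 representatives make 4 q + 1
    centres.\<close>
  define rep where "rep = (\<lambda>i. SOME c. c \<in> B \<and> k c = i)"
  define F where "F = R \<union> rep ` {..2 * q}"
  have "card F \<le> card R + card (rep ` {..2 * q})" unfolding F_def by (rule card_Un_le)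
  also have "card (rep ` {..2 * q}) \<le> 2 * q + 1" using card_image_le[of "{..2 * q}" rep] by simp
  finally have "card F \<le> 4 * q + 1" using cardR by simp
  moreover have "U \<inter> sspec V \<subseteq> (\<Union>c\<in>F. cball c (20 / t))"
  proof
    fix E assume E: "E \<in> U \<inter> sspec V"
    then have "\<bar>poly p E\<bar> \<le> 2" using sspec_periodic_imp_trace[of q V E, OF q per] by (simp add: p(2))
    then consider "\<bar>poly p E\<bar> = 2" | "\<bar>poly p E\<bar> < 2" by linarith
    then show "E \<in> (\<Union>c\<in>F. cball c (20 / t))"
    proof cases
      case 1
      have "(poly p E)\<^sup>2 = \<bar>poly p E\<bar>\<^sup>2" by simp
      also have "\<dots> = 4" unfolding 1 by simp
      finally have "(poly p E)\<^sup>2 = 4" .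
      then have "E \<in> F" by (simp add: F_def R_def polyP)
      then show ?thesis using t by (intro UN_I[of E]) auto
    next
      case 2
      then have "E \<in> B" using E by (simp add: B_def)
      then have "rep (k E) \<in> B \<and> k (rep (k E)) = k E"
        unfolding rep_def using someI[of "\<lambda>c. c \<in> B \<and> k c = k E" E] by simp
      then have "\<bar>rep (k E) - E\<bar> \<le> 20 / t"
      proof (cases "E \<le> rep (k E)")
        case True
        then show ?thesis using close[of E "rep (k E)"] \<open>E \<in> B\<close> \<open>rep (k E) \<in> B \<and> k (rep (k E)) = k E\<close> by simp
      next
        case False
        then show ?thesis using close[of "rep (k E)" E] \<open>E \<in> B\<close> \<open>rep (k E) \<in> B \<and> k (rep (k E)) = k E\<close> by simp
      qed
      moreover have "rep (k E) \<in> F" unfolding F_def using k_le[of E] by blast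
      ultimately show ?thesis by (intro UN_I[of "rep (k E)"]) (auto simp: dist_real_def)
    qed
  qed
  moreover have "finite F" using finR by (simp add: F_def)
  ultimately show ?thesis by blast
qed

section \<open>Small covers, gaps, and concatenation\<close>

text \<open>The elements of F are pairs of centre and positive radius. Mesh, exponent and total size
  are all 1/n, so having such a cover for every large n gives dimension zero at all scales. As
  \<open>1 / real 0\<close> is 0, the case n = 0 allows the empty set only.\<close>

definition small_cover :: "nat \<Rightarrow> real set \<Rightarrow> bool" where
  "small_cover n A \<longleftrightarrow> (\<exists>F. finite F \<and> (\<forall>f\<in>F. 0 < snd f \<and> 2 * snd f \<le> 1 / real n) \<and>
     A \<subseteq> (\<Union>f\<in>F. cball (fst f) (snd f)) \<and> (\<Sum>f\<in>F. (2 * snd f) powr (1 / real n)) \<le> 1 / real n)"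

text \<open>All diameters are at most 1, so raising the exponent from 1/n to s decreases every term.
  The finite cover becomes a sequence by adding empty sets, which have diameter 0 and contribute 0
  powr s = 0.\<close>

lemma hausdorff_content_small_cover:
  assumes A: "small_cover n A" and n: "n \<ge> 1" "1 / real n \<le> s" "1 / real n \<le> d"
  shows "hausdorff_content s d A \<le> ennreal (1 / real n)"
proof -
  obtain F where F: "finite F" "\<And>f. f \<in> F \<Longrightarrow> 0 < snd f \<and> 2 * snd f \<le> 1 / real n"
    "A \<subseteq> (\<Union>f\<in>F. cball (fst f) (snd f))" "(\<Sum>f\<in>F. (2 * snd f) powr (1 / real n)) \<le> 1 / real n"
    using A unfolding small_cover_def by blast
  obtain g where g: "bij_betw g {0..<card F} F" using ex_bij_betw_nat_finite[OF F(1)] by blast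
  define U where "U = (\<lambda>i. if i < card F then cball (fst (g i)) (snd (g i)) else {})"
  have gF: "g i \<in> F" if "i < card F" for i using g that by (auto simp: bij_betw_def)
  have g2: "0 < snd (g i)" "2 * snd (g i) \<le> 1 / real n" if "i < card F" for i
    using F(2)[OF gF[OF that]] by auto
  have diam: "diameter (U i) = (if i < card F then 2 * snd (g i) else 0)" for i
    using g2[of i] by (auto simp: U_def)
  have "A \<subseteq> (\<Union>i. U i)"
  proof
    fix a assume "a \<in> A"
    then obtain f where f: "f \<in> F" "a \<in> cball (fst f) (snd f)" using F(3) by blast
    then obtain i where "i < card F" "g i = f" using g by (metis atLeastLessThan_iff bij_betw_iff_bijections)
    then have "a \<in> U i" using f by (simp add: U_def)
    then show "a \<in> (\<Union>i. U i)" by blast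
  qed
  moreover have "bounded (U i) \<and> diameter (U i) \<le> d" for i
  proof
    show "bounded (U i)" by (simp add: U_def)
    have "0 \<le> d" using n by (smt (verit) divide_nonneg_nonneg of_nat_0_le_iff)
    then show "diameter (U i) \<le> d" using g2[of i] n(3) by (auto simp: diam)
  qed
  ultimately have "hausdorff_content s d A \<le> (\<Sum>i. ennreal (diameter (U i) powr s))"
    unfolding hausdorff_content_def by (intro INF_lower) blast
  also have "\<dots> = (\<Sum>i\<in>{0..<card F}. ennreal (diameter (U i) powr s))"
    by (rule suminf_finite) (auto simp: diam)
  also have "\<dots> \<le> (\<Sum>i\<in>{0..<card F}. ennreal ((2 * snd (g i)) powr (1 / real n)))"
  proof (rule sum_mono, rule ennreal_leI)
    fix i assume "i \<in> {0..<card F}"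
    then have i: "i < card F" by simp
    have "1 / real n \<le> 1" using n(1) by simp
    then have "2 * snd (g i) \<le> 1" using g2(2)[OF i] by linarith
    then show "diameter (U i) powr s \<le> (2 * snd (g i)) powr (1 / real n)"
      using g2[OF i] n(2) i by (simp add: diam powr_mono')
  qed
  also have "\<dots> = ennreal (\<Sum>i\<in>{0..<card F}. (2 * snd (g i)) powr (1 / real n))"
    by (rule sum_ennreal) simp
  also have "(\<Sum>i\<in>{0..<card F}. (2 * snd (g i)) powr (1 / real n)) = (\<Sum>f\<in>F. (2 * snd f) powr (1 / real n))"
    by (rule sum.reindex_bij_betw[OF g])
  also have "ennreal \<dots> \<le> ennreal (1 / real n)" using F(4) by (rule ennreal_leI)
  finally show ?thesis .
qed

lemma hausdorff_dim_small_cover: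
  assumes "\<And>n. n \<ge> n0 \<Longrightarrow> small_cover n A"
  shows "hausdorff_dim A = 0"
proof -
  have meas: "hausdorff_measure s A = 0" if s: "s > 0" for s
  proof -
    have "hausdorff_content s d A \<le> 0" if d: "d > 0" for d
    proof (rule tendsto_lowerbound)
      show "(\<lambda>n. ennreal (1 / real n)) \<longlonglongrightarrow> 0"
        using tendsto_ennrealI[OF lim_1_over_n[where 'a = real]] by (simp add: ennreal_0)
      have "(\<lambda>n. 1 / real n) \<longlonglongrightarrow> 0" by (rule lim_1_over_n)
      then have "\<forall>\<^sub>F n in sequentially. 1 / real n < min s d" using s d by (intro order_tendstoD) auto
      then show "\<forall>\<^sub>F n in sequentially. hausdorff_content s d A \<le> ennreal (1 / real n)"
        using eventually_ge_at_top[of "max 1 n0"]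
        by eventually_elim (rule hausdorff_content_small_cover, use assms in auto)
    qed simp
    then show ?thesis unfolding hausdorff_measure_def by (simp add: SUP_eq_const le_zero_eq)
  qed
  have le: "hausdorff_dim A \<le> ennreal e" if "e > 0" for e
    unfolding hausdorff_dim_def by (rule Inf_lower) (use meas that in auto)
  have "hausdorff_dim A \<le> 0"
  proof (rule ennreal_le_epsilon)
    fix e :: real assume "0 < e"
    then show "hausdorff_dim A \<le> 0 + ennreal e" using le[of e] by simp
  qed
  then show ?thesis by simp
qed

text \<open>A length of at most 1 does not exceed its power with exponent 1/n, so the covers have
  total length at most 1/n, too little for a fixed interval when n is large.\<close>

lemma interior_small_cover:
  assumes "\<And>n. n \<ge> n0 \<Longrightarrow> small_cover n A"
  shows "interior A = {}"
proof (rule ccontr)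
  assume "interior A \<noteq> {}"
  then obtain a e where e: "e > 0" "cball a e \<subseteq> A" using mem_interior_cball by (metis ex_in_conv)
  have "2 * e \<le> 0"
  proof (rule tendsto_lowerbound)
    show "(\<lambda>n. 1 / real n) \<longlonglongrightarrow> 0" by (rule lim_1_over_n)
    show "\<forall>\<^sub>F n in sequentially. 2 * e \<le> 1 / real n"
    proof (rule eventually_sequentiallyI[of "max 1 n0"])
      fix n assume n: "n \<ge> max 1 n0"
      then have "small_cover n A" by (intro assms) simp
      then obtain F where F: "finite F" "\<And>f. f \<in> F \<Longrightarrow> 0 < snd f \<and> 2 * snd f \<le> 1 / real n"
        "A \<subseteq> (\<Union>f\<in>F. cball (fst f) (snd f))" "(\<Sum>f\<in>F. (2 * snd f) powr (1 / real n)) \<le> 1 / real n"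
        unfolding small_cover_def by blast
      have fm: "cball (c :: real) r \<in> fmeasurable lborel" for c r
        by (rule fmeasurable_compact) simp
      have mc: "measure lborel (cball (c :: real) r) = 2 * r" if "r > 0" for c r
        using that by (simp add: cball_eq_atLeastAtMost)
      have "2 * e = measure lborel (cball a e)" using e by (simp add: mc)
      also have "\<dots> \<le> measure lborel (\<Union>f\<in>F. cball (fst f) (snd f))"
      proof (rule measure_mono_fmeasurable)
        show "cball a e \<subseteq> (\<Union>f\<in>F. cball (fst f) (snd f))" using e(2) F(3) by (rule subset_trans)
        show "(\<Union>f\<in>F. cball (fst f) (snd f)) \<in> fmeasurable lborel" using F(1) by (intro fmeasurable.finite_UN fm)
      qed simp
      also have "\<dots> \<le> (\<Sum>f\<in>F. measure lborel (cball (fst f) (snd f)))"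
        using F(1) by (intro measure_UNION_le) auto
      also have "\<dots> \<le> (\<Sum>f\<in>F. (2 * snd f) powr (1 / real n))"
      proof (rule sum_mono)
        fix f assume "f \<in> F"
        then have f: "0 < snd f" "2 * snd f \<le> 1 / real n" using F(2)[of f] by auto
        have "1 / real n \<le> 1" using n by simp
        then have "2 * snd f \<le> 1" using f(2) by linarith
        then have "(2 * snd f) powr 1 \<le> (2 * snd f) powr (1 / real n)"
          using f n by (intro powr_mono') auto
        then show "measure lborel (cball (fst f) (snd f)) \<le> (2 * snd f) powr (1 / real n)"
          using f by (simp add: mc)
      qed
      finally show "2 * e \<le> 1 / real n" using F(4) by simp
    qed
  qed simp
  then show False using e by simp
qed

section \<open>Openness of gaps in coupling and energy, and growth of traces under
  repetition\<close>

lemma gap_neighbourhood: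
  assumes v: "bounded (range v)" and E: "E \<notin> sspec (\<lambda>n. l * v n)"
  shows "\<exists>h>0. \<forall>l'\<in>cball l h. \<forall>E'\<in>cball E h. E' \<notin> sspec (\<lambda>n. l' * v n)"
proof -
  obtain b where b: "b > 0" "\<And>n. \<bar>v n\<bar> \<le> b" using v bounded_range_real by blast
  have bv: "bounded (range (\<lambda>n. l * v n))" for l
    unfolding bounded_range_real using b mult_mono[of "\<bar>l\<bar>" "\<bar>l\<bar> + 1" "\<bar>v _\<bar>" b]
    by (intro exI[of _ "(\<bar>l\<bar> + 1) * b"]) (auto simp: abs_mult)
  have "open (- sspec (\<lambda>n. l * v n))" using closed_sspec[OF bv] by (simp add: open_Compl)
  then obtain e where e: "e > 0" "cball E e \<subseteq> - sspec (\<lambda>n. l * v n)" using E unfolding open_contains_cball by auto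
  \<comment> \<open>Moving the energy and moving the coupling may each cost e/4; the latter changes
    the potential by at most h b.\<close>
  define h where "h = min (e / 4) (e / (4 * b))"
  have h: "h > 0" "h \<le> e / 4" "h * b \<le> e / 4"
  proof -
    show "h > 0" "h \<le> e / 4" using e b by (auto simp: h_def)
    have "h \<le> e / (4 * b)" by (simp add: h_def)
    then show "h * b \<le> e / 4" using b(1) by (simp add: field_simps)
  qed
  have "E' \<notin> sspec (\<lambda>n. l' * v n)" if "l' \<in> cball l h" "E' \<in> cball E h" for l' E'
  proof
    assume *: "E' \<in> sspec (\<lambda>n. l' * v n)"
    have "\<bar>l' * v n - l * v n\<bar> \<le> e / 4" for n
    proof -
      have "\<bar>l' * v n - l * v n\<bar> = \<bar>l' - l\<bar> * \<bar>v n\<bar>" by (simp flip: abs_mult left_diff_distrib)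
      also have "\<dots> \<le> h * b" using that(1) b h by (intro mult_mono) (auto simp: dist_real_def abs_minus_commute)
      finally show ?thesis using h by simp
    qed
    then obtain E2 where E2: "E2 \<in> sspec (\<lambda>n. l * v n)" "\<bar>E2 - E'\<bar> \<le> e / 4"
      using sspec_perturb[OF bv bv _ *] by blast
    have "E2 \<in> cball E e" using E2(2) that(2) h e(1) by (simp add: dist_real_def abs_if split: if_splits)
    then show False using e(2) E2(1) by blast
  qed
  then show ?thesis using h(1) by blast
qed

text \<open>By Cayley-Hamilton and determinant 1, the traces of the powers satisfy T (N + 2) = T 1 *
  T (N + 1) - T N. The subtracted term uses up the 1 in 1 + th and leaves growth by the factor th,
  provided the moduli never decrease, which the induction therefore carries along.\<close>

lemma trace_power_lower_bound:
  assumes per: "\<And>n. V (n + int P) = V n" and th: "th \<ge> 1" "\<bar>trace (transfer V E m P)\<bar> \<ge> 1 + th"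
  shows "\<bar>trace (transfer V E m (N * P))\<bar> \<ge> th ^ N"
proof -
  let ?M = "transfer V E m P"
  define T where "T = (\<lambda>N. trace (transfer V E m (N * P)))"
  have X: "transfer V E m (Suc N * P) = ?M ** transfer V E m (N * P)" for N
    using transfer_add[of V E m "N * P" P] transfer_periodic[of V "int P" E m "int N" P] per
    by (simp add: add.commute mult.commute)
  have rec: "T (Suc (Suc N)) = T 1 * T (Suc N) - T N" for N
  proof -
    let ?X = "transfer V E m (N * P)"
    have det: "?M $ 1 $ 1 * ?M $ 2 $ 2 - ?M $ 1 $ 2 * ?M $ 2 $ 1 = 1" using det_transfer[of V E m P] by (simp add: det_2)
    have "T (Suc (Suc N)) - T 1 * T (Suc N) = - (?M $ 1 $ 1 * ?M $ 2 $ 2 - ?M $ 1 $ 2 * ?M $ 2 $ 1) * T N"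
      unfolding T_def X[of "Suc N"] X[of N] by (simp add: trace_2 matrix_mult_nth_2 algebra_simps)
    then show ?thesis unfolding det by simp
  qed
  have T0: "T 0 = 2" by (simp add: T_def trace_2)
  have T1: "\<bar>T 1\<bar> \<ge> 1 + th" using th by (simp add: T_def)
  have "\<bar>T N\<bar> \<le> \<bar>T (Suc N)\<bar> \<and> th ^ Suc N \<le> \<bar>T (Suc N)\<bar>" for N
  proof (induction N)
    case 0 show ?case using T0 T1 th by simp
  next
    case (Suc N)
    have "(1 + th) * \<bar>T (Suc N)\<bar> \<le> \<bar>T 1\<bar> * \<bar>T (Suc N)\<bar>" using T1 by (intro mult_right_mono) auto
    also have "\<dots> \<le> \<bar>T (Suc (Suc N))\<bar> + \<bar>T N\<bar>"
      unfolding rec abs_mult[symmetric] by (metis abs_triangle_ineq diff_add_cancel)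
    finally have 1: "th * \<bar>T (Suc N)\<bar> \<le> \<bar>T (Suc (Suc N))\<bar>" using Suc by (simp add: algebra_simps)
    have 2: "1 * \<bar>T (Suc N)\<bar> \<le> th * \<bar>T (Suc N)\<bar>" using th(1) by (intro mult_right_mono) auto
    have 3: "th * th ^ Suc N \<le> th * \<bar>T (Suc N)\<bar>" using Suc th(1) by (intro mult_left_mono) auto
    show ?case using 1 2 3 by (simp only: power_Suc) linarith
  qed
  then have "th ^ N \<le> \<bar>T N\<bar>" using T0 by (cases N) auto
  then show ?thesis by (simp add: T_def)
qed

lemma continuous_on_transfer:
  "continuous_on A (\<lambda>(l, E). transfer (\<lambda>n. l * v n) E m n $ i $ j)"
proof -
  have "\<forall>i j. continuous_on A (\<lambda>x. transfer (\<lambda>n. fst x * v n) (snd x) m n $ i $ j)"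
  proof (induction n)
    case (Suc n)
    then have "continuous_on A (\<lambda>x. transfer (\<lambda>n. fst x * v n) (snd x) m n $ i $ j)" for i j by blast
    note [continuous_intros] = this
    have "continuous_on A (\<lambda>x. transfer (\<lambda>n. fst x * v n) (snd x) m (Suc n) $ 1 $ j)" for j
      by (simp add: matrix_mult_nth_2) (intro continuous_intros)
    moreover have "continuous_on A (\<lambda>x. transfer (\<lambda>n. fst x * v n) (snd x) m (Suc n) $ 2 $ j)" for j
      by (simp add: matrix_mult_nth_2) (intro continuous_intros)
    ultimately show ?case by (simp only: forall_2)
  qed simp
  then show ?thesis by (simp add: case_prod_beta)
qed

text \<open>By \<open>trace_imp_sspec_periodic\<close> the modulus of the trace exceeds 2 on
  \<open>B\<close>, and being continuous it attains a minimum there; th is this minimum less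
  1.\<close>

lemma uniform_trace_gap:
  assumes P: "P \<ge> 1" and per: "\<And>n. v (n + int P) = v n" and B: "compact B"
    and gap: "\<And>l E. (l, E) \<in> B \<Longrightarrow> E \<notin> sspec (\<lambda>n. l * v n)"
  shows "\<exists>th>1. \<forall>(l, E)\<in>B. \<bar>trace (transfer (\<lambda>n. l * v n) E m P)\<bar> \<ge> 1 + th"
proof (cases "B = {}")
  case False
  define f where "f = (\<lambda>(l, E). \<bar>trace (transfer (\<lambda>n. l * v n) E m P)\<bar>)"
  have "continuous_on B f"
    using continuous_on_transfer[of B v m P 1 1] continuous_on_transfer[of B v m P 2 2]
    unfolding f_def trace_2 case_prod_beta by (intro continuous_on_rabs continuous_on_add)
  then obtain x where x: "x \<in> B" "\<And>y. y \<in> B \<Longrightarrow> f x \<le> f y"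
    using continuous_attains_inf[OF B False] by blast
  have "f x > 2"
  proof (rule ccontr)
    assume "\<not> ?thesis"
    moreover obtain l E where "x = (l, E)" by (cases x)
    moreover have "trace (transfer (\<lambda>n. l * v n) E m P) = trace (transfer (\<lambda>n. l * v n) E 0 P)"
      by (rule trace_monodromy) (simp add: per)
    ultimately show False using trace_imp_sspec_periodic[of P "\<lambda>n. l * v n" E] P per gap[of l E] x(1)
      by (simp add: f_def)
  qed
  then show ?thesis using x(2) by (intro exI[of _ "f x - 1"]) (auto simp: f_def)
qed (use exI[of "\<lambda>th. 1 < th" "2 :: real"] in auto)

text \<open>Used to choose the number of repetitions: a N + b counts intervals of diameter 80 /
  th^N. The 80 is the 20 of \<open>periodic_sspec_cover\<close>, doubled once for the perturbation
  and once from radius to diameter.\<close>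

lemma exponential_beats_linear:
  fixes th :: real
  assumes th: "th > 1" and n: "n \<ge> (1::nat)" and e: "e > 0"
  shows "\<exists>N\<ge>1. 80 / th ^ N \<le> e \<and> (a * real N + b) * (80 / th ^ N) powr (1 / real n) \<le> e"
proof -
  define x where "x = 1 / th powr (1 / real n)"
  have thp: "th powr (1 / real n) > 1" using th n by (simp add: powr_less_mono2[of _ 1, simplified] gr_one_powr)
  have x: "\<bar>x\<bar> < 1" "x > 0" using thp by (auto simp: x_def divide_less_eq)
  have eq: "(80 / th ^ N) powr (1 / real n) = 80 powr (1 / real n) * x ^ N" for N
    using th by (simp add: x_def powr_divide power_divide powr_realpow[symmetric] powr_powr powr_mult mult.commute)
  have "(\<lambda>N. 80 powr (1 / real n) * (a * (real N * x ^ N) + b * x ^ N)) \<longlonglongrightarrow> 80 powr (1 / real n) * (a * 0 + b * 0)"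
    using x by (intro tendsto_intros LIMSEQ_power_zero powser_times_n_limit_0) auto
  then have "\<forall>\<^sub>F N in sequentially. 80 powr (1 / real n) * (a * (real N * x ^ N) + b * x ^ N) < e"
    using e by (intro order_tendstoD) auto
  moreover have "(\<lambda>N. 80 * (1 / th) ^ N) \<longlonglongrightarrow> 80 * 0"
    using th by (intro tendsto_intros LIMSEQ_power_zero) auto
  then have "\<forall>\<^sub>F N in sequentially. 80 * (1 / th) ^ N < e" using e by (intro order_tendstoD) auto
  ultimately have "\<forall>\<^sub>F N in sequentially. N \<ge> 1 \<and> 80 / th ^ N \<le> e \<and> (a * real N + b) * (80 / th ^ N) powr (1 / real n) \<le> e"
    using eventually_ge_at_top[of 1]
  proof eventually_elim
    case (elim N)
    then show ?case unfolding eq by (auto simp: power_divide algebra_simps)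
  qed
  then show ?thesis using eventually_happens[of _ sequentially] by fastforce
qed

text \<open>The s-th weight \<open>u s\<close> is a term of a geometric series scaled to total at
  most 1/(2n), and \<rho> solves (4 \<rho>)^(1/n) = u. The 4 again accounts for doubling the radius
  and passing to the diameter. The bound covers all finite subsets, since the relevant one is known
  only later.\<close>

lemma countable_summable_radii:
  fixes S :: "real set"
  assumes "countable S" "n \<ge> (1::nat)"
  obtains \<rho> where "\<And>s. \<rho> s > (0::real)" "\<And>s. 4 * \<rho> s \<le> 1 / real n"
    "\<And>A. finite A \<Longrightarrow> A \<subseteq> S \<Longrightarrow> (\<Sum>s\<in>A. (4 * \<rho> s) powr (1 / real n)) \<le> 1 / (2 * real n)"
proof -
  define u where "u = (\<lambda>s. (1/2) ^ Suc (to_nat_on S s) / (2 * real n))"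
  have u: "u s > 0" "u s \<le> 1 / real n" "u s \<le> 1" for s
  proof -
    show "u s > 0" using assms(2) by (simp add: u_def)
    have "u s \<le> 1 / (2 * real n)" unfolding u_def using assms(2) by (intro divide_right_mono power_le_one) auto
    also have "\<dots> \<le> 1 / real n" using assms(2) by (simp add: field_simps)
    finally show "u s \<le> 1 / real n" .
    then show "u s \<le> 1" using assms(2) by (smt (verit) divide_le_eq_1 of_nat_1 of_nat_mono)
  qed
  define \<rho> where "\<rho> = (\<lambda>s. u s ^ n / 4)"
  have pw: "(4 * \<rho> s) powr (1 / real n) = u s" for s
    using u(1)[of s] assms(2) by (simp add: \<rho>_def powr_realpow[symmetric] powr_powr)
  have "4 * \<rho> s \<le> 1 / real n" for s
  proof -
    have "u s ^ n \<le> u s ^ 1" using u[of s] assms(2) by (intro power_decreasing) auto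
    then show ?thesis using u(2)[of s] by (simp add: \<rho>_def)
  qed
  moreover have "(\<Sum>s\<in>A. (4 * \<rho> s) powr (1 / real n)) \<le> 1 / (2 * real n)" if A: "finite A" "A \<subseteq> S" for A
  proof -
    have inj: "inj_on (to_nat_on S) A" using inj_on_to_nat_on[OF assms(1)] A(2) by (rule inj_on_subset)
    have "(\<Sum>s\<in>A. (1/2 :: real) ^ Suc (to_nat_on S s)) = (\<Sum>i\<in>to_nat_on S ` A. (1/2) ^ Suc i)"
      using inj by (simp add: sum.reindex)
    also have "\<dots> \<le> (\<Sum>i. (1/2) ^ Suc i)"
      using A(1) power_half_series by (intro sum_le_suminf) (auto simp: sums_iff)
    also have "\<dots> = 1" using power_half_series by (simp add: sums_iff)
    finally have "(\<Sum>s\<in>A. (1/2 :: real) ^ Suc (to_nat_on S s)) / (2 * real n) \<le> 1 / (2 * real n)"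
      by (rule divide_right_mono) simp
    then show ?thesis unfolding pw by (simp add: u_def sum_divide_distrib)
  qed
  moreover have "\<rho> s > 0" for s using u(1)[of s] by (simp add: \<rho>_def)
  ultimately show thesis using that by blast
qed

section \<open>Flattening and concatenation of periodic sequences\<close>

lemma flatten_periodic:
  fixes y :: "int \<Rightarrow> real ^ 'k::{finite,linorder}"
  assumes "\<And>j. y (j + p) = y j"
  shows "flatten y (n + p * int CARD('k)) = flatten y n"
proof -
  have "(n + p * int CARD('k) - 1) = (n - 1) + p * int CARD('k)" by simp
  then show ?thesis unfolding flatten_def using assms[of "(n - 1) div int CARD('k)"] by (simp only: mod_mult_self1) (simp add: add.commute)
qed

lemma flatten_scaleR: "flatten (\<lambda>j. l *\<^sub>R y j) n = l * flatten y n"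
  by (simp add: flatten_def coord_def)

text \<open>Each of the m sequences is followed for N common periods p in turn. Letters keep their
  position j, so no block is shifted in phase and all letterwise distances to a reference sequence
  are inherited. The j - 1 reflects that periods start at position 1.\<close>

definition concat_blocks :: "(nat \<Rightarrow> int \<Rightarrow> 'a) \<Rightarrow> nat \<Rightarrow> nat \<Rightarrow> nat \<Rightarrow> int \<Rightarrow> 'a" where
  "concat_blocks ys m N p j = ys (nat ((((j - 1) div int p) mod (int m * int N)) div int N)) j"

lemma concat_blocks_periodic:
  assumes "\<And>i j. ys i (j + int p) = ys i j" "p \<ge> 1"
  shows "concat_blocks ys m N p (j + int p * (int m * int N)) = concat_blocks ys m N p j"
proof -
  have "(j + int p * (int m * int N) - 1) div int p = (j - 1) div int p + int m * int N"
    using assms(2) div_mult_self2[of "int p" "j - 1" "int m * int N"] by (simp add: algebra_simps)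
  then show ?thesis unfolding concat_blocks_def using periodic_mult[of "ys _" "int p" j "int m * int N"] assms(1)
    by simp
qed

text \<open>\<open>flatten\<close> puts the letter at position 1 on the sites k + 1, ..., 2 k for k
  = \<open>CARD('k)\<close>, whence the offset 1 + k; block i begins i * N common periods of k * p
  sites later.\<close>

lemma concat_blocks_block:
  fixes ys :: "nat \<Rightarrow> int \<Rightarrow> real ^ 'k::{finite,linorder}"
  assumes p: "p \<ge> 1" and i: "i < m" and j: "j < N * (CARD('k) * p)"
  defines "n \<equiv> 1 + int CARD('k) + int (CARD('k) * p) * int (i * N) + int j"
  shows "flatten (concat_blocks ys m N p) n = flatten (ys i) n"
proof -
  let ?k = "int CARD('k)"
  have N: "N > 0" using j by (cases N) auto
  define w where "w = int j div (?k * int p)"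
  have P0: "?k * int p > 0" using p by simp
  have w: "0 \<le> w" "w < int N"
  proof -
    show "0 \<le> w" using P0 by (simp add: w_def pos_imp_zdiv_nonneg_iff)
    have "j div (CARD('k) * p) < N" using j by (rule less_mult_imp_div_less)
    moreover have "w = int (j div (CARD('k) * p))" by (simp add: w_def zdiv_int)
    ultimately show "w < int N" by simp
  qed
  have "(n - 1) div ?k - 1 = (n - 1 - ?k) div ?k"
    using div_add1_eq[of "n - 1 - ?k" ?k ?k] by simp
  then have "((n - 1) div ?k - 1) div int p = (n - 1 - ?k) div (?k * int p)"
    using p by (simp add: zdiv_zmult2_eq)
  also have "n - 1 - ?k = int j + (int (i * N)) * (?k * int p)" by (simp add: n_def algebra_simps)
  also have "\<dots> div (?k * int p) = int (i * N) + w"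
    unfolding w_def using P0 p by (subst div_mult_self1) auto
  finally have e1: "((n - 1) div ?k - 1) div int p = int (i * N) + w" .
  have "int (i * N) + w < int m * int N"
  proof -
    have "int (i * N) + w < int (Suc i) * int N" using w by (simp add: algebra_simps)
    also have "\<dots> \<le> int m * int N" using i by (intro mult_right_mono) auto
    finally show ?thesis .
  qed
  then have "(int (i * N) + w) mod (int m * int N) = int (i * N) + w" using w by simp
  moreover have "(int (i * N) + w) div int N = int i" using w N by simp
  ultimately have "concat_blocks ys m N p ((n - 1) div ?k) = ys i ((n - 1) div ?k)"
    unfolding concat_blocks_def e1 by simp
  then show ?thesis by (simp add: flatten_def)
qed

section \<open>Periodic sequences with small spectrum\<close>

lemma flatten_bounded_diff:
  assumes "\<And>u :: real ^ 'k::{finite,linorder}. \<And>i. \<bar>u $ i\<bar> \<le> c * N u" "\<And>j. N (x j - y j) \<le> e" "c \<ge> 0"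
  shows "\<bar>flatten y n - flatten x n\<bar> \<le> c * e"
proof -
  let ?j = "(n - 1) div int CARD('k)"
  have "\<bar>flatten y n - flatten x n\<bar> = \<bar>coord (x ?j - y ?j) (nat ((n - 1) mod int CARD('k) + 1))\<bar>"
    by (simp add: flatten_def coord_def abs_minus_commute)
  also have "\<dots> \<le> c * N (x ?j - y ?j)" unfolding coord_def by (rule assms(1))
  also have "\<dots> \<le> c * e" using assms(2,3) by (intro mult_left_mono) auto
  finally show ?thesis .
qed

lemma Per_flatten:
  fixes y :: "int \<Rightarrow> real ^ 'k::{finite,linorder}"
  assumes "y \<in> Per Y"
  obtains q :: nat where "q \<ge> 1" "\<And>j. y (j + int q) = y j" "bounded (range (flatten y))"
proof -
  obtain q :: nat where q: "q \<ge> 1" "\<And>j. y (j + int q) = y j" using assms by (auto simp: Per_def)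
  have "bounded (range (flatten y))"
    using q by (intro bounded_range_periodic[of "int q * int CARD('k)"] flatten_periodic) auto
  with q that show thesis by blast
qed

text \<open>
  The periodic sequence \<open>z\<close> runs through finitely many periodic sequences close to \<open>x\<close>, repeating each
  of them \<open>M\<close> times, such that every energy outside small neighbourhoods of \<open>S\<close> lies in a spectral gap
  of one of them. There the block of that sequence has a transfer matrix growing exponentially with
  \<open>M\<close>, so the spectrum of \<open>z\<close> consists of exponentially short pieces, the number of which is linear
  in \<open>M\<close>.
\<close>

lemma periodic_small_spectrum:
  fixes x :: "int \<Rightarrow> real ^ 'k::{finite,linorder}" and N :: "real ^ 'k::{finite,linorder} \<Rightarrow> real"
  assumes x: "x \<in> Per Y" and C: "compact C" and S: "countable S" and n: "n \<ge> 1"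
    and c: "c > 0" "\<And>u i. \<bar>u $ i\<bar> \<le> c * N u" and N0: "N 0 = 0" and e: "e > 0"
    and gap: "\<And>l E. l \<in> C \<Longrightarrow> E \<notin> S \<Longrightarrow>
      \<exists>y\<in>Per Y. (\<forall>j. N (x j - y j) \<le> e) \<and> E \<notin> sspec (\<lambda>n. l * flatten y n)"
  shows "\<exists>z\<in>Per Y. (\<forall>j. N (x j - z j) \<le> e) \<and>
    (\<exists>d>0. \<forall>l\<in>C. \<forall>W. (\<forall>n. \<bar>W n - l * flatten z n\<bar> \<le> d) \<longrightarrow> small_cover n (sspec W))"
proof -
  obtain X where X: "X > 0" "\<And>n. \<bar>flatten x n\<bar> \<le> X"
    using Per_flatten[OF x] bounded_range_real by metis
  obtain La where La: "La > 0" "\<And>l. l \<in> C \<Longrightarrow> \<bar>l\<bar> \<le> La"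
    using compact_imp_bounded[OF C] unfolding bounded_pos by auto
  define V0 where "V0 = X + c * e"
  have V0: "V0 > 0" using X c e by (simp add: V0_def add_pos_pos)
  have near_bound: "\<bar>flatten y n\<bar> \<le> V0" if "\<And>j. N (x j - y j) \<le> e" for y n
    using flatten_bounded_diff[of c N x y e n] c that X(2)[of n] by (simp add: V0_def)
  have lV0: "\<bar>l * flatten y n\<bar> \<le> La * V0" if "l \<in> C" "\<And>j. N (x j - y j) \<le> e" for l y n
    using La(2)[OF that(1)] near_bound[OF that(2)] La(1) by (simp add: abs_mult mult_mono)
  define R where "R = La * V0 + 3"
  \<comment> \<open>R exceeds La * V0 + 2, which bounds the spectrum for every coupling in C and
    every sequence within e of x, so no relevant pair lies outside.\<close>
  define K where "K = C \<times> {- R..R}"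
  have K: "compact K" unfolding K_def using C by (intro compact_Times) auto
  obtain \<rho> where \<rho>: "\<And>s. \<rho> s > (0::real)" "\<And>s. 4 * \<rho> s \<le> 1 / real n"
    "\<And>A. finite A \<Longrightarrow> A \<subseteq> S \<Longrightarrow> (\<Sum>s\<in>A. (4 * \<rho> s) powr (1 / real n)) \<le> 1 / (2 * real n)"
    using countable_summable_radii[OF S n] by blast
  have "\<exists>y h. y \<in> Per Y \<and> (\<forall>j. N (x j - y j) \<le> e) \<and> h > 0 \<and>
      (\<forall>l'\<in>cball (fst \<kappa>) h. \<forall>E'\<in>cball (snd \<kappa>) h. E' \<notin> sspec (\<lambda>n. l' * flatten y n))"
    if \<kappa>: "\<kappa> \<in> K" "snd \<kappa> \<notin> S" for \<kappa>
  proof -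
    have "fst \<kappa> \<in> C" using \<kappa>(1) by (auto simp: K_def)
    then obtain y where y: "y \<in> Per Y" "\<forall>j. N (x j - y j) \<le> e" "snd \<kappa> \<notin> sspec (\<lambda>n. fst \<kappa> * flatten y n)"
      using gap \<kappa>(2) by blast
    have "bounded (range (flatten y))" using Per_flatten[OF y(1)] by blast
    then show ?thesis using gap_neighbourhood[OF _ y(3)] y(1,2) by blast
  qed
  then obtain yf hf where yh: "\<And>\<kappa>. \<kappa> \<in> K \<Longrightarrow> snd \<kappa> \<notin> S \<Longrightarrow> yf \<kappa> \<in> Per Y \<and> (\<forall>j. N (x j - yf \<kappa> j) \<le> e) \<and> hf \<kappa> > 0 \<and>
      (\<forall>l'\<in>cball (fst \<kappa>) (hf \<kappa>). \<forall>E'\<in>cball (snd \<kappa>) (hf \<kappa>). E' \<notin> sspec (\<lambda>n. l' * flatten (yf \<kappa>) n))"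
    by metis
  \<comment> \<open>Energies in S get a strip over all couplings, whose width depends on the energy
    alone and is controlled by the summable radii. All other pairs get a box free of
    spectrum.\<close>
  define O' where "O' = (\<lambda>\<kappa>. if snd \<kappa> \<in> S then UNIV \<times> ball (snd \<kappa>) (\<rho> (snd \<kappa>))
      else ball (fst \<kappa>) (hf \<kappa>) \<times> ball (snd \<kappa>) (hf \<kappa>))"
  have "open (O' \<kappa>)" for \<kappa> by (simp add: O'_def open_Times)
  moreover have "\<kappa> \<in> O' \<kappa>" if "\<kappa> \<in> K" for \<kappa>
    using that yh[OF that] \<rho>(1)[of "snd \<kappa>"] by (simp add: O'_def mem_Times_iff)
  then have "K \<subseteq> (\<Union>\<kappa>\<in>K. O' \<kappa>)" by blast
  ultimately obtain T where T: "T \<subseteq> K" "finite T" "K \<subseteq> (\<Union>\<kappa>\<in>T. O' \<kappa>)"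
    using compactE_image[OF K, of K O'] by metis
  define TS where "TS = snd ` {\<kappa>\<in>T. snd \<kappa> \<in> S}"
  have TS: "finite TS" "TS \<subseteq> S" using T(2) by (auto simp: TS_def)
  obtain ts where ts: "set ts = {\<kappa>\<in>T. snd \<kappa> \<notin> S}" using finite_list[of "{\<kappa>\<in>T. snd \<kappa> \<notin> S}"] T(2) by auto
  define r where "r = length ts"
  \<comment> \<open>The extra block, filled with x itself, keeps the number of blocks positive even
    when no gap boxes occur in the subcover.\<close>
  define m where "m = Suc r"
  have tsK: "ts ! i \<in> K" "snd (ts ! i) \<notin> S" if "i < r" for i
    using nth_mem[of i ts] that ts T(1) by (auto simp: r_def)
  define ys where "ys = (\<lambda>i. if i < r then yf (ts ! i) else x)"
  have ysPer: "ys i \<in> Per Y" for i using yh[OF tsK] x by (simp add: ys_def)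
  have ysnear: "N (x j - ys i j) \<le> e" for i j using yh[OF tsK] N0 e by (simp add: ys_def)
  obtain qf :: "nat \<Rightarrow> nat" where qf: "\<And>i. qf i \<ge> 1" "\<And>i j. ys i (j + int (qf i)) = ys i j"
  proof -
    have "\<exists>q::nat. q \<ge> 1 \<and> (\<forall>j. ys i (j + int q) = ys i j)" for i using Per_flatten[OF ysPer[of i]] by metis
    then show thesis using that by metis
  qed
  define p where "p = (\<Prod>i\<le>r. qf i)"
  have "p > 0" unfolding p_def by (rule prod_pos) (use qf(1) in \<open>auto simp: Suc_le_eq\<close>)
  then have p: "p \<ge> 1" by simp
  have ysp: "ys i (j + int p) = ys i j" for i j
  proof -
    have *: "ys i (j + int p) = ys i j" if "i \<le> r" for i j
    proof -
      have "qf i dvd p" unfolding p_def using that by (intro dvd_prodI) auto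
      then obtain u where "p = qf i * u" by (elim dvdE)
      then show ?thesis using periodic_mult[of "ys i" "int (qf i)" j "int u"] qf(2) by simp
    qed
    show ?thesis
    proof (cases "i \<le> r")
      case False
      then have "ys i = ys r" by (simp add: ys_def)
      then show ?thesis using *[of r] by simp
    qed (rule *)
  qed
  define P where "P = CARD('k) * p"
  have P: "P \<ge> 1" using p by (simp add: P_def Suc_le_eq)
  have fysP: "flatten (ys i) (n + int P) = flatten (ys i) n" for i n
    using flatten_periodic[of "ys i" "int p" n] ysp by (simp add: P_def mult.commute)
  define m0 where "m0 = 1 + int CARD('k)"
  define box where "box = (\<lambda>i. cball (fst (ts ! i)) (hf (ts ! i)) \<times> cball (snd (ts ! i)) (hf (ts ! i)))"
  have thex: "\<exists>th>1. \<forall>(l, E)\<in>box i. \<bar>trace (transfer (\<lambda>n. l * flatten (ys i) n) E m0 P)\<bar> \<ge> 1 + th" if i: "i < r" for i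
  proof (rule uniform_trace_gap[of P "flatten (ys i)", OF P fysP])
    show "compact (box i)" unfolding box_def by (intro compact_Times compact_cball)
    fix l E assume "(l, E) \<in> box i"
    then show "E \<notin> sspec (\<lambda>n. l * flatten (ys i) n)" using yh[OF tsK[OF i]] i by (simp add: box_def ys_def)
  qed
  define good where "good = (\<lambda>i th. th > 1 \<and> (\<forall>(l, E)\<in>box i. \<bar>trace (transfer (\<lambda>n. l * flatten (ys i) n) E m0 P)\<bar> \<ge> 1 + th))"
  define thf where "thf = (\<lambda>i. SOME th. good i th)"
  have "good i (thf i)" if "i < r" for i
  proof -
    have "\<exists>th. good i th" unfolding good_def using thex[OF that] .
    then show ?thesis unfolding thf_def by (rule someI_ex)
  qed
  then have thf: "\<And>i. i < r \<Longrightarrow> thf i > 1"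
    "\<And>i l E. i < r \<Longrightarrow> (l, E) \<in> box i \<Longrightarrow> \<bar>trace (transfer (\<lambda>n. l * flatten (ys i) n) E m0 P)\<bar> \<ge> 1 + thf i"
    unfolding good_def by blast+
  \<comment> \<open>The 2 keeps \<open>Min\<close> away from the empty set. The rate is fixed here,
    before the number M of repetitions.\<close>
  define th where "th = Min (insert 2 (thf ` {..<r}))"
  have th: "th > 1" unfolding th_def using thf(1) by (subst Min_gr_iff) auto
  have th_le: "th \<le> thf i" if "i < r" for i unfolding th_def using that by (intro Min_le) auto
  have n2: "1 / (2 * real n) > 0" using n by simp
  obtain M where M: "M \<ge> 1" "80 / th ^ M \<le> 1 / (2 * real n)"
    "(real (4 * r * m * P) * real M + real r) * (80 / th ^ M) powr (1 / real n) \<le> 1 / (2 * real n)"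
    using exponential_beats_linear[OF th n n2] by blast
  define z where "z = concat_blocks ys m M p"
  have z_ys: "\<exists>i. z j = ys i j" for j by (auto simp: z_def concat_blocks_def)
  have znear: "N (x j - z j) \<le> e" for j using z_ys[of j] ysnear by metis
  have zper: "z (j + int (p * (m * M))) = z j" for j
    unfolding z_def using concat_blocks_periodic[of ys p, OF ysp p] by simp
  have "z \<in> Per Y" unfolding Per_def
  proof (intro CollectI conjI exI allI)
    show "range z \<subseteq> Y" using z_ys ysPer unfolding Per_def by (metis (no_types, lifting) image_subset_iff mem_Collect_eq rangeI)
    show "p * (m * M) \<ge> 1" using p M(1) by (simp add: m_def Suc_le_eq)
  qed (rule zper)
  define Q where "Q = m * M * P"
  have Q: "Q \<ge> 1" using P M(1) by (simp add: Q_def m_def Suc_le_eq)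
  have fzQ: "flatten z (n + int Q) = flatten z n" for n
    using flatten_periodic[of z "int (p * (m * M))" n] zper by (simp add: Q_def P_def mult_ac)
  define t where "t = th ^ M"
  have t: "t > 0" using th by (simp add: t_def)
  define d where "d = 20 / t"
  have d: "d > 0" "4 * d = 80 / th ^ M" using t by (simp_all add: d_def t_def)
  \<comment> \<open>A perturbation of this size moves the spectrum by at most the radius of any
    interval used, so doubling the radii in \<open>F1\<close> and \<open>F2\<close> compensates for
    it; the 1 serves the explicit bound on W.\<close>
  define del where "del = Min (insert 1 (insert d (\<rho> ` TS)))"
  have del: "del > 0" "del \<le> 1" "del \<le> d" "\<And>s. s \<in> TS \<Longrightarrow> del \<le> \<rho> s"
  proof -
    have fin: "finite (insert 1 (insert d (\<rho> ` TS)))" using TS(1) by simp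
    show "del > 0" unfolding del_def using fin d(1) \<rho>(1) by (subst Min_gr_iff) auto
    show "del \<le> 1" "del \<le> d" "\<And>s. s \<in> TS \<Longrightarrow> del \<le> \<rho> s"
      unfolding del_def by (rule Min_le[OF fin], simp)+
  qed
  have main: "small_cover n (sspec W)" if l: "l \<in> C" and W: "\<And>n. \<bar>W n - l * flatten z n\<bar> \<le> del" for l W
  proof -
    define V where "V = (\<lambda>n. l * flatten z n)"
    have VB: "\<bar>V n\<bar> \<le> La * V0" for n unfolding V_def by (rule lV0[OF l znear])
    have bV: "bounded (range V)" using VB by (auto simp: bounded_iff)
    have "\<bar>W n\<bar> \<le> La * V0 + 1" for n using VB[of n] W[of n] del(2) unfolding V_def by linarith
    then have bW: "bounded (range W)" by (auto simp: bounded_iff)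
    have Vper: "V (n + int Q) = V n" for n by (simp add: V_def fzQ)
    define U where "U = (\<lambda>i. {E. (l, E) \<in> box i})"
    have Uint: "is_interval (U i)" for i
    proof (cases "l \<in> cball (fst (ts ! i)) (hf (ts ! i))")
      case True
      then have "U i = cball (snd (ts ! i)) (hf (ts ! i))" by (auto simp: U_def box_def)
      then show ?thesis by (simp add: is_interval_cball_1)
    next
      case False
      then have "U i = {}" by (auto simp: U_def box_def)
      then show ?thesis by (simp add: is_interval_empty)
    qed
    have "\<exists>n L. \<bar>trace (transfer V E n L)\<bar> \<ge> t" if i: "i < r" and E: "E \<in> U i" for i E
    proof -
      let ?v = "\<lambda>n. l * flatten (ys i) n"
      have "thf i ^ M \<le> \<bar>trace (transfer ?v E m0 (M * P))\<bar>"
        using thf[of i] E i fysP by (intro trace_power_lower_bound) (auto simp: U_def less_imp_le)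
      moreover have "t \<le> thf i ^ M" unfolding t_def using th th_le[OF i] by (intro power_mono) auto
      moreover have "transfer V E (m0 + int P * int (i * M)) (M * P) = transfer ?v E (m0 + int P * int (i * M)) (M * P)"
      proof (rule transfer_cong)
        fix j assume "j < M * P"
        then have "flatten z (m0 + int P * int (i * M) + int j) = flatten (ys i) (m0 + int P * int (i * M) + int j)"
          unfolding z_def m0_def P_def using p i by (intro concat_blocks_block) (auto simp: m_def)
        then show "V (m0 + int P * int (i * M) + int j) = ?v (m0 + int P * int (i * M) + int j)" by (simp add: V_def)
      qed
      moreover have "\<dots> = transfer ?v E m0 (M * P)" by (rule transfer_periodic) (simp add: fysP)
      ultimately have "\<bar>trace (transfer V E (m0 + int P * int (i * M)) (M * P))\<bar> \<ge> t" by simp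
      then show ?thesis by blast
    qed
    then have "\<exists>F. finite F \<and> card F \<le> 4 * Q + 1 \<and> U i \<inter> sspec V \<subseteq> (\<Union>c\<in>F. cball c (20 / t))" if "i < r" for i
      using that by (intro periodic_sspec_cover[of Q V, OF Q Vper t Uint]) auto
    then obtain Ff where Ff: "\<And>i. i < r \<Longrightarrow> finite (Ff i)" "\<And>i. i < r \<Longrightarrow> card (Ff i) \<le> 4 * Q + 1"
      "\<And>i. i < r \<Longrightarrow> U i \<inter> sspec V \<subseteq> (\<Union>c\<in>Ff i. cball c d)" unfolding d_def by metis
    define G where "G = (\<Union>i<r. Ff i)"
    have G: "finite G" using Ff(1) by (auto simp: G_def)
    have cardG: "card G \<le> r * (4 * Q + 1)"
    proof -
      have "card G \<le> (\<Sum>i<r. card (Ff i))" unfolding G_def by (rule card_UN_le) simp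
      also have "\<dots> \<le> (\<Sum>i<r. 4 * Q + 1)" using Ff(2) by (intro sum_mono) auto
      finally show ?thesis by simp
    qed
    define F1 where "F1 = (\<lambda>s. (s, 2 * \<rho> s)) ` TS"
    define F2 where "F2 = (\<lambda>c. (c, 2 * d)) ` G"
    show ?thesis unfolding small_cover_def
    proof (intro exI conjI)
      show "finite (F1 \<union> F2)" using TS G by (simp add: F1_def F2_def)
      have "4 * d \<le> 1 / (2 * real n)" using M(2) d(2) by simp
      also have "\<dots> \<le> 1 / real n" using n by (simp add: field_simps)
      finally have "4 * d \<le> 1 / real n" .
      then show "\<forall>f\<in>F1 \<union> F2. 0 < snd f \<and> 2 * snd f \<le> 1 / real n"
        using \<rho>(1,2) d(1) by (auto simp: F1_def F2_def)
      show "sspec W \<subseteq> (\<Union>f\<in>F1 \<union> F2. cball (fst f) (snd f))"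
      proof
        fix E assume E: "E \<in> sspec W"
        have "\<And>n. \<bar>W n - V n\<bar> \<le> del" unfolding V_def by (rule W)
        then obtain E' where E': "E' \<in> sspec V" "\<bar>E' - E\<bar> \<le> del" using sspec_perturb[OF bW bV _ E] by blast
        have "\<bar>E'\<bar> \<le> La * V0 + 2" using sspec_bounded[OF VB E'(1)] .
        then have "(l, E') \<in> K" using l by (auto simp: K_def R_def)
        then obtain \<kappa> where \<kappa>: "\<kappa> \<in> T" "(l, E') \<in> O' \<kappa>" using T(3) by blast
        show "E \<in> (\<Union>f\<in>F1 \<union> F2. cball (fst f) (snd f))"
        proof (cases "snd \<kappa> \<in> S")
          case True
          then have s: "snd \<kappa> \<in> TS" "dist (snd \<kappa>) E' < \<rho> (snd \<kappa>)" using \<kappa> by (auto simp: TS_def O'_def)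
          have "dist (snd \<kappa>) E \<le> 2 * \<rho> (snd \<kappa>)" using s(2) E'(2) del(4)[OF s(1)] by (simp add: dist_real_def)
          moreover have "(snd \<kappa>, 2 * \<rho> (snd \<kappa>)) \<in> F1" using s(1) by (simp add: F1_def)
          ultimately show ?thesis by (intro UN_I[of "(snd \<kappa>, 2 * \<rho> (snd \<kappa>))"]) auto
        next
          case False
          then have "\<kappa> \<in> set ts" using ts \<kappa>(1) by simp
          then obtain i where i: "i < r" "ts ! i = \<kappa>" by (auto simp: in_set_conv_nth r_def)
          have "E' \<in> U i" using \<kappa>(2) False by (auto simp: U_def box_def i(2) O'_def)
          then obtain c where c: "c \<in> Ff i" "dist c E' \<le> d" using Ff(3)[OF i(1)] E'(1) by auto
          have "dist c E \<le> 2 * d" using c(2) E'(2) del(3) by (simp add: dist_real_def)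
          moreover have "(c, 2 * d) \<in> F2" using c(1) i(1) by (auto simp: F2_def G_def)
          ultimately show ?thesis by (intro UN_I[of "(c, 2 * d)"]) auto
        qed
      qed
      have "(\<Sum>f\<in>F1 \<union> F2. (2 * snd f) powr (1 / real n)) \<le> (\<Sum>f\<in>F1. (2 * snd f) powr (1 / real n)) + (\<Sum>f\<in>F2. (2 * snd f) powr (1 / real n))"
        using TS G sum.union_inter[of F1 F2 "\<lambda>f. (2 * snd f) powr (1 / real n)"]
          sum_nonneg[of "F1 \<inter> F2" "\<lambda>f. (2 * snd f) powr (1 / real n)"] by (simp add: F1_def F2_def)
      also have "(\<Sum>f\<in>F1. (2 * snd f) powr (1 / real n)) = (\<Sum>s\<in>TS. (4 * \<rho> s) powr (1 / real n))"
        unfolding F1_def by (subst sum.reindex) (auto simp: inj_on_def)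
      also have "\<dots> \<le> 1 / (2 * real n)" using \<rho>(3) TS by blast
      also have "(\<Sum>f\<in>F2. (2 * snd f) powr (1 / real n)) = real (card G) * (4 * d) powr (1 / real n)"
        unfolding F2_def by (subst sum.reindex) (auto simp: inj_on_def)
      \<comment> \<open>Each of the r boxes contributes at most 4 Q + 1 centres, and the period Q =
        m M P is linear in M; this is the count for which M was chosen.\<close>
      also have "\<dots> \<le> (real (4 * r * m * P) * real M + real r) * (4 * d) powr (1 / real n)"
      proof (rule mult_right_mono)
        have "real (card G) \<le> real (r * (4 * Q + 1))" using cardG by (rule of_nat_mono)
        then show "real (card G) \<le> real (4 * r * m * P) * real M + real r" by (simp add: Q_def algebra_simps)
      qed simp
      also have "\<dots> \<le> 1 / (2 * real n)" using M(3) d(2) by simp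
      finally show "(\<Sum>f\<in>F1 \<union> F2. (2 * snd f) powr (1 / real n)) \<le> 1 / real n" by simp
    qed
  qed
  show ?thesis
  proof (intro bexI[of _ z] conjI exI[of _ del] ballI allI impI)
    fix l W assume "l \<in> C" "\<forall>n. \<bar>W n - l * flatten z n\<bar> \<le> del"
    then show "small_cover n (sspec W)" using main by blast
  qed (use znear del \<open>z \<in> Per Y\<close> in auto)
qed

section \<open>Generic limit-periodic sequences\<close>

lemma discrete_imp_countable:
  fixes S :: "'a::second_countable_topology set"
  assumes "discrete S"
  shows "countable S"
proof -
  obtain B :: "'a set set" where B: "countable B" "topological_basis B"
    using ex_countable_basis by blast
  have "\<exists>b\<in>B. b \<inter> S = {s}" if s: "s \<in> S" for s
  proof -
    obtain T where T: "open T" "T \<inter> S = {s}"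
      using assms s unfolding discrete_def isolated_in_def by blast
    then have "s \<in> T" by blast
    then obtain b where "b \<in> B" "s \<in> b" "b \<subseteq> T" using topological_basisE[OF B(2) T(1)] by metis
    then show ?thesis using T(2) s by blast
  qed
  then obtain f where f: "\<And>s. s \<in> S \<Longrightarrow> f s \<in> B \<and> f s \<inter> S = {s}" by metis
  have "inj_on f S"
  proof (rule inj_onI)
    fix s t assume "s \<in> S" "t \<in> S" "f s = f t"
    then have "{s} = {t}" using f[of s] f[of t] by metis
    then show "s = t" by simp
  qed
  moreover have "f ` S \<subseteq> B" using f by blast
  then have "countable (f ` S)" using B(1) by (rule countable_subset)
  ultimately show ?thesis using countable_image_inj_on by blast
qed

text \<open>Expansion in the standard basis gives the upper bound and thereby continuity of
  \<open>N\<close>; the lower bound is its minimum on the unit sphere.\<close>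

lemma is_norm_bounds:
  fixes N :: "real ^ 'k \<Rightarrow> real"
  assumes N: "is_norm N"
  obtains c C where "c > 0" "C > 0" "\<And>u. norm u \<le> c * N u" "\<And>u. N u \<le> C * norm u"
proof -
  have N0: "N u \<ge> 0" "N u = 0 \<longleftrightarrow> u = 0" "N (a *\<^sub>R u) = \<bar>a\<bar> * N u" "N (u + v) \<le> N u + N v" for u v a
    using N by (auto simp: is_norm_def)
  define C where "C = (\<Sum>i\<in>UNIV. N (axis i 1)) + 1"
  have C: "C > 0" unfolding C_def using N0(1) by (simp add: add_nonneg_pos sum_nonneg)
  have sum_le: "N (\<Sum>i\<in>I. f i) \<le> (\<Sum>i\<in>I. N (f i))" if "finite I" for I :: "'k set" and f
    using that
  proof (induction I rule: finite_induct)
    case empty show ?case using N0(2)[of 0] by simp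
  next
    case (insert i I) then show ?case using N0(4)[of "f i" "\<Sum>i\<in>I. f i"] by simp
  qed
  have up: "N u \<le> C * norm u" for u
  proof -
    have "u = (\<Sum>i\<in>UNIV. u $ i *\<^sub>R axis i 1)" using basis_expansion[of u] by (simp add: scalar_mult_eq_scaleR)
    then have "N u \<le> (\<Sum>i\<in>UNIV. N (u $ i *\<^sub>R axis i 1))" using sum_le[of UNIV "\<lambda>i. u $ i *\<^sub>R axis i 1"] by simp
    also have "\<dots> = (\<Sum>i\<in>UNIV. \<bar>u $ i\<bar> * N (axis i 1))" by (simp add: N0(3))
    also have "\<dots> \<le> (\<Sum>i\<in>UNIV. norm u * N (axis i 1))"
      using component_le_norm_cart N0(1) by (intro sum_mono mult_right_mono) auto
    also have "\<dots> \<le> C * norm u" by (simp add: C_def sum_distrib_left[symmetric] algebra_simps)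
    finally show ?thesis .
  qed
  have "continuous_on UNIV N"
  proof (rule continuous_on_iff[THEN iffD2], intro ballI allI impI)
    fix u :: "real ^ 'k" and e :: real assume e: "e > 0"
    show "\<exists>d>0. \<forall>v\<in>UNIV. dist v u < d \<longrightarrow> dist (N v) (N u) < e"
    proof (intro exI conjI ballI impI)
      show "e / C > 0" using e C by simp
      fix v assume v: "dist v u < e / C"
      have "N v \<le> N u + N (v - u)" using N0(4)[of u "v - u"] by simp
      moreover have "N u \<le> N v + N (v - u)" using N0(4)[of v "u - v"] N0(3)[of "-1" "v - u"] by simp
      moreover have "N (v - u) < e" using up[of "v - u"] v C by (simp add: dist_norm field_simps)
      ultimately show "dist (N v) (N u) < e" by (simp add: dist_real_def abs_less_iff)
    qed
  qed
  then have "continuous_on (sphere 0 1) N" by (rule continuous_on_subset) simp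
  moreover have "sphere (0 :: real ^ 'k) 1 \<noteq> {}" by simp
  ultimately obtain w where w: "w \<in> sphere 0 1" "\<And>v. v \<in> sphere 0 1 \<Longrightarrow> N w \<le> N v"
    using continuous_attains_inf[of "sphere (0 :: real ^ 'k) 1" N] by auto
  have Nw: "N w > 0" using N0(1)[of w] N0(2)[of w] w(1) by fastforce
  have "norm u \<le> (1 / N w) * N u" for u
  proof (cases "u = 0")
    case False
    have "N w \<le> N ((1 / norm u) *\<^sub>R u)" using False by (intro w(2)) simp
    also have "\<dots> = N u / norm u" by (simp add: N0(3))
    finally show ?thesis using False Nw by (simp add: field_simps)
  qed (use N0 in simp)
  then show thesis using that[of "1 / N w" C] Nw C up by simp
qed

lemma mcomplete_norm_metric:
  fixes Y :: "(real ^ 'k) set"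
  assumes N: "is_norm N" and Y: "closed Y"
  shows "Metric_space.mcomplete Y (\<lambda>u v. N (u - v))"
proof -
  interpret M: Metric_space Y "\<lambda>u v. N (u - v)" by (rule Metric_space_norm[OF N])
  obtain c C where c: "c > 0" "C > 0" "\<And>u. norm u \<le> c * N u" "\<And>u. N u \<le> C * norm u"
    using is_norm_bounds[OF N] by blast
  show ?thesis unfolding M.mcomplete_def
  proof (intro allI impI)
    fix \<sigma> assume \<sigma>: "M.MCauchy \<sigma>"
    then have \<sigma>Y: "\<And>n. \<sigma> n \<in> Y" unfolding M.MCauchy_def by blast
    have "Cauchy \<sigma>"
    proof (rule metric_CauchyI)
      fix e :: real assume "e > 0"
      then have "e / c > 0" using c by simp
      then obtain n0 where n0: "\<And>m n. m \<ge> n0 \<Longrightarrow> n \<ge> n0 \<Longrightarrow> N (\<sigma> m - \<sigma> n) < e / c"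
        using \<sigma> unfolding M.MCauchy_def by metis
      have "dist (\<sigma> m) (\<sigma> n) < e" if "m \<ge> n0" "n \<ge> n0" for m n
        using c(3)[of "\<sigma> m - \<sigma> n"] n0[OF that] c(1) by (simp add: dist_norm field_simps)
      then show "\<exists>M. \<forall>m\<ge>M. \<forall>n\<ge>M. dist (\<sigma> m) (\<sigma> n) < e" by blast
    qed
    then obtain l where l: "\<sigma> \<longlonglongrightarrow> l" using Cauchy_convergent_iff convergent_def by blast
    have "l \<in> Y" using closed_sequentially[OF Y] \<sigma>Y l by blast
    moreover have "\<exists>n0. \<forall>n\<ge>n0. \<sigma> n \<in> Y \<and> N (\<sigma> n - l) < e" if e: "e > 0" for e
    proof -
      have "e / C > 0" using e c by simp
      then obtain n0 where n0: "\<And>n. n \<ge> n0 \<Longrightarrow> dist (\<sigma> n) l < e / C" using metric_LIMSEQ_D[OF l] by blast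
      have "N (\<sigma> n - l) < e" if "n \<ge> n0" for n
        using c(4)[of "\<sigma> n - l"] n0[OF that] c(2) by (simp add: dist_norm field_simps)
      then show ?thesis using \<sigma>Y by blast
    qed
    ultimately show "\<exists>x. limitin M.mtopology \<sigma> x sequentially"
      unfolding M.limit_metric_sequentially by blast
  qed
qed

lemma topspace_LP_topology: "topspace (LP_topology N Y) = LP N Y"
  using closure_of_subset_topspace[of "mtopology_of (seq_metric N Y)" "Per Y"]
  by (auto simp: LP_topology_def LP_def)

lemma completely_metrizable_LP:
  fixes Y :: "(real ^ 'k) set"
  assumes N: "is_norm N" and Y: "closed Y"
  shows "completely_metrizable_space (LP_topology N Y)"
proof -
  interpret M: Metric_space Y "\<lambda>u v. N (u - v)" by (rule Metric_space_norm[OF N])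
  have "mcomplete_of (seq_metric N Y)"
    using M.mcomplete_funspace[OF mcomplete_norm_metric[OF N Y]]
    by (simp add: seq_metric_def norm_metric_def M.Self_def)
  then have "completely_metrizable_space (mtopology_of (seq_metric N Y))"
    unfolding mcomplete_of_def mtopology_of_def
    by (rule Metric_space.completely_metrizable_space_mtopology[OF Metric_space_mspace_mdist])
  then show ?thesis unfolding LP_topology_def
    by (rule completely_metrizable_space_closedin) (simp add: LP_def)
qed

lemma seq_metric_dist_le:
  assumes "is_norm N" "y \<in> mspace (seq_metric N Y)" "z \<in> mspace (seq_metric N Y)"
  shows "mdist (seq_metric N Y) y z \<le> a \<longleftrightarrow> (\<forall>j. N (y j - z j) \<le> a)"
  using funspace_mdist_le[of y UNIV "norm_metric N Y" z a] assms
  by (simp add: seq_metric_def mdist_norm_metric)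

lemma periodize_Per:
  assumes "x \<in> words Y"
  shows "periodize x \<in> Per Y" "periodize x (j + int (length x)) = periodize x j"
proof -
  have len: "length x > 0" and sub: "set x \<subseteq> Y" using assms by (auto simp: words_def)
  have per: "periodize x (j + int (length x)) = periodize x j" for j
  proof -
    have "(j + int (length x) - 1) mod int (length x) = (j - 1) mod int (length x)"
      using mod_add_self2[of "j - 1" "int (length x)"] by (simp add: algebra_simps)
    then show ?thesis by (simp add: periodize_def)
  qed
  then show "periodize x (j + int (length x)) = periodize x j" .
  have "periodize x j \<in> Y" for j
  proof -
    have "nat ((j - 1) mod int (length x)) < length x" using len by (simp add: nat_less_iff)
    then show ?thesis using sub nth_mem by (force simp: periodize_def)
  qed
  then show "periodize x \<in> Per Y" unfolding Per_def using per len
    by (intro CollectI conjI exI[of _ "length x"]) (auto simp: Suc_le_eq)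
qed

lemma Per_imp_periodize:
  assumes "x \<in> Per Y"
  obtains w where "w \<in> words Y" "periodize w = x"
proof -
  obtain q :: nat where q: "q \<ge> 1" "\<And>j. x (j + int q) = x j" and sub: "range x \<subseteq> Y"
    using assms by (auto simp: Per_def)
  define w where "w = map (\<lambda>i. x (int i + 1)) [0..<q]"
  have "periodize w = x"
  proof
    fix j
    have lt: "nat ((j - 1) mod int q) < q" using q(1) by (simp add: nat_less_iff)
    then have "periodize w j = x ((j - 1) mod int q + 1)" using q(1) by (simp add: periodize_def w_def)
    also have "\<dots> = x ((j - 1) mod int q + 1 + int q * ((j - 1) div int q))"
      by (rule periodic_mult[of x "int q", symmetric]) (rule q(2))
    also have "(j - 1) mod int q + 1 + int q * ((j - 1) div int q) = j"
      using mult_div_mod_eq[of "int q" "j - 1"] by linarith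
    finally show "periodize w j = x j" .
  qed
  moreover have "w \<in> words Y" using q(1) sub by (auto simp: words_def w_def)
  ultimately show thesis using that by blast
qed

text \<open>Scaling by l carries the problem to words over the scaled set and back. Distances scale
  by \<bar>l\<bar>, hence the tolerance \<open>\<bar>l\<bar> * e\<close>; dividing by l keeps the
  approximant in \<open>Per Y\<close>, independently of which coupling is considered.\<close>

lemma gap_rich_periodic:
  fixes Y :: "(real ^ 'k::{finite,linorder}) set"
  assumes N: "is_norm N" and l: "l \<noteq> 0" and rich: "gap_rich N ((*\<^sub>R) l ` Y) S"
    and E: "E \<notin> S" and x: "x \<in> Per Y" and e: "e > 0"
  shows "\<exists>y\<in>Per Y. (\<forall>j. N (x j - y j) \<le> e) \<and> E \<notin> sspec (\<lambda>n. l * flatten y n)"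
proof -
  let ?lY = "(*\<^sub>R) l ` Y"
  have Ns: "N (a *\<^sub>R u) = \<bar>a\<bar> * N u" for a u using N by (simp add: is_norm_def)
  have "(\<lambda>j. l *\<^sub>R x j) \<in> Per ?lY" using x by (auto simp: Per_def)
  then obtain w where w: "w \<in> words ?lY" "periodize w = (\<lambda>j. l *\<^sub>R x j)" by (rule Per_imp_periodize)
  have "\<bar>l\<bar> * e > 0" using l e by simp
  then obtain v where v: "v \<in> words ?lY" "word_dist N ?lY w v < \<bar>l\<bar> * e"
    "complex_of_real E \<notin> spectrum_l2 (H (periodize v))"
    using rich E w(1) unfolding gap_rich_def by blast
  define y where "y = (\<lambda>j. (1 / l) *\<^sub>R periodize v j)"
  have vy: "periodize v = (\<lambda>j. l *\<^sub>R y j)" using l by (simp add: y_def)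
  have "y \<in> Per Y" unfolding Per_def
  proof (intro CollectI conjI exI allI)
    have "range (periodize v) \<subseteq> ?lY" using periodize_Per(1)[OF v(1)] by (simp add: Per_def)
    then show "range y \<subseteq> Y"
    proof clarify
      fix j
      have "periodize v j \<in> ?lY" using \<open>range (periodize v) \<subseteq> ?lY\<close> by blast
      then show "y j \<in> Y" using l by (auto simp: y_def)
    qed
    show "length v \<ge> 1" using v(1) by (auto simp: words_def Suc_le_eq)
    show "y (j + int (length v)) = y j" for j by (simp add: y_def periodize_Per(2)[OF v(1)])
  qed
  moreover have "N (x j - y j) \<le> e" for j
  proof -
    have "\<forall>j. N (periodize w j - periodize v j) \<le> word_dist N ?lY w v"
      unfolding word_dist_def using Per_subset_mspace[OF N] periodize_Per(1) w(1) v(1)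
      by (intro seq_metric_dist_le[THEN iffD1] N) auto
    then have "N (l *\<^sub>R (x j - y j)) < \<bar>l\<bar> * e"
      using v(2) unfolding w(2) vy by (metis le_less_trans scaleR_diff_right)
    then show ?thesis using l by (simp add: Ns)
  qed
  moreover have "E \<notin> sspec (\<lambda>n. l * flatten y n)"
  proof -
    have "bounded (range (flatten (periodize v)))" using Per_flatten[OF periodize_Per(1)[OF v(1)]] by blast
    moreover have "flatten (periodize v) = (\<lambda>n. l * flatten y n)" by (rule ext) (simp only: vy flatten_scaleR)
    ultimately show ?thesis using v(3) spectrum_schroedinger[of "\<lambda>n. l * flatten y n"] by (auto simp: H_def)
  qed
  ultimately show ?thesis by blast
qed

theorem theorem2p9:
  fixes N :: "real ^ 'k::{finite,linorder} \<Rightarrow> real"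
    and S :: "real set" and Y :: "(real ^ 'k::{finite,linorder}) set" and Z :: "real set"
  assumes "is_norm N"
    and "discrete S"
    and "perfect Y"
    and "Z \<subseteq> UNIV - {0}"
    and "sigma_compact Z"
    and "\<And>l. l \<in> Z \<Longrightarrow> gap_rich N ((*\<^sub>R) l ` Y) S"
  shows "\<exists>G. gdelta_in (LP_topology N Y) G \<and> LP_topology N Y closure_of G = LP N Y \<and>
    (\<forall>y\<in>G. \<forall>l\<in>Z. \<exists>K. spectrum_l2 (H (\<lambda>j. l *\<^sub>R y j)) = complex_of_real ` K \<and>
       cantor_set K \<and> hausdorff_dim K = 0)"
proof -
  note N = assms(1)
  obtain C0 :: "nat \<Rightarrow> real set" where C0: "\<And>n. compact (C0 n)" "Z = (\<Union>n. C0 n)"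
    using assms(5) by (auto simp: sigma_compact_def)
  \<comment> \<open>Made increasing, so that a given l lies in all but finitely many of these sets
    and so receives covers of every large order.\<close>
  define C where "C = (\<lambda>n. \<Union>i\<le>n. C0 i)"
  have C: "compact (C n)" "C n \<subseteq> Z" for n using C0 by (auto simp: C_def)
  have Sc: "countable S" using assms(2) by (rule discrete_imp_countable)
  obtain c where c: "c > 0" "\<And>u. norm u \<le> c * N u" using is_norm_bounds[OF N] by metis
  have cN: "\<bar>u $ i\<bar> \<le> c * N u" for u i using component_le_norm_cart[of u i] c(2)[of u] by linarith
  have N0: "N 0 = 0" using N by (simp add: is_norm_def)
  define D where "D = mdist (seq_metric N Y)"
  define \<M> where "\<M> = mspace (seq_metric N Y)"
  define X where "X = mtopology_of (seq_metric N Y)"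
  interpret M: Metric_space \<M> D unfolding \<M>_def D_def by simp
  have Xtop: "X = M.mtopology" by (simp add: X_def mtopology_of_def \<M>_def D_def)
  have Dle: "D y z \<le> a \<longleftrightarrow> (\<forall>j. N (y j - z j) \<le> a)" if "y \<in> \<M>" "z \<in> \<M>" for y z a
    using seq_metric_dist_le[OF N] that by (simp add: D_def \<M>_def)
  have Per_M: "Per Y \<subseteq> \<M>" unfolding \<M>_def by (rule Per_subset_mspace[OF N])
  have LP: "LP N Y = X closure_of Per Y" by (simp add: LP_def X_def)
  have Per_LP: "Per Y \<subseteq> LP N Y" unfolding LP Xtop using Per_M by (intro closure_of_subset) simp
  have LP_M: "LP N Y \<subseteq> \<M>" unfolding LP Xtop using closure_of_subset_topspace[of M.mtopology] by simp
  have flat: "\<bar>flatten z n - flatten y n\<bar> \<le> c * D y z" if "y \<in> \<M>" "z \<in> \<M>" for y z n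
    using flatten_bounded_diff[of c N y z "D y z" n] cN Dle[OF that, of "D y z"] c(1) by simp
  \<comment> \<open>The covering property is demanded on a whole ball around z, so that the union of
    these balls is open by construction.\<close>
  define good where "good = (\<lambda>n z d. d > 0 \<and> (\<forall>y\<in>\<M>. D z y < d \<longrightarrow> (\<forall>l\<in>C n. small_cover (Suc n) (sspec (\<lambda>m. l * flatten y m)))))"
  define T where "T = (\<lambda>n. \<Union>z\<in>Per Y. \<Union>d\<in>{d. good n z d}. M.mball z d)"
  have good_ex: "\<exists>z\<in>Per Y. D x z < e \<and> (\<exists>d. good n z d)" if x: "x \<in> Per Y" and e: "e > 0" for x e n
  proof -
    obtain La where La: "La > 0" "\<And>l. l \<in> C n \<Longrightarrow> \<bar>l\<bar> \<le> La"
      using compact_imp_bounded[OF C(1), of n] unfolding bounded_pos by auto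
    have "\<exists>z\<in>Per Y. (\<forall>j. N (x j - z j) \<le> e / 2) \<and>
      (\<exists>d>0. \<forall>l\<in>C n. \<forall>W. (\<forall>m. \<bar>W m - l * flatten z m\<bar> \<le> d) \<longrightarrow> small_cover (Suc n) (sspec W))"
    proof (rule periodic_small_spectrum[OF x C(1) Sc _ c(1) cN N0])
      fix l E assume "l \<in> C n" "E \<notin> S"
      then show "\<exists>y\<in>Per Y. (\<forall>j. N (x j - y j) \<le> e / 2) \<and> E \<notin> sspec (\<lambda>n. l * flatten y n)"
        using C(2) assms(4,6) e by (intro gap_rich_periodic[OF N _ _ _ x]) auto
    qed (use e in auto)
    then obtain z d where z: "z \<in> Per Y" "\<And>j. N (x j - z j) \<le> e / 2" "d > 0"
      "\<And>l W. l \<in> C n \<Longrightarrow> (\<And>m. \<bar>W m - l * flatten z m\<bar> \<le> d) \<Longrightarrow> small_cover (Suc n) (sspec W)"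
      by metis
    have "D x z \<le> e / 2" using Dle Per_M x z(1,2) by blast
    then have "D x z < e" using e by simp
    \<comment> \<open>Passing from sequences to flattened potentials costs a factor c, and
      multiplying by the coupling at most La.\<close>
    moreover have "good n z (d / (La * c))" unfolding good_def
    proof (intro conjI ballI impI)
      show "d / (La * c) > 0" using z(3) La(1) c(1) by simp
      fix y l assume y: "y \<in> \<M>" "D z y < d / (La * c)" and l: "l \<in> C n"
      show "small_cover (Suc n) (sspec (\<lambda>m. l * flatten y m))"
      proof (rule z(4)[OF l])
        fix m
        have "\<bar>l * flatten y m - l * flatten z m\<bar> = \<bar>l\<bar> * \<bar>flatten y m - flatten z m\<bar>"
          by (simp flip: abs_mult right_diff_distrib)
        also have "\<dots> \<le> La * (c * D z y)"
          using La(1) La(2)[OF l] flat[of z y m] y(1) z(1) Per_M by (intro mult_mono) auto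
        also have "\<dots> \<le> d" using y(2) La(1) c(1) by (simp add: field_simps)
        finally show "\<bar>l * flatten y m - l * flatten z m\<bar> \<le> d" .
      qed
    qed
    ultimately show ?thesis using z(1) by blast
  qed
  define U where "U = (\<lambda>n. T n \<inter> LP N Y)"
  have Topen: "openin X (T n)" for n unfolding T_def Xtop by (intro openin_Union) auto
  have Uopen: "openin (LP_topology N Y) (U n)" for n
    using Topen[of n] unfolding LP_topology_def U_def X_def openin_subtopology by blast
  have Udense: "LP_topology N Y closure_of U n = topspace (LP_topology N Y)" for n
    unfolding dense_intersects_open
  proof (intro allI impI)
    fix W assume W: "openin (LP_topology N Y) W \<and> W \<noteq> {}"
    then obtain W' where W': "openin X W'" "W = W' \<inter> LP N Y"
      unfolding LP_topology_def X_def openin_subtopology by blast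
    then obtain w where "w \<in> W'" "w \<in> X closure_of Per Y" using W by (auto simp: LP)
    then obtain x where x: "x \<in> Per Y" "x \<in> W'" using W'(1) unfolding in_closure_of by blast
    then obtain r where r: "r > 0" "M.mball x r \<subseteq> W'" using W'(1) unfolding Xtop M.openin_mtopology by blast
    obtain z d where z: "z \<in> Per Y" "D x z < r" "good n z d" using good_ex[OF x(1) r(1)] by blast
    have zM: "z \<in> \<M>" "x \<in> \<M>" using z(1) x(1) Per_M by auto
    have "z \<in> W'" using r(2) z(2) zM by auto
    moreover have "z \<in> T n"
    proof -
      have "z \<in> M.mball z d" using z(3) zM by (simp add: good_def)
      then show ?thesis unfolding T_def using z(1,3) by blast
    qed
    ultimately show "U n \<inter> W \<noteq> {}" using z(1) Per_LP W'(2) by (auto simp: U_def)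
  qed
  define G where "G = \<Inter> (range U)"
  have "gdelta_in (LP_topology N Y) G" unfolding G_def
    by (rule gdelta_in_Inter) (auto intro: open_imp_gdelta_in Uopen)
  \<comment> \<open>Closedness of Y makes the space of bounded sequences complete, and with it the
    closed subset \<open>LP N Y\<close>, so Baire's theorem applies.\<close>
  moreover have "LP_topology N Y closure_of G = LP N Y"
    unfolding G_def topspace_LP_topology[symmetric]
    by (rule Baire_category) (use completely_metrizable_LP[OF N] assms(3) Uopen Udense in \<open>auto simp: perfect_def\<close>)
  moreover have "\<exists>K. spectrum_l2 (H (\<lambda>j. l *\<^sub>R y j)) = complex_of_real ` K \<and> cantor_set K \<and> hausdorff_dim K = 0"
    if y: "y \<in> G" and l: "l \<in> Z" for y l
  proof -
    define V where "V = (\<lambda>n. l * flatten y n)"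
    have yU: "y \<in> U n" for n using y by (auto simp: G_def)
    then have yLP: "y \<in> LP N Y" and yM: "y \<in> \<M>" using LP_M by (auto simp: U_def)
    have approx: "\<exists>z\<in>Per Y. \<forall>n. \<bar>V n - l * flatten z n\<bar> \<le> e" if e: "e > 0" for e
    proof -
      have "l \<noteq> 0" using l assms(4) by blast
      then have l0: "\<bar>l\<bar> * c > 0" using c(1) by simp
      then have "e / (\<bar>l\<bar> * c) > 0" using e by simp
      then obtain z where z: "z \<in> Per Y" "D y z < e / (\<bar>l\<bar> * c)"
        using yLP unfolding LP Xtop M.metric_closure_of by auto
      have "\<bar>V n - l * flatten z n\<bar> \<le> e" for n
      proof -
        have "\<bar>V n - l * flatten z n\<bar> = \<bar>l\<bar> * \<bar>flatten z n - flatten y n\<bar>"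
          by (simp add: V_def abs_minus_commute flip: abs_mult right_diff_distrib)
        also have "\<dots> \<le> \<bar>l\<bar> * (c * D y z)" using flat[of y z n] yM z(1) Per_M by (intro mult_left_mono) auto
        also have "\<dots> \<le> e" using z(2) l0 by (simp add: pos_less_divide_eq algebra_simps)
        finally show ?thesis .
      qed
      then show ?thesis using z(1) by blast
    qed
    have per: "\<exists>q. q \<ge> (1::int) \<and> bounded (range (\<lambda>n. l * flatten z n)) \<and> (\<forall>n. l * flatten z (n + q) = l * flatten z n)"
      if z: "z \<in> Per Y" for z
    proof -
      obtain q :: nat where q: "q \<ge> 1" "\<And>j. z (j + int q) = z j" using z by (auto simp: Per_def)
      have per: "flatten z (n + int q * int CARD('k)) = flatten z n" for n using q(2) by (rule flatten_periodic)
      have q': "int q * int CARD('k) \<ge> 1" using q(1) by (simp add: Suc_le_eq int_one_le_iff_zero_less)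
      have "bounded (range (\<lambda>n. l * flatten z n))"
        using q' per by (intro bounded_range_periodic[of "int q * int CARD('k)"]) auto
      then show ?thesis using q' per by (intro exI[of _ "int q * int CARD('k)"]) simp
    qed
    have bV: "bounded (range V)"
    proof -
      obtain z where z: "z \<in> Per Y" "\<And>n. \<bar>V n - l * flatten z n\<bar> \<le> 1" using approx[of 1] by auto
      obtain b where b: "\<And>n. \<bar>l * flatten z n\<bar> \<le> b" using per[OF z(1)] bounded_range_real by metis
      have "\<bar>V n\<bar> \<le> b + 1" for n using z(2)[of n] b[of n] by linarith
      then show ?thesis by (auto simp: bounded_iff)
    qed
    obtain i where i: "l \<in> C0 i" using l C0(2) by blast
    have sc: "small_cover n (sspec V)" if "n \<ge> Suc i" for n
    proof -
      obtain m where m: "n = Suc m" "m \<ge> i" using \<open>n \<ge> Suc i\<close> by (cases n) auto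
      have "l \<in> C m" using i m(2) by (auto simp: C_def)
      moreover obtain z d where "good m z d" "y \<in> M.mball z d" using yU[of m] by (auto simp: U_def T_def)
      ultimately show ?thesis using yM by (auto simp: good_def V_def m(1))
    qed
    have "H (\<lambda>j. l *\<^sub>R y j) = schroedinger V" by (simp add: H_def V_def flatten_scaleR[abs_def] ext)
    then have "spectrum_l2 (H (\<lambda>j. l *\<^sub>R y j)) = complex_of_real ` sspec V"
      using spectrum_schroedinger[OF bV] by simp
    moreover have "cantor_set (sspec V)" unfolding cantor_set_def
    proof (intro conjI ballI)
      show "sspec V \<noteq> {}" by (rule sspec_nonempty[OF bV])
      show "compact (sspec V)" by (rule compact_sspec[OF bV])
      show "interior (sspec V) = {}" using sc by (rule interior_small_cover)
      show "\<not> E isolated_in sspec V" if "E \<in> sspec V" for E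
      proof (rule sspec_not_isolated[OF bV _ that])
        fix e :: real assume "e > 0"
        then show "\<exists>W q. q \<ge> (1::int) \<and> bounded (range W) \<and> (\<forall>n. W (n + q) = W n) \<and> (\<forall>n. \<bar>V n - W n\<bar> \<le> e)"
          using approx[of e] per by metis
      qed
    qed
    moreover have "hausdorff_dim (sspec V) = 0" using sc by (rule hausdorff_dim_small_cover)
    ultimately show ?thesis by blast
  qed
  ultimately show ?thesis by blast
qed

end
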